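(* Let $n\ge 1$ be an integer, let $\sigma\ge 1$ and $\delta\in[0,\sigma)$ be real numbers (not necessarily integers), put $\mathtt{k}^-:=\min\{\sigma,2\delta\}$, and assume $n>2\mathtt{k}^-$. Let $u_1\in L^1(\mathbb{R}^n)$ satisfy $\int_{\mathbb{R}^n}u_1(x)\,dx>0$, and let $$p\in\Big(1,\;1+\frac{2\sigma}{n-\mathtt{k}^-}\Big).$$ Then there exist constants $\varepsilon_0>0$ and $C>0$ such that for every $\varepsilon\in(0,\varepsilon_0]$ the lifespan $T_\varepsilon$ of Sobolev solutions to the Cauchy problem $$\begin{cases}u_{tt}+(-\Delta)^\sigma u+(-\Delta)^\delta u_t=|u|^p, & t>0,\ x\in\mathbb{R}^n,\\ u(0,x)=0,\quad u_t(0,x)=\varepsilon u_1(x), & x\in\mathbb{R}^n,\end{cases}$$ satisfies $$T_\varepsilon\le C\,\varepsilon^{-\frac{(2\sigma-\mathtt{k}^-)(p-1)}{2\sigma-(n-\mathtt{k}^-)(p-1)}} .$$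
   Context: $H^{a}=H^a(\mathbb{R}^n)$, $a\ge 0$, denotes the Bessel potential (Sobolev) space based on $L^2$. For $\gamma\ge 0$, $(-\Delta)^\gamma$ is the operator with Fourier symbol $|\xi|^{2\gamma}$ acting in the spatial variable ($(-\Delta)^0$ is the identity). Solutions are real-valued. For $T\in(0,\infty]$, a Sobolev solution on $[0,T)$ with data $(0,\varepsilon u_1)$ is a function $u\in C([0,T),H^{2\sigma}(\mathbb{R}^n))$ satisfying the equation and initial conditions in the usual weak sense: $|u|^p\in L^1_{loc}([0,T)\times\mathbb{R}^n)$, $u(0,\cdot)=0$, and for all $\phi\in C_c^\infty([0,T)\times\mathbb{R}^n)$ $$\int_0^T\!\!\int_{\mathbb{R}^n}|u|^p\phi\,dx\,dt+\varepsilon\int_{\mathbb{R}^n}u_1(x)\phi(0,x)\,dx=\int_0^T\!\!\int_{\mathbb{R}^n}u\,\big(\partial_t^2\phi+(-\Delta)^\sigma\phi-(-\Delta)^\delta\partial_t\phi\big)\,dx\,dt .$$ The lifespan $T_\varepsilon$ is the supremum of all $T>0$ for which a Sobolev solution on $[0,T)$ with data $(0,\varepsilon u_1)$ exists (with the convention that the supremum of the empty set is $0$). The constants $\varepsilon_0$ and $C$ may depend on $n,\sigma,\delta,p,u_1$ but not on $\varepsilon$. *)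

theory Defs
  imports "HOL-Analysis.Analysis"
begin

section \<open>The Fourier transform and Bessel potential spaces\<close>

definition fourier :: "('a::euclidean_space \<Rightarrow> real) \<Rightarrow> 'a \<Rightarrow> complex" where
  "fourier f \<xi> = (LINT x|lborel. cis (- (x \<bullet> \<xi>)) * complex_of_real (f x))"

definition L2_fun :: "('a::euclidean_space \<Rightarrow> real) \<Rightarrow> bool" where
  "L2_fun f \<longleftrightarrow> f \<in> borel_measurable lborel \<and> integrable lborel (\<lambda>x. (f x)\<^sup>2)"

text \<open>The Fourier--Plancherel transform of an \<open>L\<^sup>2\<close> function is the \<open>L\<^sup>2\<close> limit, as
  \<open>R\<close> tends to infinity, of the transforms of its truncations to balls of radius \<open>R\<close>; it is
  determined up to null sets. The limit is expressed with a nonnegative integral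
  because a Bochner integral would silently be \<open>0\<close> for non-integrable differences.\<close>

definition has_fourier_L2 ::
    "('a::euclidean_space \<Rightarrow> real) \<Rightarrow> ('a \<Rightarrow> complex) \<Rightarrow> bool" where
  "has_fourier_L2 f g \<longleftrightarrow>
     g \<in> borel_measurable lborel \<and>
     integrable lborel (\<lambda>\<xi>. (cmod (g \<xi>))\<^sup>2) \<and>
     ((\<lambda>R::real. \<integral>\<^sup>+ \<xi>. ennreal ((cmod (fourier (\<lambda>x. indicator (ball 0 R) x * f x) \<xi> - g \<xi>))\<^sup>2) \<partial>lborel)
        \<longlongrightarrow> 0) at_top"

definition fourier_L2 :: "('a::euclidean_space \<Rightarrow> real) \<Rightarrow> 'a \<Rightarrow> complex" where
  "fourier_L2 f = (SOME g. has_fourier_L2 f g)"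

definition sobolev_space :: "real \<Rightarrow> ('a::euclidean_space \<Rightarrow> real) set" where
  "sobolev_space a = {f. L2_fun f \<and>
     (\<exists>g. has_fourier_L2 f g \<and>
          integrable lborel (\<lambda>\<xi>. (1 + (norm \<xi>)\<^sup>2) powr a * (cmod (g \<xi>))\<^sup>2))}"

definition sobolev_norm :: "real \<Rightarrow> ('a::euclidean_space \<Rightarrow> real) \<Rightarrow> real" where
  "sobolev_norm a f =
     sqrt (LINT \<xi>|lborel. (1 + (norm \<xi>)\<^sup>2) powr a * (cmod (fourier_L2 f \<xi>))\<^sup>2)"

text \<open>Continuous curves in the Bessel potential space of order \<open>a\<close>. A curve of \<open>L\<^sup>2\<close> classes is
  represented by a function of time and space; its joint measurability is part of
  \<open>sobolev_solution\<close> below.\<close>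

definition continuous_in_sobolev ::
    "real set \<Rightarrow> real \<Rightarrow> (real \<Rightarrow> 'a::euclidean_space \<Rightarrow> real) \<Rightarrow> bool" where
  "continuous_in_sobolev I a u \<longleftrightarrow>
     (\<forall>t\<in>I. u t \<in> sobolev_space a) \<and>
     (\<forall>t\<in>I. ((\<lambda>s. sobolev_norm a (\<lambda>x. u s x - u t x)) \<longlongrightarrow> 0) (at t within I))"

section \<open>The fractional Laplacian on test functions\<close>

text \<open>For \<open>\<gamma> = 0\<close> the first branch agrees with the second by Fourier inversion. For real
  \<open>f\<close> the inverse transform is real because the symbol is even, so \<open>Re\<close> only changes the type.\<close>

definition frac_laplacian ::
    "real \<Rightarrow> ('a::euclidean_space \<Rightarrow> real) \<Rightarrow> 'a \<Rightarrow> real" where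
  "frac_laplacian \<gamma> f x =
     (if \<gamma> = 0 then f x
      else Re (LINT \<xi>|lborel. cis (x \<bullet> \<xi>) * complex_of_real (norm \<xi> powr (2 * \<gamma>)) * fourier f \<xi>)
             / (2 * pi) ^ DIM('a))"

section \<open>Test functions\<close>

primrec C_k :: "nat \<Rightarrow> ('a::euclidean_space \<Rightarrow> real) \<Rightarrow> bool" where
  "C_k 0 f \<longleftrightarrow> continuous_on UNIV f"
| "C_k (Suc k) f \<longleftrightarrow>
     (\<forall>x. f differentiable (at x)) \<and>
     (\<forall>b\<in>Basis. C_k k (\<lambda>x. frechet_derivative f (at x) b))"

text \<open>\<open>time_interval T\<close> is \<open>[0,T)\<close>. Test functions on \<open>[0,T) \<times> \<real>\<^sup>n\<close> (not required to vanish
  at \<open>t = 0\<close>) are the restrictions of smooth functions on the whole space-time with compact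
  support in \<open>(-\<infinity>,T) \<times> \<real>\<^sup>n\<close>; only their values and derivatives for \<open>t \<ge> 0\<close> are used.
  Note that \<open>ennreal t = 0\<close> for \<open>t < 0\<close>.\<close>

definition time_interval :: "ennreal \<Rightarrow> real set" where
  "time_interval T = {t. 0 \<le> t \<and> ennreal t < T}"

definition test_function :: "ennreal \<Rightarrow> (real \<times> 'a::euclidean_space \<Rightarrow> real) \<Rightarrow> bool" where
  "test_function T \<phi> \<longleftrightarrow>
     (\<forall>k. C_k k \<phi>) \<and>
     compact (closure {z. \<phi> z \<noteq> 0}) \<and>
     closure {z. \<phi> z \<noteq> 0} \<subseteq> {t. ennreal t < T} \<times> UNIV"

definition dt :: "(real \<times> 'a \<Rightarrow> real) \<Rightarrow> real \<times> 'a \<Rightarrow> real" where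
  "dt \<phi> = (\<lambda>(t, x). deriv (\<lambda>s. \<phi> (s, x)) t)"

section \<open>Sobolev solutions and their lifespan\<close>

text \<open>Sobolev solutions on \<open>[0,T)\<close> of
  \<open>u\<^sub>t\<^sub>t + (-\<Delta>)\<^sup>\<sigma> u + (-\<Delta>)\<^sup>\<delta> u\<^sub>t = |u|\<^sup>p\<close> with data \<open>u(0) = 0\<close>, \<open>u\<^sub>t(0) = v\<close>.\<close>

definition sobolev_solution ::
    "real \<Rightarrow> real \<Rightarrow> real \<Rightarrow> ('a::euclidean_space \<Rightarrow> real) \<Rightarrow> ennreal \<Rightarrow> (real \<Rightarrow> 'a \<Rightarrow> real) \<Rightarrow> bool"
  where
  "sobolev_solution \<sigma> \<delta> p v T u \<longleftrightarrow>
     set_borel_measurable lborel (time_interval T \<times> UNIV) (\<lambda>(t, x). u t x) \<and>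
     continuous_in_sobolev (time_interval T) (2 * \<sigma>) u \<and>
     (\<forall>K. compact K \<and> K \<subseteq> time_interval T \<times> UNIV \<longrightarrow>
        set_integrable lborel K (\<lambda>(t, x). \<bar>u t x\<bar> powr p)) \<and>
     (AE x in lborel. u 0 x = 0) \<and>
     (\<forall>\<phi>. test_function T \<phi> \<longrightarrow>
        (LINT t:time_interval T|lborel. LINT x|lborel. \<bar>u t x\<bar> powr p * \<phi> (t, x))
          + (LINT x|lborel. v x * \<phi> (0, x))
        = (LINT t:time_interval T|lborel. LINT x|lborel.
             u t x * (dt (dt \<phi>) (t, x)
                      + frac_laplacian \<sigma> (\<lambda>y. \<phi> (t, y)) x
                      - frac_laplacian \<delta> (\<lambda>y. dt \<phi> (t, y)) x)))"

text \<open>In \<open>ennreal\<close> the supremum of the empty set is \<open>0\<close>, and \<open>T = \<infinity>\<close> is allowed.\<close>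

definition lifespan ::
    "real \<Rightarrow> real \<Rightarrow> real \<Rightarrow> ('a::euclidean_space \<Rightarrow> real) \<Rightarrow> real \<Rightarrow> ennreal" where
  "lifespan \<sigma> \<delta> p u1 \<epsilon> =
     Sup {T. 0 < T \<and> (\<exists>u. sobolev_solution \<sigma> \<delta> p (\<lambda>x. \<epsilon> * u1 x) T u)}"

definition k_minus :: "real \<Rightarrow> real \<Rightarrow> real" where
  "k_minus \<sigma> \<delta> = min \<sigma> (2 * \<delta>)"

end

(* Test function method with a compactly supported test function whose spatial part
   superposes dyadic dilates of one smooth bump f with weights 2^(-qj), where n < q <= n + 2 gamma
   for every nonzero order gamma that occurs. The bound |L f(x)| <= C min(1, |x|^(-q)) for
   L = (-Delta)^gamma then gives |L F| <= C K^(-2 gamma) F on the region where the superposition F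
   lives, with constants independent of the number J of scales, and outside it a remainder of size
   |x|^(-q), which tends to 0 in L^2 as J grows; a local bound for the L^2 norm of u(t), which comes
   from a non-sharp Plancherel inequality, removes this remainder. Young's inequality absorbs |u|
   into the |u|^p term, and with time scale R = K^(2 sigma - k^-) what is left says
   eps <= C K^(-s) for every K with R < T. *)
theory Submission
  imports Defs "HOL-Probability.Probability"
begin

section \<open>Smooth functions\<close>

text \<open>For non-integer gamma the operator is nonlocal: applied to a compactly supported
  function it leaves in general a tail of size |x|^(-n-2 gamma), which no multiple of the function
  itself dominates. A weight such as (1 + |x|^2)^(-q/2) would dominate it but lacks the compact
  support demanded of test functions; the dyadic sum is its truncated substitute. The condition q >
  n keeps the integral of F of order K^n uniformly in J. The bound N for the squared L^2 norm
  depends on u and on R. This is harmless because the remainder enters as tau N + t_J / tau: J tends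
  to infinity at fixed tau, and then tau to 0. The time scale R = K^alpha must make R^(-2) and
  R^(-1) K^(-2 delta) at most K^(-2 sigma), that is, alpha >= sigma and alpha >= 2 sigma - 2 delta;
  the least such alpha is 2 sigma - k^-. The remaining bound R K^n K^(-2 sigma p / (p - 1)) is
  K^(-s) with s = 2 sigma / (p - 1) - (n - k^-), positive exactly below the critical
  exponent.\<close>

lemma C_k_SucI:
  fixes f :: "'a::euclidean_space \<Rightarrow> real"
  assumes "\<And>x. (f has_derivative D x) (at x)" "\<And>b. b \<in> Basis \<Longrightarrow> C_k k (\<lambda>x. D x b)"
  shows "C_k (Suc k) f"
proof -
  have "frechet_derivative f (at x) = D x" for x
    using frechet_derivative_at[OF assms(1)] by simp
  with assms show ?thesis by (auto simp: differentiable_def)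
qed

lemma C_k_SucD:
  fixes f :: "'a::euclidean_space \<Rightarrow> real"
  assumes "C_k (Suc k) f"
  shows "(f has_derivative frechet_derivative f (at x)) (at x)"
    "b \<in> Basis \<Longrightarrow> C_k k (\<lambda>x. frechet_derivative f (at x) b)"
  using assms by (auto simp: frechet_derivative_works[symmetric])

lemma C_k_Suc_imp: "C_k (Suc k) f \<Longrightarrow> C_k k f"
proof (induction k arbitrary: f)
  case 0
  then show ?case
    by (auto intro!: continuous_at_imp_continuous_on differentiable_imp_continuous_within)
next
  case (Suc k)
  note D = C_k_SucD[OF Suc.prems]
  show ?case by (rule C_k_SucI[OF D(1)]) (rule Suc.IH[OF D(2)])
qed

lemma C_k_const: "C_k k (\<lambda>_. c)"
proof (induction k arbitrary: c)
  case (Suc k)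
  show ?case by (rule C_k_SucI[where D = "\<lambda>_ _. 0"]) (auto intro: Suc)
qed auto

lemma C_k_bounded_linear:
  assumes "bounded_linear f" shows "C_k k f"
proof (cases k)
  case 0
  then show ?thesis using assms by (auto intro: linear_continuous_on)
next
  case (Suc l)
  show ?thesis unfolding Suc
    by (rule C_k_SucI[where D = "\<lambda>_. f"])
      (auto intro: C_k_const bounded_linear_imp_has_derivative assms)
qed

lemma C_k_add: "C_k k f \<Longrightarrow> C_k k g \<Longrightarrow> C_k k (\<lambda>x. f x + g x)"
proof (induction k arbitrary: f g)
  case 0 then show ?case by (auto intro: continuous_intros)
next
  case (Suc k)
  note D = C_k_SucD[OF Suc.prems(1)] C_k_SucD[OF Suc.prems(2)]
  show ?case
    by (rule C_k_SucI[OF has_derivative_add[OF D(1) D(3)]]) (intro Suc.IH D)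
qed

lemma C_k_mult: "C_k k f \<Longrightarrow> C_k k g \<Longrightarrow> C_k k (\<lambda>x. f x * g x)"
proof (induction k arbitrary: f g)
  case 0 then show ?case by (auto intro: continuous_intros)
next
  case (Suc k)
  note D = C_k_SucD[OF Suc.prems(1)] C_k_SucD[OF Suc.prems(2)]
  show ?case
    by (rule C_k_SucI[OF has_derivative_mult[OF D(1) D(3)]])
      (intro C_k_add Suc.IH D C_k_Suc_imp[OF Suc.prems(1)] C_k_Suc_imp[OF Suc.prems(2)])
qed

lemma C_k_sum: "(\<And>i. i \<in> A \<Longrightarrow> C_k k (f i)) \<Longrightarrow> C_k k (\<lambda>x. \<Sum>i\<in>A. f i x)"
  by (induction A rule: infinite_finite_induct) (auto intro: C_k_const C_k_add)

lemma C_k_prod: "(\<And>i. i \<in> A \<Longrightarrow> C_k k (f i)) \<Longrightarrow> C_k k (\<lambda>x. \<Prod>i\<in>A. f i x)"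
  by (induction A rule: infinite_finite_induct) (auto intro: C_k_const C_k_mult)

lemma C_k_power: "C_k k f \<Longrightarrow> C_k k (\<lambda>x. f x ^ m)"
  by (induction m) (auto intro: C_k_const C_k_mult)

lemma C_k_compose:
  fixes g :: "real \<Rightarrow> real" and f :: "'a::euclidean_space \<Rightarrow> real"
  shows "C_k k g \<Longrightarrow> C_k k f \<Longrightarrow> C_k k (\<lambda>x. g (f x))"
proof (induction k arbitrary: f g)
  case 0 then show ?case by (auto intro: continuous_on_compose2)
next
  case (Suc k)
  note Dg = C_k_SucD[OF Suc.prems(1)] and Df = C_k_SucD[OF Suc.prems(2)]
  \<comment> \<open>A linear map on the reals is multiplication by its value at 1. This turns the
    chain rule into a product of two scalar functions, to which \<open>C_k_mult\<close> and the
    induction hypothesis apply.\<close>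
  have scale: "frechet_derivative g (at y) v = frechet_derivative g (at y) 1 * v" for y v
    using linear_scale[OF has_derivative_linear[OF Dg(1)[of y]], of v 1]
    by (metis mult.commute mult.right_neutral real_scaleR_def)
  show ?case
  proof (rule C_k_SucI)
    show "((\<lambda>x. g (f x)) has_derivative
        (\<lambda>v. frechet_derivative g (at (f x)) (frechet_derivative f (at x) v))) (at x)" for x
      by (rule has_derivative_compose[OF Df(1) Dg(1)])
  next
    fix b :: 'a assume b: "b \<in> Basis"
    have "C_k k (\<lambda>x. frechet_derivative g (at (f x)) 1 * frechet_derivative f (at x) b)"
      by (rule C_k_mult[OF Suc.IH[OF Dg(2) C_k_Suc_imp[OF Suc.prems(2)]] Df(2)[OF b]]) simp
    then show "C_k k (\<lambda>x. frechet_derivative g (at (f x)) (frechet_derivative f (at x) b))"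
      by (subst scale)
  qed
qed

lemma C_k_Suc_real:
  assumes "\<And>x. (g has_real_derivative g' x) (at x)" "C_k k g'"
  shows "C_k (Suc k) g"
  using C_k_SucI[of g "\<lambda>x h. g' x * h" k] assms by (auto simp: has_field_derivative_def)

lemma C_k_Suc_realE:
  fixes f :: "real \<Rightarrow> real"
  assumes "C_k (Suc k) f"
  obtains f' where "\<And>t. (f has_real_derivative f' t) (at t)" "C_k k f'"
proof -
  define f' where "f' t = frechet_derivative f (at t) 1" for t
  note D = C_k_SucD[OF assms]
  have "frechet_derivative f (at t) = (*) (f' t)" for t
    using linear_scale[OF has_derivative_linear[OF D(1)[of t]], of _ 1]
    by (intro ext) (metis f'_def mult.commute mult.right_neutral real_scaleR_def)
  with D(1) have "(f has_real_derivative f' t) (at t)" for t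
    unfolding has_field_derivative_def by metis
  moreover have "C_k k f'" unfolding f'_def using D(2) by simp
  ultimately show thesis by (rule that)
qed

text \<open>The set where r < |t| is open, so the function is locally zero there. The same r
  therefore serves for successive derivatives, and integration by parts has no boundary
  terms.\<close>

lemma deriv_zero_off_support:
  fixes f :: "real \<Rightarrow> real"
  assumes "\<And>t. (f has_real_derivative f' t) (at t)" "\<And>t. r < \<bar>t\<bar> \<Longrightarrow> f t = 0" "r < \<bar>t\<bar>"
  shows "f' t = 0"
proof -
  have "open {t. r < \<bar>t\<bar>}" by (intro open_Collect_less continuous_intros)
  then have "((\<lambda>_. 0) has_real_derivative f' t) (at t)"
    by (rule has_field_derivative_transform_within_open[OF assms(1)]) (use assms in auto)
  then show ?thesis by (metis DERIV_const DERIV_unique)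
qed

section \<open>A smooth bump function\<close>

text \<open>\<open>flat 1\<close> is the classical exp (-1/t) extended by 0. The polynomial in 1/t
  makes the family closed under differentiation, so a single induction over all P proves
  smoothness.\<close>

definition flat :: "real poly \<Rightarrow> real \<Rightarrow> real" where
  "flat P t = (if t > 0 then poly P (1 / t) * exp (- (1 / t)) else 0)"

lemma poly_exp_tendsto_0:
  "((\<lambda>y. poly P y * exp (- y)) \<longlongrightarrow> 0) at_top" for P :: "real poly"
proof -
  have "((\<lambda>y. \<Sum>i\<le>degree P. coeff P i * (y ^ i / exp y)) \<longlongrightarrow> (\<Sum>i\<le>degree P. coeff P i * 0)) at_top"
    by (intro tendsto_sum tendsto_mult tendsto_const tendsto_power_div_exp_0)
  then show ?thesis
    by (simp add: poly_altdef sum_distrib_right exp_minus divide_inverse mult.assoc)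
qed

text \<open>In the variable y = 1/t one has d/dt = -y^2 d/dy, which sends P(y) exp (-y) to y^2 (P -
  P')(y) exp (-y); the two \<open>pCons 0\<close> are the factor y^2. At t = 0 the claim rests on
  exponential decay beating powers of 1/t.\<close>

lemma flat_has_derivative:
  "(flat P has_real_derivative flat (pCons 0 (pCons 0 (P - pderiv P))) t) (at t)"
proof -
  consider "t > 0" | "t < 0" | "t = 0" by linarith
  then show ?thesis
  proof cases
    case 1
    have "((\<lambda>t. poly P (1 / t) * exp (- (1 / t))) has_real_derivative
        flat (pCons 0 (pCons 0 (P - pderiv P))) t) (at t)"
      using 1 by (auto intro!: derivative_eq_intros poly_DERIV[THEN DERIV_chain2]
          simp: flat_def field_simps power2_eq_square)
    then show ?thesis
      by (rule has_field_derivative_transform_within_open[where S = "{0<..}"])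
        (use 1 in \<open>auto simp: flat_def\<close>)
  next
    case 2
    have "((\<lambda>_. 0) has_real_derivative 0) (at t)" by simp
    then have "(flat P has_real_derivative 0) (at t)"
      by (rule has_field_derivative_transform_within_open[where S = "{..<0}"])
        (use 2 in \<open>auto simp: flat_def\<close>)
    with 2 show ?thesis by (simp add: flat_def)
  next
    case 3
    have l: "((\<lambda>h. flat P h / h) \<longlongrightarrow> 0) (at_left 0)"
      by (rule tendsto_eventually) (auto simp: eventually_at_filter flat_def)
    \<comment> \<open>For h > 0 the difference quotient at 0 is y P(y) exp (-y) with y = 1/h, again
      a polynomial times exp (-y).\<close>
    have "((\<lambda>y. poly (pCons 0 P) y * exp (- y)) \<longlongrightarrow> 0) at_top"
      by (rule poly_exp_tendsto_0)
    then have "((\<lambda>h. poly (pCons 0 P) (inverse h) * exp (- inverse h)) \<longlongrightarrow> 0) (at_right 0)"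
      by (rule filterlim_compose) (rule filterlim_inverse_at_top_right)
    moreover have "eventually (\<lambda>h. poly (pCons 0 P) (inverse h) * exp (- inverse h) = flat P h / h) (at_right 0)"
      by (auto simp: eventually_at_filter flat_def field_simps)
    ultimately have r: "((\<lambda>h. flat P h / h) \<longlongrightarrow> 0) (at_right 0)"
      by (rule Lim_transform_eventually)
    show ?thesis unfolding 3 DERIV_def
      using filterlim_split_at[OF l r] by (simp add: flat_def)
  qed
qed

lemma C_k_flat: "C_k k (flat P)"
proof (induction k arbitrary: P)
  case 0
  show ?case
    by (auto intro!: continuous_at_imp_continuous_on DERIV_isCont flat_has_derivative)
next
  case (Suc k)
  show ?case by (rule C_k_Suc_real[OF flat_has_derivative Suc])
qed

text \<open>The inner \<open>flat\<close> vanishes for \<open>\<bar>t\<bar> \<le> 1\<close>, which gives the plateau, and exceeds \<open>exp (-1/3)\<close>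
  for \<open>\<bar>t\<bar> \<ge> 2\<close>, which makes the outer one vanish.\<close>

definition bump :: "real \<Rightarrow> real" where
  "bump t = flat 1 (1 - exp (1 / 3) * flat 1 (t\<^sup>2 - 1)) * exp 1"

lemma flat_1: "flat 1 s = (if s > 0 then exp (- (1 / s)) else 0)"
  by (simp add: flat_def)

lemma C_k_bump: "C_k k bump"
proof -
  have id: "C_k k (\<lambda>t::real. t)" by (rule C_k_bounded_linear) (rule bounded_linear_ident)
  have "C_k k (\<lambda>t. flat 1 (1 + (- exp (1 / 3)) * flat 1 (t * t + - 1)) * exp 1)"
    by (intro C_k_mult C_k_compose[OF C_k_flat] C_k_add C_k_const id)
  moreover have "(\<lambda>t. flat 1 (1 + (- exp (1 / 3)) * flat 1 (t * t + - 1)) * exp 1) = bump"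
    by (simp add: bump_def fun_eq_iff power2_eq_square)
  ultimately show ?thesis by simp
qed

lemma bump_eq_1: "\<bar>t\<bar> \<le> 1 \<Longrightarrow> bump t = 1"
  using abs_square_le_1[of t] by (simp add: bump_def flat_1 exp_minus)

lemma bump_eq_0: assumes "2 \<le> \<bar>t\<bar>" shows "bump t = 0"
proof -
  have "2\<^sup>2 \<le> \<bar>t\<bar>\<^sup>2" using assms by (intro power_mono) auto
  then have t: "3 \<le> t\<^sup>2 - 1" by simp
  then have "exp (- (1 / 3)) \<le> exp (- (1 / (t\<^sup>2 - 1)))"
    by (simp add: field_simps)
  then have "exp (1 / 3) * exp (- (1 / 3)) \<le> exp (1 / 3) * exp (- (1 / (t\<^sup>2 - 1)))"
    by (intro mult_left_mono) auto
  then have "1 \<le> exp (1 / 3) * flat 1 (t\<^sup>2 - 1)" using t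
    by (simp add: flat_1 exp_minus del: mult_le_cancel_left_pos)
  then show ?thesis unfolding bump_def by (subst flat_1) auto
qed

lemma bump_nonneg: "0 \<le> bump t" and bump_le_1: "bump t \<le> 1"
proof -
  show "0 \<le> bump t" by (simp add: bump_def flat_1)
  have "flat 1 s \<le> exp (- 1)" if "s \<le> 1" for s
    using that by (auto simp: flat_1 field_simps)
  moreover have "1 - exp (1 / 3) * flat 1 (t\<^sup>2 - 1) \<le> 1" by (simp add: flat_1)
  ultimately have "bump t \<le> exp (- 1) * exp 1"
    unfolding bump_def by (intro mult_right_mono) auto
  then show "bump t \<le> 1" by (simp add: exp_minus)
qed

section \<open>Gaussians and the Fourier transform\<close>

text \<open>Fubini in coordinates. It reduces the Gaussian integrals, the transform of the bump and
  the integrable majorants on the whole space to their one-dimensional counterparts.\<close>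

lemma lborel_prod_Basis:
  fixes f :: "'a::euclidean_space \<Rightarrow> real \<Rightarrow> 'c::{real_normed_field,banach,second_countable_topology}"
  assumes f: "\<And>b. b \<in> Basis \<Longrightarrow> integrable lborel (f b)"
  shows integrable_lborel_prod: "integrable lborel (\<lambda>x::'a. \<Prod>b\<in>Basis. f b (x \<bullet> b))" (is ?I)
    and integral_lborel_prod:
      "(LINT x|lborel. (\<Prod>b\<in>Basis. f b (x \<bullet> b))) = (\<Prod>b\<in>Basis. (LINT t|lborel. f b t))" (is ?E)
proof -
  interpret product_sigma_finite "\<lambda>_::'a. lborel :: real measure" ..
  have [measurable]: "f b \<in> borel_measurable borel" if "b \<in> Basis" for b
    using borel_measurable_integrable[OF f[OF that]] by simp
  have T[measurable]: "(\<lambda>g. \<Sum>b\<in>Basis. g b *\<^sub>R b) \<in> (\<Pi>\<^sub>M b\<in>Basis. (lborel::real measure)) \<rightarrow>\<^sub>M (borel :: 'a measure)"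
    by measurable
  have m: "(\<lambda>x::'a. \<Prod>b\<in>Basis. f b (x \<bullet> b)) \<in> borel_measurable borel"
    by measurable
  have eq: "(\<lambda>g. \<Prod>b\<in>Basis. f b ((\<Sum>b\<in>Basis. g b *\<^sub>R b) \<bullet> b)) = (\<lambda>g. \<Prod>b\<in>Basis. f b (g b))"
    by (intro ext prod.cong refl) simp
  show ?I
    by (subst lborel_eq, subst integrable_distr_eq[OF T m], subst eq)
      (intro product_integrable_prod f finite_Basis)
  show ?E
    by (subst (1) lborel_eq, subst integral_distr[OF T m], subst eq)
      (intro product_integral_prod f finite_Basis)
qed

lemma cis_measurable [measurable]:
  "f \<in> borel_measurable M \<Longrightarrow> (\<lambda>x. cis (f x)) \<in> borel_measurable M"
  unfolding cis_conv_exp by measurable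

lemma gaussian_fourier_real:
  assumes "0 < s"
  shows "integrable lborel (\<lambda>x::real. cis (z * x) * complex_of_real (exp (- s * x\<^sup>2)))" (is ?I)
    and "(LINT x|lborel. cis (z * x) * complex_of_real (exp (- s * x\<^sup>2)))
       = complex_of_real (sqrt (pi / s) * exp (- z\<^sup>2 / (4 * s)))" (is ?E)
proof -
  \<comment> \<open>Rescaling by c turns the Gaussian into the standard normal density, so the known
    characteristic function gives the transform without contour integration.\<close>
  define c where "c = sqrt (2 * s)"
  have c: "c > 0" "c\<^sup>2 = 2 * s" using assms by (auto simp: c_def)
  have n: "std_normal_density (c * x) = exp (- s * x\<^sup>2) / sqrt (2 * pi)" for x
    using c by (simp add: std_normal_density_def power_mult_distrib)
  have "integrable lborel (\<lambda>x. std_normal_density (0 + c * x))"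
    using c by (intro lborel_integrable_real_affine) auto
  then have "integrable lborel (\<lambda>x. sqrt (2 * pi) * std_normal_density (0 + c * x))"
    by (intro integrable_mult_right)
  then have i: "integrable lborel (\<lambda>x. exp (- s * x\<^sup>2))"
    by (simp add: n)
  show ?I
    by (rule Bochner_Integration.integrable_bound[OF i]) (auto simp: norm_mult)
  have "complex_of_real (exp (- ((z / c)\<^sup>2) / 2)) = char std_normal_distribution (z / c)"
    by (simp add: char_std_normal_distribution)
  also have "\<dots> = (LINT x|lborel. std_normal_density x *\<^sub>R iexp (z / c * x))"
    unfolding char_def by (subst integral_density) (auto intro: normal_density_nonneg)
  also have "\<dots> = c *\<^sub>R (LINT x|lborel. std_normal_density (c * x) *\<^sub>R iexp (z / c * (c * x)))"
    using lborel_integral_real_affine[of c "\<lambda>x. std_normal_density x *\<^sub>R iexp (z / c * x)" 0] c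
    by simp
  also have "(\<lambda>x. std_normal_density (c * x) *\<^sub>R iexp (z / c * (c * x)))
      = (\<lambda>x. (1 / sqrt (2 * pi)) *\<^sub>R (cis (z * x) * complex_of_real (exp (- s * x\<^sup>2))))"
    using c by (intro ext) (simp add: n cis_conv_exp scaleR_conv_of_real)
  finally have "complex_of_real (exp (- ((z / c)\<^sup>2) / 2))
     = (c / sqrt (2 * pi)) *\<^sub>R (LINT x|lborel. cis (z * x) * complex_of_real (exp (- s * x\<^sup>2)))"
    by simp
  moreover have "sqrt (pi / s) * (c / sqrt (2 * pi)) = 1"
    using assms by (simp add: c_def real_sqrt_mult real_sqrt_divide)
  moreover have "- ((z / c)\<^sup>2) / 2 = - z\<^sup>2 / (4 * s)"
    using c by (simp add: power_divide)
  ultimately show ?E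
    by (metis (no_types, lifting) of_real_mult scaleR_conv_of_real scaleR_one scaleR_scaleR)
qed

lemma norm_sq_Basis: "(norm (x::'a::euclidean_space))\<^sup>2 = (\<Sum>b\<in>Basis. (x \<bullet> b)\<^sup>2)"
  unfolding power2_norm_eq_inner by (subst euclidean_inner) (simp add: power2_eq_square)

lemma gaussian_fourier:
  fixes z :: "'a::euclidean_space"
  assumes "0 < s"
  shows "integrable lborel (\<lambda>x. cis (z \<bullet> x) * complex_of_real (exp (- s * (norm x)\<^sup>2)))" (is ?I)
    and "(LINT x|lborel. cis (z \<bullet> x) * complex_of_real (exp (- s * (norm x)\<^sup>2)))
       = complex_of_real (sqrt (pi / s) ^ DIM('a) * exp (- (norm z)\<^sup>2 / (4 * s)))" (is ?E)
proof -
  have eq: "cis (z \<bullet> x) * complex_of_real (exp (- s * (norm x)\<^sup>2))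
      = (\<Prod>b\<in>Basis. cis ((z \<bullet> b) * (x \<bullet> b)) * complex_of_real (exp (- s * (x \<bullet> b)\<^sup>2)))" for x :: 'a
    by (simp add: cis_conv_exp euclidean_inner[of z x] norm_sq_Basis sum_distrib_left
        exp_sum prod.distrib flip: of_real_prod exp_sum sum_negf)
  show ?I unfolding eq
    by (rule integrable_lborel_prod) (rule gaussian_fourier_real(1)[OF assms])
  have "exp (- (norm z)\<^sup>2 / (4 * s)) = (\<Prod>b\<in>Basis. exp (- (z \<bullet> b)\<^sup>2 / (4 * s)))"
    by (simp add: norm_sq_Basis sum_divide_distrib flip: exp_sum sum_negf)
  then show ?E unfolding eq integral_lborel_prod[OF gaussian_fourier_real(1)[OF assms]]
      gaussian_fourier_real(2)[OF assms]
    by (simp only: of_real_prod[symmetric] prod.distrib prod_constant)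
qed

lemma gaussian_integral:
  assumes "0 < s"
  shows "integrable lborel (\<lambda>x::'a::euclidean_space. exp (- s * (norm x)\<^sup>2))"
    and "(LINT x|lborel. exp (- s * (norm (x::'a))\<^sup>2)) = sqrt (pi / s) ^ DIM('a)"
  using gaussian_fourier[OF assms, of "0::'a"]
  by (simp_all add: complex_of_real_integrable_eq del: of_real_exp of_real_power of_real_mult)

lemma integrable_cis_mult:
  assumes "integrable lborel f" "g \<in> borel_measurable lborel"
  shows "integrable lborel (\<lambda>x::'a::euclidean_space. cis (g x) * (f x :: complex))"
  by (rule Bochner_Integration.integrable_bound[OF assms(1)])
    (use assms in \<open>auto simp: norm_mult\<close>)

lemma fourier_measurable [measurable]:
  fixes f :: "'a::euclidean_space \<Rightarrow> real"
  assumes [measurable]: "f \<in> borel_measurable borel"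
  shows "fourier f \<in> borel_measurable borel"
  unfolding fourier_def[abs_def] by measurable

lemma fourier_integrand_integrable:
  fixes f :: "'a::euclidean_space \<Rightarrow> real"
  assumes "integrable lborel f"
  shows "integrable lborel (\<lambda>x. cis (- (x \<bullet> \<xi>)) * complex_of_real (f x))"
  by (intro integrable_cis_mult) (use assms in auto)

lemma fourier_bound:
  fixes f :: "'a::euclidean_space \<Rightarrow> real"
  assumes "integrable lborel f"
  shows "cmod (fourier f \<xi>) \<le> (LINT x|lborel. \<bar>f x\<bar>)"
  unfolding fourier_def
  by (rule order_trans[OF integral_norm_bound]) (simp add: norm_mult)

text \<open>Damping the transform by a Gaussian makes the double integral absolutely convergent, and
  Fubini leaves the Gaussian transform at x - y. The \<xi> integral carries no factor (2 pi)^(-n),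
  so the kernel is (2 pi)^n times the heat kernel at time s. This explicit formula takes the place
  of Fourier inversion below.\<close>

lemma heat_identity:
  fixes f :: "'a::euclidean_space \<Rightarrow> real"
  assumes f: "integrable lborel f" and s: "0 < s"
  shows "(LINT \<xi>|lborel. cis (x \<bullet> \<xi>) * complex_of_real (exp (- s * (norm \<xi>)\<^sup>2)) * fourier f \<xi>)
    = complex_of_real (sqrt (pi / s) ^ DIM('a) *
        (LINT y|lborel. f y * exp (- (norm (x - y))\<^sup>2 / (4 * s))))"
proof -
  have [measurable]: "f \<in> borel_measurable borel" using f by auto
  define F where "F \<xi> y = cis (x \<bullet> \<xi>) * complex_of_real (exp (- s * (norm \<xi>)\<^sup>2))
      * (cis (- (y \<bullet> \<xi>)) * complex_of_real (f y))" for \<xi> y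
  have nF: "norm (F \<xi> y) = exp (- s * (norm \<xi>)\<^sup>2) * \<bar>f y\<bar>" for \<xi> y
    by (simp add: F_def norm_mult)
  have int: "integrable (lborel \<Otimes>\<^sub>M lborel) (\<lambda>(\<xi>, y). F \<xi> y)"
  proof (rule lborel_pair.Fubini_integrable)
    show "(\<lambda>(\<xi>, y). F \<xi> y) \<in> borel_measurable (lborel \<Otimes>\<^sub>M lborel)"
      unfolding F_def by measurable
    show "integrable lborel (\<lambda>\<xi>. LINT y|lborel. norm (case (\<xi>, y) of (\<xi>, y) \<Rightarrow> F \<xi> y))"
      using gaussian_integral(1)[OF s, where 'a = 'a] by (simp add: nF)
    show "AE \<xi> in lborel. integrable lborel (\<lambda>y. case (\<xi>, y) of (\<xi>, y) \<Rightarrow> F \<xi> y)"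
      unfolding F_def
      by (auto intro!: integrable_mult_right fourier_integrand_integrable f)
  qed
  have "(LINT \<xi>|lborel. cis (x \<bullet> \<xi>) * complex_of_real (exp (- s * (norm \<xi>)\<^sup>2)) * fourier f \<xi>)
      = (LINT \<xi>|lborel. LINT y|lborel. F \<xi> y)"
    unfolding F_def fourier_def by simp
  also have "\<dots> = (LINT y|lborel. LINT \<xi>|lborel. F \<xi> y)"
    by (rule lborel_pair.Fubini_integral[OF int, symmetric])
  also have "(\<lambda>y. LINT \<xi>|lborel. F \<xi> y) = (\<lambda>y. complex_of_real (sqrt (pi / s) ^ DIM('a) *
       (f y * exp (- (norm (x - y))\<^sup>2 / (4 * s)))))"
  proof
    fix y
    have "F \<xi> y = complex_of_real (f y) *
        (cis ((x - y) \<bullet> \<xi>) * complex_of_real (exp (- s * (norm \<xi>)\<^sup>2)))" for \<xi>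
      unfolding F_def inner_diff_left diff_conv_add_uminus[of "x \<bullet> \<xi>"] cis_mult[symmetric]
      by (simp only: mult_ac)
    then have "(LINT \<xi>|lborel. F \<xi> y) = complex_of_real (f y) *
        (LINT \<xi>|lborel. cis ((x - y) \<bullet> \<xi>) * complex_of_real (exp (- s * (norm \<xi>)\<^sup>2)))"
      by simp
    then show "(LINT \<xi>|lborel. F \<xi> y) = complex_of_real (sqrt (pi / s) ^ DIM('a) *
       (f y * exp (- (norm (x - y))\<^sup>2 / (4 * s))))"
      unfolding gaussian_fourier(2)[OF s] by simp
  qed
  finally show ?thesis by (simp del: of_real_mult of_real_power)
qed

section \<open>Decay of the transform of a bump\<close>

lemma cont_compact_support_integrable:
  fixes f :: "'a::euclidean_space \<Rightarrow> 'b::{banach,second_countable_topology}"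
  assumes "continuous_on UNIV f" "compact S" "\<And>x. x \<notin> S \<Longrightarrow> f x = 0"
  shows "integrable lborel f"
proof -
  have "integrable lborel (\<lambda>x. indicator S x *\<^sub>R f x)"
    by (rule borel_integrable_compact) (use assms continuous_on_subset in blast)+
  moreover have "(\<lambda>x. indicator S x *\<^sub>R f x) = f"
    using assms(3) by (auto simp: indicator_def)
  ultimately show ?thesis by simp
qed

text \<open>Integration by parts: D is the derivative of exp (-i t \<xi>) g(t), and its integral
  vanishes because g is zero at both endpoints.\<close>

lemma fourier_deriv_real:
  fixes g g' :: "real \<Rightarrow> real"
  assumes g: "\<And>t. (g has_real_derivative g' t) (at t)" and g': "continuous_on UNIV g'"
    and supp: "\<And>t. r < \<bar>t\<bar> \<Longrightarrow> g t = 0" "\<And>t. r < \<bar>t\<bar> \<Longrightarrow> g' t = 0"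
  shows "fourier g' \<xi> = \<i> * complex_of_real \<xi> * fourier g \<xi>"
proof -
  have cg: "continuous_on UNIV g"
    by (auto intro!: continuous_at_imp_continuous_on DERIV_isCont g)
  have ig: "integrable lborel g" and ig': "integrable lborel g'"
    by (rule cont_compact_support_integrable[where S = "cball 0 r"];
        use cg g' supp in \<open>auto simp: not_le\<close>)+
  \<comment> \<open>The given r may be negative; |r| + 1 is a nonnegative radius strictly beyond the
    support, so g and g' vanish at the endpoints.\<close>
  define R where "R = \<bar>r\<bar> + 1"
  have supp_R: "g t = 0" "g' t = 0" if "t \<notin> {-R..R}" for t
    using that by (intro supp; auto simp: R_def abs_if split: if_splits)+
  have 0: "g R = 0" "g (- R) = 0" "0 \<le> R" by (intro supp; simp add: R_def; fail)+ (simp add: R_def)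
  define D where "D t = cis (- (t * \<xi>)) * complex_of_real (g' t)
      - \<i> * complex_of_real \<xi> * (cis (- (t * \<xi>)) * complex_of_real (g t))" for t
  have "((\<lambda>t. exp (- \<i> * complex_of_real t * complex_of_real \<xi>) * complex_of_real (g t))
      has_vector_derivative D t) (at t within {-R..R})" for t
    unfolding D_def cis_conv_exp
    by (rule has_vector_derivative_at_within)
      (auto intro!: derivative_eq_intros has_vector_derivative_real_field
        g
        simp: algebra_simps)
  moreover have "continuous_on {-R..R} D"
    unfolding D_def cis_conv_exp
    by (intro continuous_intros continuous_on_subset[OF cg] continuous_on_subset[OF g']) auto
  ultimately have "(LINT t|lborel. indicator {-R..R} t *\<^sub>R D t) = 0"
    using integral_FTC_Icc[of "-R" R "\<lambda>t. exp (- \<i> * complex_of_real t * complex_of_real \<xi>) * complex_of_real (g t)" D]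
    using 0 by simp
  also have "(\<lambda>t. indicator {-R..R} t *\<^sub>R D t) = D"
    using supp_R by (auto simp: D_def indicator_def fun_eq_iff)
  finally have "(LINT t|lborel. D t) = 0" .
  moreover have "(LINT t|lborel. D t) = fourier g' \<xi> - \<i> * complex_of_real \<xi> * fourier g \<xi>"
    unfolding D_def fourier_def
    using fourier_integrand_integrable[OF ig, of \<xi>] fourier_integrand_integrable[OF ig', of \<xi>]
    by (subst Bochner_Integration.integral_diff) auto
  ultimately show ?thesis by simp
qed

text \<open>Each derivative is traded for one factor |\<xi>|. Dimension one suffices, because the
  bump in several variables is a product.\<close>

lemma fourier_decay_real:
  fixes g :: "real \<Rightarrow> real"
  assumes "C_k N g" "\<And>t. r < \<bar>t\<bar> \<Longrightarrow> g t = 0"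
  shows "\<exists>C. \<forall>\<xi>. \<bar>\<xi>\<bar> ^ N * cmod (fourier g \<xi>) \<le> C"
  using assms
proof (induction N arbitrary: g)
  case 0
  have "integrable lborel g"
    by (rule cont_compact_support_integrable[where S = "cball 0 r"]) (use 0 in \<open>auto simp: not_le\<close>)
  then show ?case using fourier_bound by auto
next
  case (Suc N)
  obtain g' where d: "\<And>t. (g has_real_derivative g' t) (at t)" and c: "C_k N g'"
    using C_k_Suc_realE[OF Suc.prems(1)] by blast
  have s: "g' t = 0" if "r < \<bar>t\<bar>" for t
    by (rule deriv_zero_off_support[OF d _ that]) (rule Suc.prems)
  from Suc.IH[OF c s] obtain C where C: "\<And>\<xi>. \<bar>\<xi>\<bar> ^ N * cmod (fourier g' \<xi>) \<le> C"
    by blast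
  have "C_k 0 g'" using c by (induction N) (auto intro: C_k_Suc_imp simp del: C_k.simps)
  then have "fourier g' \<xi> = \<i> * complex_of_real \<xi> * fourier g \<xi>" for \<xi>
    by (intro fourier_deriv_real[where r = r] d s Suc.prems) auto
  then have "\<bar>\<xi>\<bar> ^ Suc N * cmod (fourier g \<xi>) \<le> C" for \<xi>
    using C[of \<xi>] by (simp add: norm_mult mult_ac)
  then show ?case by blast
qed

lemma integrable_inverse_1_plus_sq: "integrable lborel (\<lambda>t::real. 1 / (1 + t\<^sup>2))"
  using integrable_inverse_1_plus_square
  by (simp add: set_integrable_def einterval_def inverse_eq_divide)

lemma bump_fourier_weight_integrable:
  assumes "0 \<le> a"
  shows "integrable lborel (\<lambda>t. (1 + \<bar>t\<bar>) powr a * cmod (fourier bump t))"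
proof -
  \<comment> \<open>Two orders beyond a: since 1 + t^2 \<le> (1 + |t|)^2, they leave the integrable
    majorant 1 / (1 + t^2).\<close>
  define N where "N = nat \<lceil>a\<rceil> + 2"
  have N: "a + 2 \<le> real N" using assms unfolding N_def by linarith
  obtain C where C: "\<And>\<xi>. \<bar>\<xi>\<bar> ^ N * cmod (fourier bump \<xi>) \<le> C"
    using fourier_decay_real[OF C_k_bump, of 2 N] bump_eq_0 by (metis less_imp_le)
  obtain B where B: "\<And>\<xi>. \<bar>\<xi>\<bar> ^ 0 * cmod (fourier bump \<xi>) \<le> B"
    using fourier_decay_real[OF C_k_bump, of 2 0] bump_eq_0 by (metis less_imp_le)
  have [measurable]: "bump \<in> borel_measurable borel"
    using C_k_bump[of 0] by (auto intro: borel_measurable_continuous_onI)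
  have B0: "0 \<le> B" using B[of 0] by (simp add: order_trans[OF norm_ge_zero])
  have C0: "0 \<le> C" by (rule order_trans[OF _ C[of 0]]) simp
  have *: "(1 + \<bar>t\<bar>) ^ N * cmod (fourier bump t) \<le> 2 ^ N * (B + C)" for t
  proof (cases "\<bar>t\<bar> \<le> 1")
    case True
    then have "(1 + \<bar>t\<bar>) ^ N * cmod (fourier bump t) \<le> 2 ^ N * B"
      using B[of t] by (intro mult_mono power_mono) auto
    also have "\<dots> \<le> 2 ^ N * (B + C)" using C0 by (intro mult_left_mono) auto
    finally show ?thesis .
  next
    case False
    then have "(1 + \<bar>t\<bar>) ^ N * cmod (fourier bump t) \<le> (2 * \<bar>t\<bar>) ^ N * cmod (fourier bump t)"
      by (intro mult_right_mono power_mono) auto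
    also have "\<dots> \<le> 2 ^ N * C"
      using C[of t] by (simp add: power_mult_distrib mult.assoc)
    also have "\<dots> \<le> 2 ^ N * (B + C)" using B0 by (intro mult_left_mono) auto
    finally show ?thesis .
  qed
  show ?thesis
  proof (rule Bochner_Integration.integrable_bound)
    show "integrable lborel (\<lambda>t::real. 2 ^ N * (B + C) * (1 / (1 + t\<^sup>2)))"
      by (intro integrable_mult_right integrable_inverse_1_plus_sq)
    show "AE t in lborel. norm ((1 + \<bar>t\<bar>) powr a * cmod (fourier bump t))
        \<le> norm (2 ^ N * (B + C) * (1 / (1 + t\<^sup>2)))"
    proof (rule AE_I2)
      fix t :: real
      have "(1 + \<bar>t\<bar>) powr a * (1 + t\<^sup>2) \<le> (1 + \<bar>t\<bar>) powr a * (1 + \<bar>t\<bar>) powr 2"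
        by (intro mult_left_mono) (auto simp: powr_numeral power2_eq_square algebra_simps)
      also have "\<dots> \<le> (1 + \<bar>t\<bar>) powr real N"
        unfolding powr_add[symmetric] using N by (intro powr_mono) auto
      also have "\<dots> = (1 + \<bar>t\<bar>) ^ N" by (rule powr_realpow) auto
      finally have "(1 + \<bar>t\<bar>) powr a * (1 + t\<^sup>2) * cmod (fourier bump t) \<le> (1 + \<bar>t\<bar>) ^ N * cmod (fourier bump t)"
        by (rule mult_right_mono) auto
      also note *[of t]
      finally have "(1 + \<bar>t\<bar>) powr a * cmod (fourier bump t) * (1 + t\<^sup>2) \<le> 2 ^ N * (B + C)"
        by (simp add: mult_ac)
      moreover have "0 < 1 + t\<^sup>2" by (simp add: add_pos_nonneg)
      ultimately show "norm ((1 + \<bar>t\<bar>) powr a * cmod (fourier bump t))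
        \<le> norm (2 ^ N * (B + C) * (1 / (1 + t\<^sup>2)))"
        using B0 C0 by (simp add: pos_le_divide_eq)
    qed
  qed measurable
qed

text \<open>A tensor product instead of a radial bump: its transform factorises
  (\<open>fourier_prof\<close>), so decay in one variable is enough. The price is a cubical support,
  which is only enclosed in the ball of radius 2n.\<close>

definition prof :: "'a::euclidean_space \<Rightarrow> real" where
  "prof x = (\<Prod>b\<in>Basis. bump (x \<bullet> b))"

lemma C_k_prof: "C_k k prof"
  unfolding prof_def[abs_def]
  by (intro C_k_prod C_k_compose[OF C_k_bump] C_k_bounded_linear bounded_linear_inner_left)

lemma continuous_prof: "continuous_on S prof"
  using C_k_prof[of 0] by (auto intro: continuous_on_subset)

lemma prof_measurable [measurable]: "prof \<in> borel_measurable borel"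
  by (rule borel_measurable_continuous_onI) (rule continuous_prof)

lemma prof_nonneg: "0 \<le> prof x" and prof_le_1: "prof x \<le> 1"
  unfolding prof_def by (intro prod_nonneg prod_le_1 ballI conjI bump_nonneg bump_le_1)+

lemma prof_eq_1: "norm x \<le> 1 \<Longrightarrow> prof x = 1"
  unfolding prof_def
  by (intro prod.neutral ballI bump_eq_1) (meson Basis_le_norm order_trans)

lemma prof_eq_0:
  assumes "2 * real DIM('a) < norm (x :: 'a::euclidean_space)"
  shows "prof x = 0"
proof -
  have "\<exists>b\<in>Basis. 2 \<le> \<bar>x \<bullet> b\<bar>"
  proof (rule ccontr)
    assume "\<not> ?thesis"
    then have "(\<Sum>b\<in>Basis. \<bar>x \<bullet> b\<bar>) \<le> (\<Sum>b\<in>(Basis::'a set). 2)" by (intro sum_mono) force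
    with norm_le_l1[of x] assms show False by (simp add: mult.commute)
  qed
  then show ?thesis using bump_eq_0 unfolding prof_def by (auto intro: prod_zero)
qed

lemma integrable_prof: "integrable lborel (prof :: 'a::euclidean_space \<Rightarrow> real)"
  by (rule cont_compact_support_integrable[where S = "cball 0 (2 * real DIM('a))"])
    (auto intro: continuous_prof prof_eq_0 simp: not_le)

lemma integrable_bump: "integrable lborel bump"
  by (rule cont_compact_support_integrable[where S = "cball 0 2"])
    (use C_k_bump[of 0] in \<open>auto intro: bump_eq_0\<close>)

lemma fourier_prof: "fourier prof \<xi> = (\<Prod>b\<in>Basis. fourier bump (\<xi> \<bullet> b))"
proof -
  have "cis (- (x \<bullet> \<xi>)) * complex_of_real (prof x)
      = (\<Prod>b\<in>Basis. cis (- ((x \<bullet> b) \<bullet> (\<xi> \<bullet> b))) * complex_of_real (bump (x \<bullet> b)))" for x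
    by (simp add: prof_def cis_conv_exp euclidean_inner[of x \<xi>] sum_distrib_left
        exp_sum prod.distrib flip: of_real_prod exp_sum sum_negf)
  then show ?thesis unfolding fourier_def
    by (simp only:) (rule integral_lborel_prod, rule fourier_integrand_integrable, rule integrable_bump)
qed

text \<open>A power of the norm is thereby dominated by a product over the coordinates, and the
  weighted transform of \<open>prof\<close> splits into one-dimensional integrals. Expanding the
  product yields 1 plus the l1 norm among nonnegative terms.\<close>

lemma norm_le_prod_1_plus: "norm (x::'a::euclidean_space) \<le> (\<Prod>b\<in>Basis. 1 + \<bar>x \<bullet> b\<bar>)"
proof -
  have "1 + (\<Sum>b\<in>A. \<bar>x \<bullet> b\<bar>) \<le> (\<Prod>b\<in>A. 1 + \<bar>x \<bullet> b\<bar>)" if "finite A" for A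
    using that
  proof induction
    case (insert a A)
    have "1 + (\<Sum>b\<in>insert a A. \<bar>x \<bullet> b\<bar>) \<le> (1 + \<bar>x \<bullet> a\<bar>) * (1 + (\<Sum>b\<in>A. \<bar>x \<bullet> b\<bar>))"
      using insert by (simp add: algebra_simps sum_nonneg)
    also have "\<dots> \<le> (1 + \<bar>x \<bullet> a\<bar>) * (\<Prod>b\<in>A. 1 + \<bar>x \<bullet> b\<bar>)"
      by (intro mult_left_mono insert) auto
    finally show ?case using insert by simp
  qed auto
  from this[OF finite_Basis] norm_le_l1[of x] show ?thesis by linarith
qed

lemma prof_fourier_weight_integrable:
  assumes "0 \<le> a"
  shows "integrable lborel (\<lambda>\<xi>::'a::euclidean_space. norm \<xi> powr a * cmod (fourier prof \<xi>))"
proof (rule Bochner_Integration.integrable_bound)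
  show "integrable lborel (\<lambda>\<xi>::'a. \<Prod>b\<in>Basis. (1 + \<bar>\<xi> \<bullet> b\<bar>) powr a * cmod (fourier bump (\<xi> \<bullet> b)))"
    by (rule integrable_lborel_prod) (rule bump_fourier_weight_integrable[OF assms])
  show "AE \<xi>::'a in lborel. norm (norm \<xi> powr a * cmod (fourier prof \<xi>))
    \<le> norm (\<Prod>b\<in>Basis. (1 + \<bar>\<xi> \<bullet> b\<bar>) powr a * cmod (fourier bump (\<xi> \<bullet> b)))"
  proof (rule AE_I2)
    fix \<xi> :: 'a
    have "norm \<xi> powr a \<le> (\<Prod>b\<in>Basis. 1 + \<bar>\<xi> \<bullet> b\<bar>) powr a"
      by (intro powr_mono2 norm_le_prod_1_plus assms) auto
    also have "\<dots> = (\<Prod>b\<in>Basis. (1 + \<bar>\<xi> \<bullet> b\<bar>) powr a)"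
      by (simp add: prod_powr_distrib)
    finally show "norm (norm \<xi> powr a * cmod (fourier prof \<xi>))
      \<le> norm (\<Prod>b\<in>Basis. (1 + \<bar>\<xi> \<bullet> b\<bar>) powr a * cmod (fourier bump (\<xi> \<bullet> b)))"
      by (simp add: fourier_prof prod.distrib prod_norm abs_mult abs_prod mult_right_mono prod_nonneg)
  qed
qed measurable

section \<open>Pointwise decay of the fractional Laplacian of a bump\<close>

lemma set_integrable_lborel_powr:
  shows "- 1 < a \<Longrightarrow> integrable lborel (\<lambda>s::real. indicator {0..1} s * s powr a)"
    and "b < - 1 \<Longrightarrow> integrable lborel (\<lambda>s::real. indicator {1..} s * s powr b)"
proof -
  have *: "integrable lborel (\<lambda>s. indicator A s * s powr e)"
    if "(\<lambda>s. s powr e) integrable_on A" "A \<in> sets borel" for A and e :: real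
  proof -
    have [measurable]: "A \<in> sets borel" by fact
    have "(\<lambda>s. s powr e) absolutely_integrable_on A"
      by (rule nonnegative_absolutely_integrable_1[OF that(1)]) auto
    then have "integrable lebesgue (\<lambda>s. indicator A s * s powr e)"
      by (simp add: set_integrable_def)
    then show ?thesis by (subst (asm) integrable_completion) measurable
  qed
  show "- 1 < a \<Longrightarrow> integrable lborel (\<lambda>s::real. indicator {0..1} s * s powr a)"
    by (rule *) (auto intro: integrable_on_powr_from_0)
  show "b < - 1 \<Longrightarrow> integrable lborel (\<lambda>s::real. indicator {1..} s * s powr b)"
    by (rule *) (auto intro!: has_integral_integrable[OF has_integral_powr_to_inf])
qed

lemma integrable_powr_ends:
  fixes g :: "real \<Rightarrow> real"
  assumes [measurable]: "g \<in> borel_measurable borel" and "- 1 < a" "b < - 1"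
    and near: "\<And>s. 0 < s \<Longrightarrow> s \<le> 1 \<Longrightarrow> \<bar>g s\<bar> \<le> C * s powr a"
    and far: "\<And>s. 1 \<le> s \<Longrightarrow> \<bar>g s\<bar> \<le> C * s powr b"
    and neg: "\<And>s. s \<le> 0 \<Longrightarrow> g s = 0"
  shows "integrable lborel g"
proof (rule Bochner_Integration.integrable_bound)
  show "integrable lborel (\<lambda>s. C * (indicator {0..1} s * s powr a) + C * (indicator {1..} s * s powr b))"
    by (intro Bochner_Integration.integrable_add integrable_mult_right set_integrable_lborel_powr assms)
  have C: "0 \<le> C" using far[of 1] by simp
  show "AE s in lborel. norm (g s) \<le>
      norm (C * (indicator {0..1} s * s powr a) + C * (indicator {1..} s * s powr b))"
  proof (rule AE_I2)
    fix s :: real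
    consider "s \<le> 0" | "0 < s" "s < 1" | "s = 1" | "1 < s" by linarith
    then show "norm (g s) \<le>
      norm (C * (indicator {0..1} s * s powr a) + C * (indicator {1..} s * s powr b))"
      by cases (use near[of s] far[of s] C in \<open>auto simp: neg\<close>)
  qed
qed measurable

text \<open>Up to a constant, \<open>l powr \<gamma>\<close> is the integral of this kernel over \<open>s\<close>. With \<open>l = \<bar>\<xi>\<bar>\<^sup>2\<close>, the
  binomial expansion of the \<open>m\<close>-th power leaves only Gaussians in \<open>\<xi>\<close>, whose action on a bump is
  explicit; its constant term reproduces the bump and hence vanishes off the support.\<close>

definition pow_kernel :: "real \<Rightarrow> nat \<Rightarrow> real \<Rightarrow> real \<Rightarrow> real" where
  "pow_kernel \<gamma> m l s = indicator {0<..} s * ((1 - exp (- (s * l))) ^ m * s powr (- 1 - \<gamma>))"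

lemma pow_kernel_measurable [measurable]:
  "pow_kernel \<gamma> m l \<in> borel_measurable borel"
  unfolding pow_kernel_def[abs_def] by measurable

lemma pow_kernel_nonneg: "0 \<le> l \<Longrightarrow> 0 \<le> pow_kernel \<gamma> m l s"
  by (auto simp: pow_kernel_def indicator_def)

text \<open>Near 0 the m-th power is at most s^m, so m > \<gamma> gives convergence there; at
  infinity it is at most 1, and \<gamma> > 0 suffices.\<close>

lemma pow_kernel_integrable_1:
  assumes "0 < \<gamma>" "\<gamma> < real m"
  shows "integrable lborel (pow_kernel \<gamma> m 1)"
proof (rule integrable_powr_ends[where a = "real m - 1 - \<gamma>" and b = "- 1 - \<gamma>" and C = 1])
  fix s :: real
  {
    assume s: "0 < s" "s \<le> 1"
    have "1 - s \<le> exp (- s)" using exp_ge_add_one_self[of "- s"] by simp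
    then have "(1 - exp (- s)) ^ m \<le> s ^ m" using s by (intro power_mono) auto
    then have "(1 - exp (- s)) ^ m * s powr (- 1 - \<gamma>) \<le> s powr real m * s powr (- 1 - \<gamma>)"
      using s by (intro mult_right_mono) (auto simp: powr_realpow)
    then show "\<bar>pow_kernel \<gamma> m 1 s\<bar> \<le> 1 * s powr (real m - 1 - \<gamma>)"
      using s by (simp add: pow_kernel_def powr_add[symmetric] abs_mult algebra_simps)
  next
    assume s: "1 \<le> s"
    have "(1 - exp (- s)) ^ m \<le> 1" using s by (intro power_le_one) auto
    then show "\<bar>pow_kernel \<gamma> m 1 s\<bar> \<le> 1 * s powr (- 1 - \<gamma>)"
      using s by (simp add: pow_kernel_def abs_mult mult_le_cancel_right1)
  }
qed (use assms in \<open>auto simp: pow_kernel_def\<close>)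

definition pow_const :: "real \<Rightarrow> nat \<Rightarrow> real" where
  "pow_const \<gamma> m = (LINT s|lborel. pow_kernel \<gamma> m 1 s)"

lemma pow_const_pos:
  assumes "0 < \<gamma>" "\<gamma> < real m"
  shows "0 < pow_const \<gamma> m"
proof -
  \<comment> \<open>A lower bound of the kernel on [1, 2]: the first factor is smallest at s = 1,
    the power of s at s = 2.\<close>
  define d where "d = (1 - exp (- 1)) ^ m * (2::real) powr (- 1 - \<gamma>)"
  have "0 < d" by (simp add: d_def)
  also have "d = (LINT s|lborel. indicator {1..2::real} s *\<^sub>R d)" by simp
  also have "\<dots> \<le> pow_const \<gamma> m"
    unfolding pow_const_def
  proof (rule integral_mono)
    show "integrable lborel (\<lambda>s. indicator {1..2::real} s *\<^sub>R d)"
      by (rule borel_integrable_compact) auto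
    fix s :: real
    show "indicator {1..2} s *\<^sub>R d \<le> pow_kernel \<gamma> m 1 s"
    proof (cases "s \<in> {1..2}")
      case True
      then have "d \<le> (1 - exp (- s)) ^ m * s powr (- 1 - \<gamma>)" unfolding d_def
        using assms by (intro mult_mono power_mono powr_mono2') auto
      with True show ?thesis by (simp add: pow_kernel_def)
    qed (simp add: pow_kernel_nonneg)
  qed (rule pow_kernel_integrable_1[OF assms])
  finally show ?thesis .
qed

text \<open>The kernel is homogeneous: with parameter l at s it is
  \<open>l powr (1 + \<gamma>)\<close> times the kernel with parameter 1 at l s. The Jacobian of
  this substitution removes one power of l.\<close>

lemma pow_kernel_integral:
  assumes "0 < \<gamma>" "\<gamma> < real m" "0 \<le> l"
  shows "integrable lborel (pow_kernel \<gamma> m l)" (is ?I)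
    and "(LINT s|lborel. pow_kernel \<gamma> m l s) = pow_const \<gamma> m * l powr \<gamma>" (is ?E)
proof -
  consider "l = 0" | "0 < l" using assms by linarith
  then have "?I \<and> ?E"
  proof cases
    case 1
    have "pow_kernel \<gamma> m 0 = (\<lambda>_. 0)"
      using assms by (auto simp: pow_kernel_def fun_eq_iff)
    with 1 show ?thesis by simp
  next
    case 2
    have eq: "pow_kernel \<gamma> m l = (\<lambda>s. l powr (1 + \<gamma>) * pow_kernel \<gamma> m 1 (0 + l * s))"
    proof
      fix s
      show "pow_kernel \<gamma> m l s = l powr (1 + \<gamma>) * pow_kernel \<gamma> m 1 (0 + l * s)"
      proof (cases "0 < s")
        case True
        have "l powr (1 + \<gamma>) * l powr (- 1 - \<gamma>) = 1"
          using 2 by (simp flip: powr_add)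
        with 2 True show ?thesis
          by (simp add: pow_kernel_def powr_mult mult_ac)
      qed (use 2 in \<open>auto simp: pow_kernel_def zero_less_mult_iff\<close>)
    qed
    have "pow_const \<gamma> m = l * (LINT s|lborel. pow_kernel \<gamma> m 1 (0 + l * s))"
      unfolding pow_const_def using 2 lborel_integral_real_affine[of l "pow_kernel \<gamma> m 1" 0] by simp
    moreover have "l powr (1 + \<gamma>) = l * l powr \<gamma>" using 2 by (simp add: powr_add)
    ultimately have ?E unfolding eq using 2 by simp
    moreover have ?I unfolding eq
      by (intro integrable_mult_right lborel_integrable_real_affine pow_kernel_integrable_1 assms)
        (use 2 in auto)
    ultimately show ?thesis by simp
  qed
  then show ?I ?E by auto
qed

text \<open>A single term of the exponential series bounds exp y from below.\<close>

lemma exp_neg_le_power: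
  assumes "0 < (y::real)" shows "exp (- y) \<le> fact N / y ^ N"
proof -
  have "(\<Sum>n\<in>{N}. inverse (fact n) * y ^ n) \<le> (\<Sum>n. inverse (fact n) * y ^ n)"
    by (rule sum_le_suminf[OF summable_exp]) (use assms in auto)
  then have "y ^ N / fact N \<le> exp y"
    by (simp add: exp_def divide_inverse mult.commute)
  then show ?thesis using assms by (simp add: exp_minus field_simps)
qed

text \<open>For a > 0 this is the value of the Gamma function at a, as the substitution of 1/s for s
  shows; the estimates treat it as a nonnegative constant.\<close>

definition inv_exp_const :: "real \<Rightarrow> real" where
  "inv_exp_const a = (LINT s|lborel. indicator {0<..} s * (s powr (- 1 - a) * exp (- (1 / s))))"

lemma inv_exp_integral:
  assumes "0 < a" "0 < b"
  shows "integrable lborel (\<lambda>s. indicator {0<..} s * (s powr (- 1 - a) * exp (- (b / s))))" (is ?I)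
    and "(LINT s|lborel. indicator {0<..} s * (s powr (- 1 - a) * exp (- (b / s))))
      = inv_exp_const a * b powr (- a)" (is ?E)
proof -
  define g where "g s = indicator {0<..} s * (s powr (- 1 - a) * exp (- (1 / s)))" for s :: real
  \<comment> \<open>N is at least the order 1 + a of the singularity at 0, so exp (-1/s) \<le> N!
    s^N makes the integrand bounded there.\<close>
  define N where "N = nat \<lceil>1 + a\<rceil>"
  have N: "1 + a \<le> real N" unfolding N_def by linarith
  have [measurable]: "g \<in> borel_measurable borel"
    unfolding g_def[abs_def] by measurable
  have g: "integrable lborel g"
  proof (rule integrable_powr_ends[where a = 0 and b = "- 1 - a" and C = "fact N"])
    fix s :: real
    {
      assume s: "0 < s" "s \<le> 1"
      have "exp (- (1 / s)) \<le> fact N * s ^ N"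
        using exp_neg_le_power[of "1 / s" N] s by (simp add: power_divide)
      then have "s powr (- 1 - a) * exp (- (1 / s)) \<le> s powr (- 1 - a) * (fact N * s powr real N)"
        using s by (intro mult_left_mono) (auto simp: powr_realpow)
      also have "\<dots> = fact N * s powr (real N - (1 + a))"
        by (simp add: powr_add[symmetric] algebra_simps)
      also have "\<dots> \<le> fact N * 1"
        using s N by (intro mult_left_mono powr_le1) auto
      finally show "\<bar>g s\<bar> \<le> fact N * s powr 0" using s by (simp add: g_def)
    next
      assume s: "1 \<le> s"
      have "s powr (- 1 - a) * exp (- (1 / s)) \<le> s powr (- 1 - a) * fact N"
        using s by (intro mult_left_mono) (auto intro: order_trans[of _ 1])
      then show "\<bar>g s\<bar> \<le> fact N * s powr (- 1 - a)" using s by (simp add: g_def mult.commute)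
    }
  qed (use assms in \<open>auto simp: g_def\<close>)
  have eq: "(\<lambda>s. indicator {0<..} s * (s powr (- 1 - a) * exp (- (b / s))))
      = (\<lambda>s. b powr (- 1 - a) * g (0 + (1 / b) * s))"
  proof
    fix s
    show "indicator {0<..} s * (s powr (- 1 - a) * exp (- (b / s))) = b powr (- 1 - a) * g (0 + (1 / b) * s)"
    proof (cases "0 < s")
      case True
      with assms have "s powr (- 1 - a) = b powr (- 1 - a) * (s / b) powr (- 1 - a)"
        by (simp add: powr_mult[symmetric])
      with True assms show ?thesis by (simp add: g_def)
    qed (use assms in \<open>auto simp: g_def zero_less_divide_iff\<close>)
  qed
  have "inv_exp_const a = (1 / b) * (LINT s|lborel. g (0 + (1 / b) * s))"
    unfolding inv_exp_const_def g_def[symmetric]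
    using assms lborel_integral_real_affine[of "1 / b" g 0] by simp
  moreover have "b powr (- a) = b powr (- 1 - a) * b" using assms
    by (simp add: powr_diff powr_minus divide_inverse)
  ultimately show ?E unfolding eq using assms by simp
  show ?I unfolding eq
    by (intro integrable_mult_right lborel_integrable_real_affine g) (use assms in auto)
qed

text \<open>On the support of the bump |y| \<le> 2n, so |x| > 4n gives |x - y| \<ge> |x|/2; squaring
  turns the 4s of the heat kernel into 16s.\<close>

lemma prof_heat_bound:
  fixes x :: "'a::euclidean_space"
  assumes s: "0 < s" and x: "4 * real DIM('a) < norm x"
  shows "cmod (LINT \<xi>|lborel. cis (x \<bullet> \<xi>) * complex_of_real (exp (- s * (norm \<xi>)\<^sup>2)) * fourier prof \<xi>)
    \<le> sqrt (pi / s) ^ DIM('a) * exp (- (norm x)\<^sup>2 / (16 * s)) * (LINT y|lborel. prof (y::'a))"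
proof -
  have pt: "prof y * exp (- (norm (x - y))\<^sup>2 / (4 * s)) \<le> exp (- (norm x)\<^sup>2 / (16 * s)) * prof y" for y
  proof (cases "2 * real DIM('a) < norm y")
    case False
    then have "norm x / 2 \<le> norm (x - y)" using x norm_triangle_ineq2[of x y] by linarith
    then have "(norm x / 2)\<^sup>2 \<le> (norm (x - y))\<^sup>2" by (intro power_mono) auto
    then have "- (norm (x - y))\<^sup>2 / (4 * s) \<le> - (norm x)\<^sup>2 / (16 * s)"
      using s by (simp add: field_simps power_divide)
    then show ?thesis using prof_nonneg[of y] by (subst mult.commute) (intro mult_right_mono, auto)
  qed (simp add: prof_eq_0)
  have i: "integrable lborel (\<lambda>y. exp (- (norm x)\<^sup>2 / (16 * s)) * prof (y::'a))"
    by (intro integrable_mult_right integrable_prof)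
  have "(LINT y|lborel. prof y * exp (- (norm (x - y))\<^sup>2 / (4 * s)))
      \<le> (LINT y|lborel. exp (- (norm x)\<^sup>2 / (16 * s)) * prof (y::'a))"
    by (rule integral_mono'[OF i]) (use pt in \<open>auto intro!: mult_nonneg_nonneg prof_nonneg\<close>)
  moreover have "0 \<le> (LINT y|lborel. prof y * exp (- (norm (x - y))\<^sup>2 / (4 * s)))"
    by (rule Bochner_Integration.integral_nonneg) (auto intro!: mult_nonneg_nonneg prof_nonneg)
  ultimately show ?thesis
    unfolding heat_identity[OF integrable_prof s] norm_of_real
    using s by (simp add: abs_mult mult.assoc mult_left_mono)
qed

lemma prof_fourier_integrable:
  "integrable lborel (\<lambda>\<xi>::'a::euclidean_space. cmod (fourier prof \<xi>))"
proof -
  have i: "integrable lborel (\<lambda>\<xi>::'a. norm \<xi> powr 0 * cmod (fourier prof \<xi>))"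
    by (rule prof_fourier_weight_integrable) simp
  have "AE \<xi>::'a in lborel. \<xi> \<noteq> 0" by (rule AE_lborel_singleton)
  then have "AE \<xi>::'a in lborel. norm \<xi> powr 0 * cmod (fourier prof \<xi>) = cmod (fourier prof \<xi>)"
    by eventually_elim simp
  then show ?thesis by (rule integrable_cong_AE_imp[OF i, rotated]) measurable
qed

text \<open>Fourier inversion at a point off the support, where the bump is zero. The integral
  damped by a Gaussian with parameter \<open>e i\<close> tends to the undamped one by dominated
  convergence, while \<open>prof_heat_bound\<close> makes it tend to 0.\<close>

lemma prof_inversion_zero:
  fixes x :: "'a::euclidean_space"
  assumes x: "4 * real DIM('a) < norm x"
  shows "(LINT \<xi>|lborel. cis (x \<bullet> \<xi>) * fourier prof \<xi>) = 0"
proof -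
  define H where "H s = (LINT \<xi>|lborel. cis (x \<bullet> \<xi>) * complex_of_real (exp (- s * (norm \<xi>)\<^sup>2)) * fourier prof \<xi>)" for s
  define e where "e i = 1 / real (Suc i)" for i
  have e: "0 < e i" for i by (simp add: e_def)
  have e0: "e \<longlonglongrightarrow> 0" unfolding e_def by (rule LIMSEQ_Suc[OF lim_1_over_n])
  have x0: "0 < norm x" using x by (rule le_less_trans[rotated]) simp
  define M where "M = (LINT y|lborel. prof (y::'a))"
  have M: "0 \<le> M" unfolding M_def by (rule Bochner_Integration.integral_nonneg) (rule prof_nonneg)
  have 1: "(\<lambda>i. H (e i)) \<longlonglongrightarrow> (LINT \<xi>|lborel. cis (x \<bullet> \<xi>) * fourier prof \<xi>)"
    unfolding H_def
  proof (rule integral_dominated_convergence)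
    show "integrable lborel (\<lambda>\<xi>::'a. cmod (fourier prof \<xi>))" by (rule prof_fourier_integrable)
    show "AE \<xi> in lborel. (\<lambda>i. cis (x \<bullet> \<xi>) * complex_of_real (exp (- e i * (norm \<xi>)\<^sup>2)) * fourier prof \<xi>)
        \<longlonglongrightarrow> cis (x \<bullet> \<xi>) * fourier prof \<xi>"
    proof (rule AE_I2)
      fix \<xi> :: 'a
      have "(\<lambda>i. cis (x \<bullet> \<xi>) * complex_of_real (exp (- e i * (norm \<xi>)\<^sup>2)) * fourier prof \<xi>)
        \<longlonglongrightarrow> cis (x \<bullet> \<xi>) * complex_of_real (exp (- 0 * (norm \<xi>)\<^sup>2)) * fourier prof \<xi>"
        by (intro tendsto_intros e0)
      then show "(\<lambda>i. cis (x \<bullet> \<xi>) * complex_of_real (exp (- e i * (norm \<xi>)\<^sup>2)) * fourier prof \<xi>)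
        \<longlonglongrightarrow> cis (x \<bullet> \<xi>) * fourier prof \<xi>" by simp
    qed
    show "AE \<xi> in lborel. norm (cis (x \<bullet> \<xi>) * complex_of_real (exp (- e i * (norm \<xi>)\<^sup>2)) * fourier prof \<xi>)
        \<le> cmod (fourier prof \<xi>)" for i
      using e[of i] by (auto simp: norm_mult intro!: mult_left_le_one_le)
  qed measurable
  have "(\<lambda>i. H (e i)) \<longlonglongrightarrow> 0"
  proof (rule Lim_null_comparison)
    define B where "B = fact DIM('a) * (16 / (norm x)\<^sup>2) ^ DIM('a) * M"
    show "\<forall>\<^sub>F i in sequentially. norm (H (e i)) \<le> B * sqrt (pi * e i) ^ DIM('a)"
    proof (rule always_eventually, rule allI)
      fix i
      \<comment> \<open>The exponent n in the series bound gains (e i)^n against the singular factor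
        (e i)^(-n/2), which leaves (e i)^(n/2).\<close>
      have "exp (- ((norm x)\<^sup>2 / (16 * e i))) \<le> fact DIM('a) / ((norm x)\<^sup>2 / (16 * e i)) ^ DIM('a)"
        by (rule exp_neg_le_power) (use x0 e in auto)
      also have "\<dots> = fact DIM('a) * (16 / (norm x)\<^sup>2) ^ DIM('a) * e i ^ DIM('a)"
        by (simp add: power_divide power_mult_distrib)
      finally have "sqrt (pi / e i) ^ DIM('a) * exp (- (norm x)\<^sup>2 / (16 * e i)) * M
        \<le> sqrt (pi / e i) ^ DIM('a) * (fact DIM('a) * (16 / (norm x)\<^sup>2) ^ DIM('a) * e i ^ DIM('a)) * M"
        using e[of i] M by (intro mult_right_mono mult_left_mono) auto
      also have "\<dots> = B * (sqrt (pi / e i) * e i) ^ DIM('a)"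
        by (simp add: B_def power_mult_distrib)
      also have "sqrt (pi / e i) * e i = sqrt (pi * e i)"
      proof -
        have "sqrt (pi / e i) * sqrt ((e i)\<^sup>2) = sqrt (pi * e i)"
          unfolding real_sqrt_mult[symmetric] using e[of i] by (simp add: power2_eq_square)
        then show ?thesis using e[of i] by simp
      qed
      finally show "norm (H (e i)) \<le> B * sqrt (pi * e i) ^ DIM('a)"
        using prof_heat_bound[OF e x, of i] by (simp add: H_def M_def)
    qed
    have "(\<lambda>i. B * sqrt (pi * e i) ^ DIM('a)) \<longlonglongrightarrow> B * sqrt (pi * 0) ^ DIM('a)"
      by (intro tendsto_intros e0)
    then show "(\<lambda>i. B * sqrt (pi * e i) ^ DIM('a)) \<longlonglongrightarrow> 0" by (simp add: zero_power)
  qed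
  with 1 show ?thesis by (rule LIMSEQ_unique)
qed

text \<open>In the binomial expansion the term k = 0 is the inversion integral, which is zero off
  the support; otherwise it would make the s integral diverge at 0. The terms with k \<ge> 1 are
  heat extensions at time k s, hence bounded up to constants by s^(-n/2) exp (-|x|^2 / (16 m s)).
  Integrating this against s^(-1-\<gamma>) produces |x|^(-2\<gamma>-n).\<close>

lemma prof_frac_decay:
  assumes \<gamma>: "0 < \<gamma>"
  shows "\<exists>C\<ge>0. \<forall>x::'a::euclidean_space. 4 * real DIM('a) < norm x \<longrightarrow>
    cmod (LINT \<xi>|lborel. cis (x \<bullet> \<xi>) * complex_of_real (norm \<xi> powr (2 * \<gamma>)) * fourier prof \<xi>)
      \<le> C * norm x powr (- (2 * \<gamma> + real DIM('a)))"
proof -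
  define m where "m = nat \<lceil>\<gamma>\<rceil> + 1"
  have m: "\<gamma> < real m" "0 < m" unfolding m_def by linarith+
  define c where "c = pow_const \<gamma> m"
  have c: "0 < c" unfolding c_def by (rule pow_const_pos[OF \<gamma> m(1)])
  define M where "M = (LINT y|lborel. prof (y::'a))"
  have M: "0 \<le> M" unfolding M_def by (rule Bochner_Integration.integral_nonneg) (rule prof_nonneg)
  \<comment> \<open>The factor s^(-n/2) of the heat kernel adds n/2 to \<gamma>; the resulting power
    of |x| is -2a.\<close>
  define a where "a = \<gamma> + real DIM('a) / 2"
  have a: "0 < a" using \<gamma> by (simp add: a_def)
  define C where "C = 2 ^ m * sqrt pi ^ DIM('a) * M * inv_exp_const a * (16 * real m) powr a / c"
  have bound: "cmod (LINT \<xi>|lborel. cis (x \<bullet> \<xi>) * complex_of_real (norm \<xi> powr (2 * \<gamma>)) * fourier prof \<xi>)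
      \<le> C * norm x powr (- (2 * \<gamma> + real DIM('a)))"
    if x: "4 * real DIM('a) < norm x" for x :: 'a
  proof -
    have x0: "0 < norm x" using x by (rule le_less_trans[rotated]) simp
    define F where "F \<xi> = cis (x \<bullet> \<xi>) * fourier prof \<xi>" for \<xi> :: 'a
    have [measurable]: "F \<in> borel_measurable borel" unfolding F_def[abs_def] by measurable
    have nF: "cmod (F \<xi>) = cmod (fourier prof \<xi>)" for \<xi> by (simp add: F_def norm_mult)
    have iF: "integrable lborel F"
      by (rule Bochner_Integration.integrable_bound[OF prof_fourier_integrable]) (auto simp: nF)
    define \<Phi> where "\<Phi> \<xi> s = complex_of_real (pow_kernel \<gamma> m ((norm \<xi>)\<^sup>2) s) * F \<xi>" for \<xi> :: 'a and s
    have pk: "pow_const \<gamma> m * ((norm \<xi>)\<^sup>2) powr \<gamma> = c * norm \<xi> powr (2 * \<gamma>)" for \<xi> :: 'a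
      by (cases "\<xi> = 0") (simp_all add: c_def powr_powr flip: powr_numeral)
    have int: "integrable (lborel \<Otimes>\<^sub>M lborel) (\<lambda>(\<xi>, s). \<Phi> \<xi> s)"
    proof (rule lborel_pair.Fubini_integrable)
      show "(\<lambda>(\<xi>, s). \<Phi> \<xi> s) \<in> borel_measurable (lborel \<Otimes>\<^sub>M lborel)"
        unfolding \<Phi>_def pow_kernel_def by measurable
      have "(LINT s|lborel. norm (\<Phi> \<xi> s)) = c * (norm \<xi> powr (2 * \<gamma>) * cmod (fourier prof \<xi>))" for \<xi>
        using pow_kernel_integral(2)[OF \<gamma> m(1), of "(norm \<xi>)\<^sup>2"]
        by (simp add: \<Phi>_def norm_mult nF pow_kernel_nonneg pk mult.assoc)
      then show "integrable lborel (\<lambda>\<xi>. LINT s|lborel. norm (case (\<xi>, s) of (\<xi>, s) \<Rightarrow> \<Phi> \<xi> s))"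
        using prof_fourier_weight_integrable[of "2 * \<gamma>", where 'a = 'a] \<gamma> by simp
      show "AE \<xi> in lborel. integrable lborel (\<lambda>s. case (\<xi>, s) of (\<xi>, s) \<Rightarrow> \<Phi> \<xi> s)"
        unfolding \<Phi>_def using pow_kernel_integral(1)[OF \<gamma> m(1)]
        by (auto intro!: integrable_mult_left simp: complex_of_real_integrable_eq)
    qed
    have inner: "(LINT s|lborel. \<Phi> \<xi> s) = complex_of_real c * (cis (x \<bullet> \<xi>) * complex_of_real (norm \<xi> powr (2 * \<gamma>)) * fourier prof \<xi>)" for \<xi>
      using pow_kernel_integral(2)[OF \<gamma> m(1), of "(norm \<xi>)\<^sup>2"]
      unfolding \<Phi>_def F_def pk by simp
    \<comment> \<open>Among the times k s with 1 \<le> k \<le> m the last one has the weakest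
      Gaussian decay, which explains the factor m.\<close>
    define b where "b = (norm x)\<^sup>2 / (16 * real m)"
    have b: "0 < b" using x0 m by (simp add: b_def)
    have outer: "cmod (LINT \<xi>|lborel. \<Phi> \<xi> s)
        \<le> 2 ^ m * sqrt pi ^ DIM('a) * M * (indicator {0<..} s * (s powr (- 1 - a) * exp (- (b / s))))" for s
    proof (cases "0 < s")
      case s: True
      define G where "G k \<xi> = complex_of_real ((real (m choose k) * (- 1) ^ k)) *
        (cis (x \<bullet> \<xi>) * complex_of_real (exp (- (real k * s) * (norm \<xi>)\<^sup>2)) * fourier prof \<xi>)" for k and \<xi> :: 'a
      have iG: "integrable lborel (G k)" for k
        unfolding G_def
        by (intro integrable_mult_right Bochner_Integration.integrable_bound[OF prof_fourier_integrable])
          (use s in \<open>auto simp: norm_mult intro!: mult_left_le_one_le\<close>)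
      have "(1 - exp (- (s * l))) ^ m = (\<Sum>k\<le>m. (real (m choose k) * (- 1) ^ k) * exp (- (real k * s) * l))" for l
      proof -
        have "(- exp (- (s * l))) ^ k = (- 1) ^ k * exp (- (real k * s) * l)" for k
          by (subst power_minus) (simp add: exp_of_nat_mult[symmetric] mult_ac)
        then show ?thesis using binomial_ring[of "- exp (- (s * l))" 1 m] by (simp add: mult.assoc)
      qed
      note expand = this
      have \<Phi>G: "\<Phi> \<xi> s = complex_of_real (s powr (- 1 - \<gamma>)) * (\<Sum>k\<le>m. G k \<xi>)" for \<xi>
      proof -
        have "\<Phi> \<xi> s = complex_of_real (s powr (- 1 - \<gamma>)) *
            (complex_of_real ((1 - exp (- (s * (norm \<xi>)\<^sup>2))) ^ m) * F \<xi>)"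
          using s by (simp add: \<Phi>_def pow_kernel_def)
        also have "complex_of_real ((1 - exp (- (s * (norm \<xi>)\<^sup>2))) ^ m) * F \<xi> = (\<Sum>k\<le>m. G k \<xi>)"
          unfolding expand of_real_sum sum_distrib_right G_def F_def of_real_mult by (simp only: mult_ac)
        finally show ?thesis .
      qed
      define X where "X = sqrt (pi / s) ^ DIM('a) * exp (- (b / s)) * M"
      have bG: "cmod (LINT \<xi>|lborel. G k \<xi>) \<le> real (m choose k) * X" if k: "k \<le> m" for k
      proof (cases "k = 0")
        case True
        then show ?thesis using prof_inversion_zero[OF x] M s by (simp add: G_def X_def)
      next
        case False
        then have ks: "0 < real k * s" "s \<le> real k * s" using s by auto
        have "real k * s \<le> real m * s" using k s by auto
        then have "(norm x)\<^sup>2 / (16 * (real m * s)) \<le> (norm x)\<^sup>2 / (16 * (real k * s))"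
          using ks s m by (intro divide_left_mono mult_left_mono mult_pos_pos) simp_all
        then have e: "- (norm x)\<^sup>2 / (16 * (real k * s)) \<le> - (b / s)"
          by (simp add: b_def mult.assoc)
        have "cmod (LINT \<xi>|lborel. G k \<xi>) = real (m choose k) *
            cmod (LINT \<xi>|lborel. cis (x \<bullet> \<xi>) * complex_of_real (exp (- (real k * s) * (norm \<xi>)\<^sup>2)) * fourier prof \<xi>)"
          unfolding G_def by (simp add: norm_mult norm_power)
        also have "\<dots> \<le> real (m choose k) *
            (sqrt (pi / (real k * s)) ^ DIM('a) * exp (- (norm x)\<^sup>2 / (16 * (real k * s))) * M)"
          unfolding M_def by (intro mult_left_mono prof_heat_bound x ks) auto
        also have "\<dots> \<le> real (m choose k) * X"
        proof -
          have "pi / (real k * s) \<le> pi / s"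
            using ks s by (intro divide_left_mono mult_pos_pos) simp_all
          then have "sqrt (pi / (real k * s)) ^ DIM('a) \<le> sqrt (pi / s) ^ DIM('a)"
            using ks by (intro power_mono real_sqrt_le_mono) simp_all
          then have "sqrt (pi / (real k * s)) ^ DIM('a) * exp (- (norm x)\<^sup>2 / (16 * (real k * s)))
              \<le> sqrt (pi / s) ^ DIM('a) * exp (- (b / s))"
            using s e by (intro mult_mono) simp_all
          then show ?thesis unfolding X_def by (intro mult_left_mono mult_right_mono M) simp_all
        qed
        finally show ?thesis .
      qed
      have "cmod (LINT \<xi>|lborel. \<Phi> \<xi> s) = s powr (- 1 - \<gamma>) * cmod (\<Sum>k\<le>m. (LINT \<xi>|lborel. G k \<xi>))"
        unfolding \<Phi>G using iG by (simp add: norm_mult)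
      also have "\<dots> \<le> s powr (- 1 - \<gamma>) * (\<Sum>k\<le>m. real (m choose k) * X)"
        by (intro mult_left_mono order_trans[OF norm_sum] sum_mono bG) auto
      \<comment> \<open>The alternating signs are given up: the binomial coefficients themselves sum
        to 2^m.\<close>
      also have "(\<Sum>k\<le>m. real (m choose k) * X) = 2 ^ m * X"
        using choose_row_sum[of m] by (simp flip: sum_distrib_right of_nat_sum)
      also have "sqrt (pi / s) ^ DIM('a) = sqrt pi ^ DIM('a) * s powr (- real DIM('a) / 2)"
        using s by (simp add: real_sqrt_divide power_divide powr_half_sqrt[symmetric] powr_powr
            powr_minus_divide flip: powr_realpow)
      then have "s powr (- 1 - \<gamma>) * (2 ^ m * X) = 2 ^ m * sqrt pi ^ DIM('a) * M *
          ((s powr (- 1 - \<gamma>) * s powr (- real DIM('a) / 2)) * exp (- (b / s)))"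
        by (simp add: X_def mult_ac)
      also have "s powr (- 1 - \<gamma>) * s powr (- real DIM('a) / 2) = s powr (- 1 - a)"
        by (simp add: a_def powr_add[symmetric] algebra_simps)
      finally show ?thesis using s by simp
    qed (simp add: \<Phi>_def pow_kernel_def)
    have "c * cmod (LINT \<xi>|lborel. cis (x \<bullet> \<xi>) * complex_of_real (norm \<xi> powr (2 * \<gamma>)) * fourier prof \<xi>)
        = cmod (LINT \<xi>|lborel. LINT s|lborel. \<Phi> \<xi> s)"
      using c by (simp add: inner norm_mult)
    also have "(LINT \<xi>|lborel. LINT s|lborel. \<Phi> \<xi> s) = (LINT s|lborel. LINT \<xi>|lborel. \<Phi> \<xi> s)"
      by (rule lborel_pair.Fubini_integral[OF int, symmetric])
    also have "cmod \<dots> \<le> (LINT s|lborel. cmod (LINT \<xi>|lborel. \<Phi> \<xi> s))"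
      by (rule integral_norm_bound)
    also have "\<dots> \<le> (LINT s|lborel. 2 ^ m * sqrt pi ^ DIM('a) * M * (indicator {0<..} s * (s powr (- 1 - a) * exp (- (b / s)))))"
      by (rule integral_mono'[OF integrable_mult_right[OF inv_exp_integral(1)[OF a b]]])
        (use outer order_trans[OF norm_ge_zero outer] in auto)
    also have "\<dots> = 2 ^ m * sqrt pi ^ DIM('a) * M * (inv_exp_const a * b powr (- a))"
      using inv_exp_integral(2)[OF a b] by simp
    also have "b powr (- a) = (16 * real m) powr a * norm x powr (- (2 * \<gamma> + real DIM('a)))"
    proof -
      have "((norm x)\<^sup>2) powr (- a) = norm x powr (- (2 * \<gamma> + real DIM('a)))"
        using x0 by (simp add: a_def powr_powr flip: powr_numeral)
      moreover have "b powr (- a) = ((norm x)\<^sup>2) powr (- a) / (16 * real m) powr (- a)"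
        unfolding b_def by (rule powr_divide)
      ultimately show ?thesis by (metis powr_minus divide_inverse inverse_inverse_eq mult.commute)
    qed
    finally show ?thesis using c unfolding C_def by (simp add: pos_le_divide_eq mult_ac)
  qed
  have "0 \<le> inv_exp_const a" unfolding inv_exp_const_def
    by (rule Bochner_Integration.integral_nonneg) simp
  then have "0 \<le> C" using M c by (simp add: C_def)
  with bound show ?thesis by blast
qed

section \<open>Dyadic superpositions of bumps\<close>

lemma lborel_affine_change:
  fixes f :: "'a::euclidean_space \<Rightarrow> 'b::{banach,second_countable_topology}"
  assumes [measurable]: "f \<in> borel_measurable borel" and c: "c \<noteq> 0"
  shows "integrable lborel (\<lambda>x. f (t + c *\<^sub>R x)) \<longleftrightarrow> integrable lborel f"
    and "(LINT x|lborel. f (t + c *\<^sub>R x)) = (LINT x|lborel. f x) /\<^sub>R \<bar>c\<bar> ^ DIM('a)"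
proof -
  have l: "(lborel :: 'a measure) = density (distr lborel borel (\<lambda>x. t + c *\<^sub>R x)) (\<lambda>_. \<bar>c\<bar> ^ DIM('a))"
    using lborel_affine[of c t] c by simp
  have "integrable lborel f \<longleftrightarrow> integrable (distr lborel borel (\<lambda>x. t + c *\<^sub>R x)) (\<lambda>x. \<bar>c\<bar> ^ DIM('a) *\<^sub>R f x)"
    by (subst l, subst integrable_density) (use c in auto)
  also have "\<dots> \<longleftrightarrow> integrable lborel (\<lambda>x. \<bar>c\<bar> ^ DIM('a) *\<^sub>R f (t + c *\<^sub>R x))"
    by (rule integrable_distr_eq) auto
  also have "\<dots> \<longleftrightarrow> integrable lborel (\<lambda>x. f (t + c *\<^sub>R x))"
    using integrable_scaleR_right[of "\<bar>c\<bar> ^ DIM('a)" lborel "\<lambda>x. f (t + c *\<^sub>R x)"] c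
      integrable_scaleR_right[of "inverse (\<bar>c\<bar> ^ DIM('a))" lborel "\<lambda>x. \<bar>c\<bar> ^ DIM('a) *\<^sub>R f (t + c *\<^sub>R x)"]
    by auto
  finally show "integrable lborel (\<lambda>x. f (t + c *\<^sub>R x)) \<longleftrightarrow> integrable lborel f" ..
  have "(LINT x|lborel. f x) = (LINT x|distr lborel borel (\<lambda>x. t + c *\<^sub>R x). \<bar>c\<bar> ^ DIM('a) *\<^sub>R f x)"
    by (subst l, subst integral_density) (use c in auto)
  also have "\<dots> = (LINT x|lborel. \<bar>c\<bar> ^ DIM('a) *\<^sub>R f (t + c *\<^sub>R x))"
    by (rule integral_distr) auto
  finally show "(LINT x|lborel. f (t + c *\<^sub>R x)) = (LINT x|lborel. f x) /\<^sub>R \<bar>c\<bar> ^ DIM('a)"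
    using c by simp
qed

lemma lborel_dilate:
  fixes f :: "'a::euclidean_space \<Rightarrow> 'b::{banach,second_countable_topology}"
  assumes "f \<in> borel_measurable borel" "0 < c"
  shows "integrable lborel (\<lambda>x. f (c *\<^sub>R x)) \<longleftrightarrow> integrable lborel f"
    and "(LINT x|lborel. f (c *\<^sub>R x)) = (LINT x|lborel. f x) /\<^sub>R c ^ DIM('a)"
  using lborel_affine_change[of f c 0] assms by auto

lemma inner_dilate: "0 < l \<Longrightarrow> (x /\<^sub>R l) \<bullet> (l *\<^sub>R y) = x \<bullet> y"
  by simp

lemma fourier_dilate:
  fixes f :: "'a::euclidean_space \<Rightarrow> real"
  assumes [measurable]: "f \<in> borel_measurable borel" and l: "0 < l"
  shows "fourier (\<lambda>x. f (x /\<^sub>R l)) \<xi> = complex_of_real (l ^ DIM('a)) * fourier f (l *\<^sub>R \<xi>)"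
proof -
  have "fourier (\<lambda>x. f (x /\<^sub>R l)) \<xi>
      = (LINT x|lborel. cis (- ((inverse l *\<^sub>R x) \<bullet> (l *\<^sub>R \<xi>))) * complex_of_real (f (inverse l *\<^sub>R x)))"
    unfolding fourier_def inner_dilate[OF l] ..
  also have "\<dots> = (LINT x|lborel. cis (- (x \<bullet> (l *\<^sub>R \<xi>))) * complex_of_real (f x)) /\<^sub>R inverse l ^ DIM('a)"
    by (rule lborel_dilate(2)[of "\<lambda>x. cis (- (x \<bullet> (l *\<^sub>R \<xi>))) * complex_of_real (f x)"]) (use l in auto)
  finally show ?thesis
    by (simp add: fourier_def scaleR_conv_of_real power_inverse)
qed

lemma frac_laplacian_dilate:
  fixes f :: "'a::euclidean_space \<Rightarrow> real"
  assumes [measurable]: "f \<in> borel_measurable borel" and l: "0 < l"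
  shows "frac_laplacian \<gamma> (\<lambda>x. f (x /\<^sub>R l)) x = l powr (- 2 * \<gamma>) * frac_laplacian \<gamma> f (x /\<^sub>R l)"
proof (cases "\<gamma> = 0")
  case True
  then show ?thesis using l by (simp add: frac_laplacian_def)
next
  case False
  define g where "g \<eta> = cis ((x /\<^sub>R l) \<bullet> \<eta>) * complex_of_real (norm \<eta> powr (2 * \<gamma>)) * fourier f \<eta>" for \<eta>
  have [measurable]: "g \<in> borel_measurable borel" unfolding g_def[abs_def] by measurable
  have "cis (x \<bullet> \<xi>) * complex_of_real (norm \<xi> powr (2 * \<gamma>)) * fourier (\<lambda>x. f (x /\<^sub>R l)) \<xi>
      = complex_of_real (l ^ DIM('a) * l powr (- 2 * \<gamma>)) * g (l *\<^sub>R \<xi>)" for \<xi>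
  proof -
    have "norm (l *\<^sub>R \<xi>) powr (2 * \<gamma>) = l powr (2 * \<gamma>) * norm \<xi> powr (2 * \<gamma>)"
      using l by (simp add: powr_mult)
    then have "l powr (- 2 * \<gamma>) * norm (l *\<^sub>R \<xi>) powr (2 * \<gamma>) = norm \<xi> powr (2 * \<gamma>)"
      using l by (simp add: powr_minus)
    then have "complex_of_real (norm \<xi> powr (2 * \<gamma>))
        = complex_of_real (l powr (- 2 * \<gamma>)) * complex_of_real (norm (l *\<^sub>R \<xi>) powr (2 * \<gamma>))"
      by (metis of_real_mult)
    then show ?thesis unfolding g_def fourier_dilate[OF assms] inner_dilate[OF l] of_real_mult by (simp only: mult_ac)
  qed
  then have "(LINT \<xi>|lborel. cis (x \<bullet> \<xi>) * complex_of_real (norm \<xi> powr (2 * \<gamma>)) * fourier (\<lambda>x. f (x /\<^sub>R l)) \<xi>)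
      = complex_of_real (l ^ DIM('a) * l powr (- 2 * \<gamma>)) * ((LINT \<eta>|lborel. g \<eta>) /\<^sub>R l ^ DIM('a))"
    using lborel_dilate(2)[of g l] l by simp
  also have "\<dots> = l powr (- 2 * \<gamma>) *\<^sub>R (LINT \<eta>|lborel. g \<eta>)"
    using l by (simp add: scaleR_conv_of_real)
  finally show ?thesis using False by (simp add: frac_laplacian_def g_def)
qed

text \<open>The weighted integrability licenses additivity: a Bochner integral of a non-integrable
  function is 0 by default.\<close>

lemma frac_laplacian_sum:
  fixes f :: "'i \<Rightarrow> 'a::euclidean_space \<Rightarrow> real"
  assumes "finite A" and f: "\<And>i. i \<in> A \<Longrightarrow> integrable lborel (f i)"
    and w: "\<And>i. i \<in> A \<Longrightarrow> integrable lborel (\<lambda>\<xi>. norm \<xi> powr (2 * \<gamma>) * cmod (fourier (f i) \<xi>))"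
  shows "frac_laplacian \<gamma> (\<lambda>x. \<Sum>i\<in>A. a i * f i x) x = (\<Sum>i\<in>A. a i * frac_laplacian \<gamma> (f i) x)"
proof (cases "\<gamma> = 0")
  case False
  have F: "fourier (\<lambda>x. \<Sum>i\<in>A. a i * f i x) \<xi> = (\<Sum>i\<in>A. complex_of_real (a i) * fourier (f i) \<xi>)" for \<xi>
  proof -
    have "fourier (\<lambda>x. \<Sum>i\<in>A. a i * f i x) \<xi>
        = (LINT x|lborel. (\<Sum>i\<in>A. complex_of_real (a i) * (cis (- (x \<bullet> \<xi>)) * complex_of_real (f i x))))"
      unfolding fourier_def by (simp add: sum_distrib_left mult_ac)
    also have "\<dots> = (\<Sum>i\<in>A. complex_of_real (a i) * fourier (f i) \<xi>)"
      unfolding fourier_def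
      by (subst Bochner_Integration.integral_sum) (auto intro!: integrable_mult_right fourier_integrand_integrable f)
    finally show ?thesis .
  qed
  have i: "integrable lborel (\<lambda>\<xi>. cis (x \<bullet> \<xi>) * complex_of_real (norm \<xi> powr (2 * \<gamma>)) * fourier (f i) \<xi>)" if "i \<in> A" for i
  proof (rule Bochner_Integration.integrable_bound[OF w[OF that]])
    have [measurable]: "f i \<in> borel_measurable borel" using f[OF that] by auto
    show "(\<lambda>\<xi>. cis (x \<bullet> \<xi>) * complex_of_real (norm \<xi> powr (2 * \<gamma>)) * fourier (f i) \<xi>) \<in> borel_measurable lborel"
      by measurable
  qed (auto simp: norm_mult)
  have "(LINT \<xi>|lborel. cis (x \<bullet> \<xi>) * complex_of_real (norm \<xi> powr (2 * \<gamma>)) * fourier (\<lambda>x. \<Sum>i\<in>A. a i * f i x) \<xi>)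
      = (LINT \<xi>|lborel. (\<Sum>i\<in>A. complex_of_real (a i) * (cis (x \<bullet> \<xi>) * complex_of_real (norm \<xi> powr (2 * \<gamma>)) * fourier (f i) \<xi>)))"
    by (simp add: F sum_distrib_left mult_ac)
  also have "\<dots> = (\<Sum>i\<in>A. complex_of_real (a i) * (LINT \<xi>|lborel. cis (x \<bullet> \<xi>) * complex_of_real (norm \<xi> powr (2 * \<gamma>)) * fourier (f i) \<xi>))"
    by (subst Bochner_Integration.integral_sum) (auto intro!: integrable_mult_right i)
  finally show ?thesis using False
    by (simp add: frac_laplacian_def sum_divide_distrib)
qed (simp add: frac_laplacian_def)

text \<open>A constant factor passes through the Bochner integral even when the integrand is not
  integrable, both sides then being 0 by default. The time factor of the test function is pulled out
  in this way.\<close>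

lemma frac_laplacian_cmult:
  "frac_laplacian \<gamma> (\<lambda>x. c * f x) x = c * frac_laplacian \<gamma> f x"
proof (cases "\<gamma> = 0")
  case False
  have "fourier (\<lambda>x. c * f x) \<xi> = complex_of_real c * fourier f \<xi>" for \<xi>
    by (simp add: fourier_def mult.left_commute[of _ "complex_of_real c"])
  with False show ?thesis
    by (simp add: frac_laplacian_def mult.left_commute[of _ "complex_of_real c"])
qed (simp add: frac_laplacian_def)

lemma frac_laplacian_measurable [measurable]:
  fixes f :: "'a::euclidean_space \<Rightarrow> real"
  assumes [measurable]: "f \<in> borel_measurable borel"
  shows "frac_laplacian \<gamma> f \<in> borel_measurable borel"
  unfolding frac_laplacian_def[abs_def] by measurable

text \<open>A single q has to serve both orders \<sigma> and \<delta>, so the decay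
  |x|^(-2\<gamma>-n) is weakened to |x|^(-q) far out. Within |x| \<le> 4n the uniform bound B is
  itself at most a multiple of |x|^(-q); this is the first summand of D.\<close>

lemma prof_frac_bound:
  assumes \<gamma>: "0 < \<gamma>" and q: "0 < q" "q \<le> 2 * \<gamma> + real DIM('a)"
  shows "\<exists>C\<ge>0. \<forall>x::'a::euclidean_space. \<bar>frac_laplacian \<gamma> prof x\<bar> \<le> C \<and>
    (x \<noteq> 0 \<longrightarrow> \<bar>frac_laplacian \<gamma> prof x\<bar> \<le> C * norm x powr (- q))"
proof -
  define I where "I x = (LINT \<xi>|lborel. cis (x \<bullet> \<xi>) * complex_of_real (norm \<xi> powr (2 * \<gamma>)) * fourier prof \<xi>)" for x :: 'a
  define B where "B = (LINT \<xi>|lborel. norm (\<xi>::'a) powr (2 * \<gamma>) * cmod (fourier prof \<xi>))"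
  obtain C where C: "0 \<le> C" "\<And>x. 4 * real DIM('a) < norm x \<Longrightarrow> cmod (I x) \<le> C * norm x powr (- (2 * \<gamma> + real DIM('a)))"
    using prof_frac_decay[OF \<gamma>, where 'a = 'a] unfolding I_def by blast
  have B: "cmod (I x) \<le> B" for x
    unfolding I_def B_def by (rule order_trans[OF integral_norm_bound]) (simp add: norm_mult)
  have B0: "0 \<le> B" using B[of 0] norm_ge_zero order_trans by blast
  have frac: "\<bar>frac_laplacian \<gamma> prof x\<bar> \<le> cmod (I x)" for x
  proof -
    have "1 \<le> (2 * pi) ^ DIM('a)" using pi_gt3 by (intro one_le_power) linarith
    then have "\<bar>Re (I x)\<bar> / (2 * pi) ^ DIM('a) \<le> cmod (I x) / 1"
      by (intro frac_le abs_Re_le_cmod) auto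
    then show ?thesis using \<gamma> by (simp add: frac_laplacian_def I_def abs_divide)
  qed
  define D where "D = B * (4 * real DIM('a)) powr q + B + C"
  have D0: "0 \<le> D" using B0 C by (simp add: D_def)
  have "cmod (I x) \<le> D * norm x powr (- q)" if "x \<noteq> 0" for x
  proof (cases "4 * real DIM('a) < norm x")
    case True
    have "1 \<le> real DIM('a)" by (simp add: Suc_leI)
    with True have "1 \<le> norm x" by linarith
    then have "norm x powr (- (2 * \<gamma> + real DIM('a))) \<le> norm x powr (- q)"
      using q by (intro powr_mono) auto
    then have "cmod (I x) \<le> C * norm x powr (- q)"
      using C(2)[OF True] C(1) mult_left_mono order_trans by blast
    also have "\<dots> \<le> D * norm x powr (- q)"
      using B0 by (intro mult_right_mono) (auto simp: D_def)
    finally show ?thesis .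
  next
    case False
    have "norm x powr q \<le> (4 * real DIM('a)) powr q"
      using False q by (intro powr_mono2) auto
    then have "B * 1 \<le> B * ((4 * real DIM('a)) powr q * norm x powr (- q))"
      using that B0 by (intro mult_left_mono) (auto simp: powr_minus field_simps)
    also have "\<dots> \<le> D * norm x powr (- q)"
      unfolding mult.assoc[symmetric] using B0 C by (intro mult_right_mono) (auto simp: D_def)
    finally show ?thesis using B[of x] by simp
  qed
  moreover have "cmod (I x) \<le> D" for x
    using B[of x] B0 C(1) by (simp add: D_def add_increasing2 add_increasing)
  ultimately show ?thesis using D0 frac order_trans by blast
qed

text \<open>For \<open>\<bar>x\<bar> \<le> K * 2 ^ J\<close>, \<open>cutoff\<close> is comparable to \<open>min 1 ((\<bar>x\<bar> / K) powr (- q))\<close>, uniformly in \<open>J\<close>;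
  \<open>tail\<close> is the part of this profile that the finitely many scales miss.\<close>

definition cutoff :: "real \<Rightarrow> nat \<Rightarrow> real \<Rightarrow> 'a::euclidean_space \<Rightarrow> real" where
  "cutoff q J K x = (\<Sum>j\<le>J. (2 powr (- q)) ^ j * prof (x /\<^sub>R (K * 2 ^ j)))"

definition tail :: "real \<Rightarrow> nat \<Rightarrow> real \<Rightarrow> 'a::euclidean_space \<Rightarrow> real" where
  "tail q J K x = indicator {x. K * 2 ^ J < norm x} x * (norm x / K) powr (- q)"

lemma tail_measurable [measurable]: "tail q J K \<in> borel_measurable borel"
  unfolding tail_def[abs_def] by measurable

lemma tail_nonneg: "0 \<le> tail q J K x"
  by (auto simp: tail_def)

lemma C_k_cutoff: "C_k k (cutoff q J K)"
  unfolding cutoff_def[abs_def] prof_def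
  by (intro C_k_sum C_k_mult C_k_prod C_k_const C_k_compose[OF C_k_bump] C_k_bounded_linear
      bounded_linear_inner_left_comp bounded_linear_scaleR_right)

lemma cutoff_measurable [measurable]: "cutoff q J K \<in> borel_measurable borel"
  unfolding cutoff_def[abs_def] by measurable

lemma cutoff_nonneg: "0 \<le> cutoff q J K x"
  unfolding cutoff_def by (intro sum_nonneg mult_nonneg_nonneg prof_nonneg) auto

lemma geometric_sum_le:
  fixes r :: real assumes "0 \<le> r" "r < 1" shows "(\<Sum>j\<le>J. r ^ j) \<le> 1 / (1 - r)"
proof -
  have "(\<Sum>j\<le>J. r ^ j) \<le> (\<Sum>j. r ^ j)"
    using assms by (intro sum_le_suminf summable_geometric) auto
  then show ?thesis using assms by (simp add: suminf_geometric)
qed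

lemma two_powr_sum_le_2:
  assumes "1 \<le> q" shows "(\<Sum>j\<le>J. (2 powr (- q)) ^ j) \<le> (2::real)"
proof -
  have "(2::real) powr (- q) \<le> 2 powr (- 1)" using assms by (intro powr_mono) auto
  then have *: "(2::real) powr (- q) \<le> 1 / 2" by (simp add: powr_minus)
  then have "(\<Sum>j\<le>J. ((2::real) powr (- q)) ^ j) \<le> 1 / (1 - 2 powr (- q))"
    by (intro geometric_sum_le) auto
  also have "\<dots> \<le> 1 / (1 / 2)" using * by (intro divide_left_mono) auto
  finally show ?thesis by simp
qed

lemma cutoff_le_2: assumes "1 \<le> q" shows "cutoff q J K x \<le> 2"
proof -
  have "cutoff q J K x \<le> (\<Sum>j\<le>J. (2 powr (- q)) ^ j * 1)"
    unfolding cutoff_def by (intro sum_mono mult_left_mono prof_le_1) auto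
  then show ?thesis using two_powr_sum_le_2[OF assms, of J] by simp
qed

lemma cutoff_ge_term:
  assumes "0 < K" "j \<le> J" "norm x \<le> K * 2 ^ j"
  shows "(2 powr (- q)) ^ j \<le> cutoff q J K x"
proof -
  have "norm (x /\<^sub>R (K * 2 ^ j)) \<le> 1"
    using assms by (simp add: divide_simps)
  then have "(2 powr (- q)) ^ j = (2 powr (- q)) ^ j * prof (x /\<^sub>R (K * 2 ^ j))"
    by (simp only: prof_eq_1)
  also have "\<dots> \<le> cutoff q J K x" unfolding cutoff_def
    by (rule member_le_sum[where f = "\<lambda>j. (2 powr (- q)) ^ j * prof (x /\<^sub>R (K * 2 ^ j))"])
      (use assms in \<open>auto intro!: mult_nonneg_nonneg prof_nonneg\<close>)
  finally show ?thesis .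
qed

lemma cutoff_ge_1: "0 < K \<Longrightarrow> norm x \<le> K \<Longrightarrow> 1 \<le> cutoff q J K x"
  using cutoff_ge_term[of K 0 J x q] by simp

text \<open>For |x| \<le> K every scale is on its plateau. The common value depends on q and J but
  not on x, which is what the pairing with \<open>u1\<close> needs.\<close>

lemma cutoff_plateau:
  assumes "0 < K" "norm x \<le> K" shows "cutoff q J K x = cutoff q J K 0"
proof -
  have "norm (x /\<^sub>R (K * 2 ^ j)) \<le> 1" for j
  proof -
    have "norm x \<le> K * 2 ^ j" using assms by (simp add: order_trans mult_le_cancel_left1)
    then show ?thesis using assms by (simp add: divide_simps)
  qed
  then show ?thesis unfolding cutoff_def by (simp only: prof_eq_1) (simp add: prof_eq_1)
qed

lemma cutoff_eq_0:
  fixes x :: "'a::euclidean_space"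
  assumes "0 < K" "2 * real DIM('a) * K * 2 ^ J < norm x"
  shows "cutoff q J K x = 0"
  unfolding cutoff_def
proof (rule sum.neutral, rule ballI)
  fix j assume "j \<in> {..J}"
  then have "2 * real DIM('a) * K * 2 ^ j \<le> 2 * real DIM('a) * K * 2 ^ J"
    using assms by (intro mult_left_mono power_increasing) auto
  with assms have "2 * real DIM('a) * K * 2 ^ j < norm x" by linarith
  then have "2 * real DIM('a) < norm (x /\<^sub>R (K * 2 ^ j))"
    using assms by (simp add: divide_simps mult_ac)
  then show "(2 powr (- q)) ^ j * prof (x /\<^sub>R (K * 2 ^ j)) = 0" by (simp add: prof_eq_0)
qed

lemma cutoff_integrable: "integrable lborel (cutoff q J K :: 'a::euclidean_space \<Rightarrow> real)" if "0 < K"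
  by (rule cont_compact_support_integrable[where S = "cball 0 (2 * real DIM('a) * K * 2 ^ J)"])
    (use C_k_cutoff[of 0] cutoff_eq_0[OF that] in \<open>auto simp: not_le\<close>)

text \<open>The j-th dilate has an integral of order (K 2^j)^n and the weight 2^(-qj), so the sum is
  geometric with ratio r = 2^(n-q) < 1 and is bounded uniformly in J.\<close>

lemma cutoff_integral_le:
  assumes q: "real DIM('a::euclidean_space) < q"
  shows "\<exists>B\<ge>0. \<forall>J. \<forall>K>0. (LINT x|lborel. cutoff q J K (x::'a)) \<le> B * K ^ DIM('a)"
proof -
  define M where "M = (LINT y|lborel. prof (y::'a))"
  have M: "0 \<le> M" unfolding M_def by (rule Bochner_Integration.integral_nonneg) (rule prof_nonneg)
  define r where "r = (2::real) powr (- (q - DIM('a)))"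
  have "r < 2 powr 0" unfolding r_def using q by (intro powr_less_mono) auto
  then have r: "0 \<le> r" "r < 1" by (auto simp: r_def)
  have "(LINT x|lborel. cutoff q J K (x::'a)) \<le> (M * (1 / (1 - r))) * K ^ DIM('a)" if K: "0 < K" for J K
  proof -
    have i: "integrable lborel (\<lambda>x::'a. prof (inverse (K * 2 ^ j) *\<^sub>R x))" for j
      by (subst lborel_dilate(1)) (use K integrable_prof in auto)
    have e: "(LINT x|lborel. prof (inverse (K * 2 ^ j) *\<^sub>R (x::'a))) = M * (K * 2 ^ j) ^ DIM('a)" for j
      by (subst lborel_dilate(2)) (use K in \<open>auto simp: M_def power_inverse simp del: inverse_mult_distrib\<close>)
    have "(LINT x|lborel. cutoff q J K (x::'a)) = (\<Sum>j\<le>J. (2 powr (- q)) ^ j * (M * (K * 2 ^ j) ^ DIM('a)))"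
      unfolding cutoff_def by (subst Bochner_Integration.integral_sum) (auto intro!: i integrable_mult_right simp: e simp del: inverse_mult_distrib)
    also have "\<dots> = (\<Sum>j\<le>J. M * K ^ DIM('a) * r ^ j)"
    proof (rule sum.cong[OF refl])
      fix j
      have "r = 2 powr (- q) * 2 ^ DIM('a)"
        by (simp add: r_def powr_diff powr_minus powr_realpow divide_inverse mult.commute)
      then show "(2 powr (- q)) ^ j * (M * (K * 2 ^ j) ^ DIM('a)) = M * K ^ DIM('a) * r ^ j"
        by (simp add: power_mult_distrib power_mult[symmetric] mult_ac)
    qed
    also have "\<dots> = M * K ^ DIM('a) * (\<Sum>j\<le>J. r ^ j)" by (simp add: sum_distrib_left)
    also have "\<dots> \<le> M * K ^ DIM('a) * (1 / (1 - r))"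
      using K M by (intro mult_left_mono geometric_sum_le r) auto
    finally show ?thesis by (simp add: mult_ac)
  qed
  then show ?thesis using M r by (intro exI[of _ "M * (1 / (1 - r))"]) auto
qed

lemma cutoff_ge_powr:
  fixes x :: "'a::euclidean_space"
  assumes K: "0 < K" and q: "0 < q" and x: "K < norm x" "norm x \<le> K * 2 ^ J"
  shows "(norm x / K) powr (- q) \<le> 2 powr q * cutoff q J K x"
proof -
  \<comment> \<open>The least admissible scale: minimality gives |x| > K 2^(j-1), so replacing |x|/K
    by 2^j costs at most one factor 2^q.\<close>
  define j where "j = (LEAST j. norm x \<le> K * 2 ^ j)"
  have j: "norm x \<le> K * 2 ^ j" "j \<le> J"
    unfolding j_def using x(2) by (auto intro: LeastI Least_le)
  have "j \<noteq> 0" using j x by (cases j) auto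
  then obtain i where i: "j = Suc i" by (cases j) auto
  have "\<not> norm x \<le> K * 2 ^ i"
    using not_less_Least[of i "\<lambda>j. norm x \<le> K * 2 ^ j"] i unfolding j_def by simp
  then have "2 powr real i \<le> norm x / K" using K by (simp add: pos_le_divide_eq powr_realpow mult.commute)
  then have "(norm x / K) powr (- q) \<le> (2 powr real i) powr (- q)"
    using q by (intro powr_mono2') auto
  also have "\<dots> = 2 powr q * (2 powr (- q)) ^ j"
    by (simp add: i powr_powr powr_add[symmetric] powr_realpow[symmetric] algebra_simps)
  also have "\<dots> \<le> 2 powr q * cutoff q J K x"
    by (intro mult_left_mono cutoff_ge_term K j) auto
  finally show ?thesis .
qed

lemma frac_laplacian_cutoff:
  fixes x :: "'a::euclidean_space"
  assumes "0 < K" "0 < \<gamma>"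
  shows "frac_laplacian \<gamma> (cutoff q J K) x =
    K powr (- 2 * \<gamma>) * (\<Sum>j\<le>J. (2 powr (- q)) ^ j * (2 powr (- 2 * \<gamma>)) ^ j * frac_laplacian \<gamma> prof (x /\<^sub>R (K * 2 ^ j)))"
proof -
  have l: "0 < K * 2 ^ j" for j :: nat using assms by simp
  have "frac_laplacian \<gamma> (cutoff q J K) x
      = (\<Sum>j\<le>J. (2 powr (- q)) ^ j * frac_laplacian \<gamma> (\<lambda>x. prof (x /\<^sub>R (K * 2 ^ j))) x)"
    unfolding cutoff_def[abs_def]
  proof (rule frac_laplacian_sum)
    fix j
    show "integrable lborel (\<lambda>x::'a. prof (x /\<^sub>R (K * 2 ^ j)))"
      by (subst lborel_dilate(1)) (use l[of j] integrable_prof in \<open>auto simp del: inverse_mult_distrib\<close>)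
    define l where "l = K * 2 ^ j"
    have l0: "0 < l" using l by (simp add: l_def)
    have "integrable lborel (\<lambda>\<xi>. (\<lambda>\<xi>::'a. norm \<xi> powr (2 * \<gamma>) * cmod (fourier prof \<xi>)) (l *\<^sub>R \<xi>))"
      by (subst lborel_dilate(1)[OF _ l0]) (use assms prof_fourier_weight_integrable[of "2 * \<gamma>"] in auto)
    then have "integrable lborel (\<lambda>\<xi>::'a. l powr (- 2 * \<gamma>) * l ^ DIM('a) * (norm (l *\<^sub>R \<xi>) powr (2 * \<gamma>) * cmod (fourier prof (l *\<^sub>R \<xi>))))"
      by (intro integrable_mult_right)
    moreover have "l powr (- 2 * \<gamma>) * l ^ DIM('a) * (norm (l *\<^sub>R \<xi>) powr (2 * \<gamma>) * cmod (fourier prof (l *\<^sub>R \<xi>)))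
        = norm \<xi> powr (2 * \<gamma>) * cmod (fourier (\<lambda>x. prof (x /\<^sub>R l)) \<xi>)" for \<xi> :: 'a
      using l0 by (simp add: fourier_dilate norm_mult norm_power powr_mult powr_minus)
    ultimately show "integrable lborel (\<lambda>\<xi>::'a. norm \<xi> powr (2 * \<gamma>) * cmod (fourier (\<lambda>x. prof (x /\<^sub>R (K * 2 ^ j))) \<xi>))"
      unfolding l_def[symmetric] by (simp only:)
  qed auto
  also have "\<dots> = (\<Sum>j\<le>J. (2 powr (- q)) ^ j * ((K * 2 ^ j) powr (- 2 * \<gamma>) * frac_laplacian \<gamma> prof (x /\<^sub>R (K * 2 ^ j))))"
    by (simp only: frac_laplacian_dilate[OF prof_measurable l])
  also have "\<dots> = (\<Sum>j\<le>J. K powr (- 2 * \<gamma>) * ((2 powr (- q)) ^ j * (2 powr (- 2 * \<gamma>)) ^ j * frac_laplacian \<gamma> prof (x /\<^sub>R (K * 2 ^ j))))"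
  proof (rule sum.cong[OF refl])
    fix j
    have "(K * 2 ^ j) powr (- 2 * \<gamma>) = K powr (- 2 * \<gamma>) * (2 powr (- 2 * \<gamma>)) ^ j"
      by (simp add: powr_mult powr_realpow[symmetric] powr_powr mult_ac)
    then show "(2 powr (- q)) ^ j * ((K * 2 ^ j) powr (- 2 * \<gamma>) * frac_laplacian \<gamma> prof (x /\<^sub>R (K * 2 ^ j)))
      = K powr (- 2 * \<gamma>) * ((2 powr (- q)) ^ j * (2 powr (- 2 * \<gamma>)) ^ j * frac_laplacian \<gamma> prof (x /\<^sub>R (K * 2 ^ j)))"
      by (simp add: mult_ac)
  qed
  finally show ?thesis by (simp add: sum_distrib_left)
qed

text \<open>The sum T over the scales is estimated in two ways: the uniform bound gives T \<le> 2C,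
  good for |x| \<le> K, and the decay bound gives T \<le> C S (|x|/K)^(-q), good outside. Up to |x|
  = K 2^J the latter is at most a multiple of the cutoff; beyond, it is a multiple of
  \<open>tail\<close>.\<close>

lemma frac_laplacian_cutoff_bound:
  assumes \<gamma>: "0 \<le> \<gamma>" and q: "1 \<le> q" "\<gamma> = 0 \<or> q \<le> 2 * \<gamma> + real DIM('a::euclidean_space)"
  shows "\<exists>C\<ge>0. \<forall>J. \<forall>K>0. \<forall>x::'a. \<bar>frac_laplacian \<gamma> (cutoff q J K) x\<bar>
    \<le> C * K powr (- 2 * \<gamma>) * (cutoff q J K x + tail q J K x)"
proof (cases "\<gamma> = 0")
  case True
  then show ?thesis
    by (intro exI[of _ 1]) (simp add: frac_laplacian_def cutoff_nonneg tail_nonneg)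
next
  case False
  with \<gamma> q have g0: "0 < \<gamma>" and q0: "0 < q" and q2: "q \<le> 2 * \<gamma> + real DIM('a)" by auto
  obtain C where C: "0 \<le> C" "\<And>x::'a. \<bar>frac_laplacian \<gamma> prof x\<bar> \<le> C"
    "\<And>x::'a. x \<noteq> 0 \<Longrightarrow> \<bar>frac_laplacian \<gamma> prof x\<bar> \<le> C * norm x powr (- q)"
    using prof_frac_bound[OF g0 q0 q2] by blast
  define r where "r = (2::real) powr (- 2 * \<gamma>)"
  have "r < 2 powr 0" unfolding r_def using g0 by (intro powr_less_mono) auto
  then have r: "0 \<le> r" "r < 1" by (auto simp: r_def)
  define S where "S = 1 / (1 - r)"
  have S: "0 \<le> S" using r by (simp add: S_def)
  define D where "D = 2 * C + C * S + C * S * 2 powr q"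
  have D: "0 \<le> D" "2 * C \<le> D" "C * S \<le> D" "C * S * 2 powr q \<le> D"
    using C(1) S by (simp_all add: D_def)
  have "\<bar>frac_laplacian \<gamma> (cutoff q J K) x\<bar> \<le> D * K powr (- 2 * \<gamma>) * (cutoff q J K x + tail q J K x)"
    if K: "0 < K" for J K and x :: 'a
  proof -
    define T where "T = (\<Sum>j\<le>J. (2 powr (- q)) ^ j * r ^ j * \<bar>frac_laplacian \<gamma> prof (x /\<^sub>R (K * 2 ^ j))\<bar>)"
    have "\<bar>frac_laplacian \<gamma> (cutoff q J K) x\<bar> = K powr (- 2 * \<gamma>) *
        \<bar>\<Sum>j\<le>J. (2 powr (- q)) ^ j * r ^ j * frac_laplacian \<gamma> prof (x /\<^sub>R (K * 2 ^ j))\<bar>"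
      by (simp add: frac_laplacian_cutoff[OF K g0] abs_mult r_def)
    also have "\<dots> \<le> K powr (- 2 * \<gamma>) * T"
      unfolding T_def by (intro mult_left_mono order_trans[OF sum_abs] sum_mono) (auto simp: abs_mult r)
    finally have 1: "\<bar>frac_laplacian \<gamma> (cutoff q J K) x\<bar> \<le> K powr (- 2 * \<gamma>) * T" .
    have T1: "T \<le> 2 * C"
    proof -
      have "T \<le> (\<Sum>j\<le>J. (2 powr (- q)) ^ j * 1 * C)"
        unfolding T_def using r by (intro sum_mono mult_mono mult_left_mono power_le_one C) auto
      also have "\<dots> = (\<Sum>j\<le>J. (2 powr (- q)) ^ j) * C" by (simp add: sum_distrib_right)
      also have "\<dots> \<le> 2 * C" by (intro mult_right_mono two_powr_sum_le_2 q C)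
      finally show ?thesis .
    qed
    \<comment> \<open>The weight 2^(-qj) cancels exactly against the dilation inside |x|^(-q), so
      every scale contributes equally; convergence uniform in J comes from r^j = 2^(-2\<gamma>j),
      the scaling factor of an operator of positive order.\<close>
    have T2: "T \<le> C * S * (norm x / K) powr (- q)" if x: "x \<noteq> 0"
    proof -
      have "(2 powr (- q)) ^ j * r ^ j * \<bar>frac_laplacian \<gamma> prof (x /\<^sub>R (K * 2 ^ j))\<bar>
          \<le> C * (norm x / K) powr (- q) * r ^ j" for j
      proof -
        have "norm (x /\<^sub>R (K * 2 ^ j)) = (norm x / K) / 2 ^ j"
          using K by (simp add: divide_inverse abs_mult mult_ac)
        then have A: "norm (x /\<^sub>R (K * 2 ^ j)) powr (- q) = (norm x / K) powr (- q) * (2 ^ j) powr q"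
          by (metis powr_divide powr_minus divide_inverse inverse_inverse_eq)
        have B: "(2 powr (- q)) ^ j * ((2::real) ^ j) powr q = 1"
          by (simp add: powr_realpow[symmetric] powr_powr powr_add[symmetric])
        have e: "(2 powr (- q)) ^ j * norm (x /\<^sub>R (K * 2 ^ j)) powr (- q) = (norm x / K) powr (- q)"
          by (simp only: A mult.left_commute[of _ "(norm x / K) powr (- q)"] B mult_1_right)
        have "\<bar>frac_laplacian \<gamma> prof (x /\<^sub>R (K * 2 ^ j))\<bar> \<le> C * norm (x /\<^sub>R (K * 2 ^ j)) powr (- q)"
          using x K by (intro C) auto
        then have "(2 powr (- q)) ^ j * r ^ j * \<bar>frac_laplacian \<gamma> prof (x /\<^sub>R (K * 2 ^ j))\<bar>
           \<le> (2 powr (- q)) ^ j * r ^ j * (C * norm (x /\<^sub>R (K * 2 ^ j)) powr (- q))"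
          using r by (intro mult_left_mono) auto
        also have "\<dots> = C * ((2 powr (- q)) ^ j * norm (x /\<^sub>R (K * 2 ^ j)) powr (- q)) * r ^ j"
          by (simp only: mult_ac)
        finally show ?thesis unfolding e .
      qed
      then have "T \<le> (\<Sum>j\<le>J. C * (norm x / K) powr (- q) * r ^ j)"
        unfolding T_def by (rule sum_mono)
      also have "\<dots> = C * (norm x / K) powr (- q) * (\<Sum>j\<le>J. r ^ j)" by (simp add: sum_distrib_left)
      also have "\<dots> \<le> C * (norm x / K) powr (- q) * S"
        unfolding S_def using C by (intro mult_left_mono geometric_sum_le r) auto
      finally show ?thesis by (simp add: mult_ac)
    qed
    have "T \<le> D * (cutoff q J K x + tail q J K x)"
    proof -
      have c0: "0 \<le> cutoff q J K x" and t0: "0 \<le> tail q J K x"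
        by (rule cutoff_nonneg, rule tail_nonneg)
      consider "norm x \<le> K" | "K < norm x" "norm x \<le> K * 2 ^ J" | "K < norm x" "K * 2 ^ J < norm x"
        by linarith
      then show ?thesis
      proof cases
        case 1
        have "T \<le> D * 1" using T1 D by simp
        also have "\<dots> \<le> D * (cutoff q J K x + tail q J K x)"
          using cutoff_ge_1[OF K 1, of q J] t0 D by (intro mult_left_mono) auto
        finally show ?thesis .
      next
        case 2
        then have "x \<noteq> 0" using K by auto
        note T2[OF this]
        also have "C * S * (norm x / K) powr (- q) \<le> C * S * (2 powr q * cutoff q J K x)"
          using C S by (intro mult_left_mono cutoff_ge_powr K q0 2) auto
        also have "\<dots> \<le> D * cutoff q J K x"
          unfolding mult.assoc[symmetric] by (intro mult_right_mono D c0)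
        also have "\<dots> \<le> D * (cutoff q J K x + tail q J K x)" using t0 D by (intro mult_left_mono) auto
        finally show ?thesis .
      next
        case 3
        then have "x \<noteq> 0" using K by auto
        note T2[OF this]
        also have "C * S * (norm x / K) powr (- q) \<le> D * tail q J K x"
          using 3 D by (simp add: tail_def mult_right_mono)
        also have "\<dots> \<le> D * (cutoff q J K x + tail q J K x)" using c0 D by (intro mult_left_mono) auto
        finally show ?thesis .
      qed
    qed
    then have "K powr (- 2 * \<gamma>) * T \<le> K powr (- 2 * \<gamma>) * (D * (cutoff q J K x + tail q J K x))"
      by (intro mult_left_mono) auto
    with 1 show ?thesis by (simp add: mult_ac)
  qed
  with D show ?thesis by blast
qed

text \<open>Where the tail is nonzero |x| > K 2^J \<ge> 1, so q \<ge> n and 1 + x_b^2 \<le> 2 |x|^2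
  bound |x|^(-2q) by a multiple of the product of 1 / (1 + x_b^2), which is integrable and
  independent of J. At each point the tail is eventually 0, and dominated convergence
  applies.\<close>

lemma tail_sq_tendsto_0:
  assumes q: "real DIM('a::euclidean_space) \<le> q" and K: "1 \<le> K"
  shows "integrable lborel (\<lambda>x::'a. (tail q J K x)\<^sup>2)"
    and "(\<lambda>J. LINT x|lborel. (tail q J K (x::'a))\<^sup>2) \<longlonglongrightarrow> 0"
proof -
  define w where "w x = K powr (2 * q) * 2 ^ DIM('a) * (\<Prod>b\<in>Basis. 1 / (1 + (x \<bullet> b)\<^sup>2))" for x :: 'a
  have w: "integrable lborel w"
    unfolding w_def[abs_def]
    by (intro integrable_mult_right integrable_lborel_prod integrable_inverse_1_plus_sq)
  have w0: "0 \<le> w x" for x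
    unfolding w_def by (intro mult_nonneg_nonneg prod_nonneg) (auto simp: add_nonneg_nonneg)
  have bound: "(tail q J K x)\<^sup>2 \<le> w x" for J and x :: 'a
  proof (cases "K * 2 ^ J < norm x")
    case True
    have "1 \<le> K * 2 ^ J" using K mult_mono[of 1 K 1 "2 ^ J"] by simp
    with True have x: "1 \<le> norm x" by linarith
    have "(tail q J K x)\<^sup>2 = (norm x / K) powr (- (2 * q))"
      using True by (simp add: tail_def powr_powr flip: powr_numeral) (simp add: mult.commute)
    also have "\<dots> = K powr (2 * q) * norm x powr (- (2 * q))"
      by (metis powr_divide powr_minus divide_inverse inverse_inverse_eq mult.commute)
    also have "norm x powr (- (2 * q)) \<le> norm x powr (- (2 * real DIM('a)))"
      using x q by (intro powr_mono) auto
    also have "\<dots> = inverse (((norm x)\<^sup>2) ^ DIM('a))"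
    proof -
      have "norm x powr real (2 * DIM('a)) = norm x ^ (2 * DIM('a))" using x by (intro powr_realpow) auto
      then show ?thesis by (simp add: powr_minus power_mult)
    qed
    also have "\<dots> \<le> 2 ^ DIM('a) * (\<Prod>b\<in>Basis. 1 / (1 + (x \<bullet> b)\<^sup>2))"
    proof -
      have "(\<Prod>b\<in>(Basis::'a set). inverse ((norm x)\<^sup>2)) \<le> (\<Prod>b\<in>Basis. 2 * (1 / (1 + (x \<bullet> b)\<^sup>2)))"
      proof (intro prod_mono conjI)
        fix b :: 'a assume b: "b \<in> Basis"
        have "(x \<bullet> b)\<^sup>2 \<le> (norm x)\<^sup>2" using Basis_le_norm[OF b, of x] by (simp add: abs_le_square_iff[symmetric])
        moreover have "1 \<le> (norm x)\<^sup>2" using x by (simp add: one_le_power)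
        ultimately have "1 + (x \<bullet> b)\<^sup>2 \<le> 2 * (norm x)\<^sup>2" by simp
        moreover have "0 < 1 + (x \<bullet> b)\<^sup>2" by (simp add: add_pos_nonneg)
        ultimately show "inverse ((norm x)\<^sup>2) \<le> 2 * (1 / (1 + (x \<bullet> b)\<^sup>2))"
          using x by (simp add: divide_simps)
      qed simp
      then show ?thesis by (simp add: prod.distrib power_inverse prod_dividef)
    qed
    finally show ?thesis by (simp add: w_def mult_left_mono)
  qed (simp add: tail_def w0)
  show "integrable lborel (\<lambda>x::'a. (tail q J K x)\<^sup>2)"
    by (rule Bochner_Integration.integrable_bound[OF w]) (use bound w0 in auto)
  have "(\<lambda>J. LINT x|lborel. (tail q J K (x::'a))\<^sup>2) \<longlonglongrightarrow> (LINT x|(lborel::'a measure). (0::real))"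
  proof (rule integral_dominated_convergence[OF _ _ w])
    show "AE x::'a in lborel. (\<lambda>J. (tail q J K x)\<^sup>2) \<longlonglongrightarrow> 0"
    proof (rule AE_I2)
      fix x :: 'a
      obtain N where N: "norm x < 2 ^ N" using real_arch_pow[of 2 "norm x"] by auto
      have "tail q J K x = 0" if "N \<le> J" for J
      proof -
        have "(2::real) ^ N \<le> 2 ^ J" using that by (intro power_increasing) auto
        also have "\<dots> \<le> K * 2 ^ J" using K by simp
        finally show ?thesis using N by (simp add: tail_def)
      qed
      then have "eventually (\<lambda>J. (tail q J K x)\<^sup>2 = 0) sequentially"
        by (auto simp: eventually_sequentially)
      then show "(\<lambda>J. (tail q J K x)\<^sup>2) \<longlonglongrightarrow> 0" by (rule tendsto_eventually)
    qed
  qed (use bound in auto)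
  then show "(\<lambda>J. LINT x|lborel. (tail q J K (x::'a))\<^sup>2) \<longlonglongrightarrow> 0" by simp
qed

section \<open>The Plancherel inequality\<close>

lemma fourier_gauss_weight_integrable:
  fixes h :: "'a::euclidean_space \<Rightarrow> real"
  assumes h: "integrable lborel h" and s: "0 < s"
  shows "integrable lborel (\<lambda>\<xi>. exp (- s * (norm \<xi>)\<^sup>2) * (cmod (fourier h \<xi>))\<^sup>2)"
proof (rule Bochner_Integration.integrable_bound)
  have [measurable]: "h \<in> borel_measurable borel" using h by auto
  let ?B = "(LINT x|lborel. \<bar>h x\<bar>)\<^sup>2"
  show "integrable lborel (\<lambda>\<xi>::'a. ?B * exp (- s * (norm \<xi>)\<^sup>2))"
    by (intro integrable_mult_right gaussian_integral s)
  have "(cmod (fourier h \<xi>))\<^sup>2 \<le> ?B" for \<xi>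
    by (intro power_mono fourier_bound h) auto
  then show "AE \<xi> in lborel. norm (exp (- s * (norm \<xi>)\<^sup>2) * (cmod (fourier h \<xi>))\<^sup>2)
      \<le> norm (?B * exp (- s * (norm \<xi>)\<^sup>2))"
    by (auto intro!: AE_I2 simp: mult.commute)
  show "(\<lambda>\<xi>. exp (- s * (norm \<xi>)\<^sup>2) * (cmod (fourier h \<xi>))\<^sup>2) \<in> borel_measurable lborel"
    by measurable
qed

text \<open>The squared \<open>L\<^sup>2\<close> norm of the transform, regularised so that it is finite for every integrable
  function and can be computed by Fubini.\<close>

definition gauss_energy :: "real \<Rightarrow> ('a::euclidean_space \<Rightarrow> real) \<Rightarrow> real" where
  "gauss_energy s h = (LINT \<xi>|lborel. exp (- s * (norm \<xi>)\<^sup>2) * (cmod (fourier h \<xi>))\<^sup>2)"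

text \<open>One factor of the squared modulus is written as the conjugate transform and expanded;
  after Fubini the \<xi> integral is that of \<open>heat_identity\<close>.\<close>

lemma gauss_energy_eq:
  fixes h :: "'a::euclidean_space \<Rightarrow> real"
  assumes h: "integrable lborel h" and s: "0 < s"
  shows "gauss_energy s h = sqrt (pi / s) ^ DIM('a) *
    (LINT x|lborel. h x * (LINT y|lborel. h y * exp (- (norm (x - y))\<^sup>2 / (4 * s))))"
proof -
  have [measurable]: "h \<in> borel_measurable borel" using h by auto
  define F where "F \<xi> x = (cis (x \<bullet> \<xi>) * complex_of_real (exp (- s * (norm \<xi>)\<^sup>2)) * fourier h \<xi>) * complex_of_real (h x)"
    for \<xi> x :: 'a
  have nF: "norm (F \<xi> x) = exp (- s * (norm \<xi>)\<^sup>2) * cmod (fourier h \<xi>) * \<bar>h x\<bar>" for \<xi> x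
    by (simp add: F_def norm_mult)
  have int: "integrable (lborel \<Otimes>\<^sub>M lborel) (\<lambda>(\<xi>, x). F \<xi> x)"
  proof (rule lborel_pair.Fubini_integrable)
    show "(\<lambda>(\<xi>, y). F \<xi> y) \<in> borel_measurable (lborel \<Otimes>\<^sub>M lborel)"
      unfolding F_def by measurable
    have "integrable lborel (\<lambda>\<xi>::'a. exp (- s * (norm \<xi>)\<^sup>2) * cmod (fourier h \<xi>))"
    proof (rule Bochner_Integration.integrable_bound)
      show "integrable lborel (\<lambda>\<xi>::'a. exp (- s * (norm \<xi>)\<^sup>2) * (LINT x|lborel. \<bar>h x\<bar>))"
        by (intro integrable_mult_left gaussian_integral s)
      show "AE \<xi> in lborel. norm (exp (- s * (norm \<xi>)\<^sup>2) * cmod (fourier h \<xi>))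
          \<le> norm (exp (- s * (norm \<xi>)\<^sup>2) * (LINT x|lborel. \<bar>h x\<bar>))"
        using fourier_bound[OF h] by (auto intro!: AE_I2 mult_left_mono order_trans[OF _ abs_ge_self] simp: abs_mult)
    qed measurable
    then show "integrable lborel (\<lambda>\<xi>. LINT y|lborel. norm (case (\<xi>, y) of (\<xi>, y) \<Rightarrow> F \<xi> y))"
      by (simp add: nF)
    show "AE \<xi> in lborel. integrable lborel (\<lambda>y. case (\<xi>, y) of (\<xi>, y) \<Rightarrow> F \<xi> y)"
    proof (rule AE_I2)
      fix \<xi> :: 'a
      have "integrable lborel (\<lambda>x. (complex_of_real (exp (- s * (norm \<xi>)\<^sup>2)) * fourier h \<xi>) * (cis (x \<bullet> \<xi>) * complex_of_real (h x)))"
        by (intro integrable_mult_right integrable_cis_mult) (use h in auto)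
      then show "integrable lborel (\<lambda>y. case (\<xi>, y) of (\<xi>, y) \<Rightarrow> F \<xi> y)"
        by (simp add: F_def mult_ac)
    qed
  qed
  have cnj: "cnj (fourier h \<xi>) = (LINT x|lborel. cis (x \<bullet> \<xi>) * complex_of_real (h x))" for \<xi>
    unfolding fourier_def by (subst Bochner_Integration.integral_cnj[symmetric]) (simp add: cis_cnj)
  have "complex_of_real (gauss_energy s h) = (LINT \<xi>|lborel. complex_of_real (exp (- s * (norm \<xi>)\<^sup>2) * (cmod (fourier h \<xi>))\<^sup>2))"
    unfolding gauss_energy_def by (rule integral_complex_of_real[symmetric])
  also have "\<dots> = (LINT \<xi>|lborel. LINT x|lborel. F \<xi> x)"
  proof (rule Bochner_Integration.integral_cong[OF refl])
    fix \<xi> :: 'a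
    have "complex_of_real (exp (- s * (norm \<xi>)\<^sup>2) * (cmod (fourier h \<xi>))\<^sup>2)
        = (complex_of_real (exp (- s * (norm \<xi>)\<^sup>2)) * fourier h \<xi>) * cnj (fourier h \<xi>)"
      by (simp add: complex_norm_square[symmetric] mult.assoc)
    also have "\<dots> = (LINT x|lborel. (complex_of_real (exp (- s * (norm \<xi>)\<^sup>2)) * fourier h \<xi>) * (cis (x \<bullet> \<xi>) * complex_of_real (h x)))"
      unfolding cnj by simp
    also have "\<dots> = (LINT x|lborel. F \<xi> x)" unfolding F_def by (simp only: mult_ac)
    finally show "complex_of_real (exp (- s * (norm \<xi>)\<^sup>2) * (cmod (fourier h \<xi>))\<^sup>2) = (LINT x|lborel. F \<xi> x)" .
  qed
  also have "\<dots> = (LINT x|lborel. LINT \<xi>|lborel. F \<xi> x)"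
    by (rule lborel_pair.Fubini_integral[OF int, symmetric])
  also have "\<dots> = (LINT x|lborel. complex_of_real (sqrt (pi / s) ^ DIM('a) *
        (h x * (LINT y|lborel. h y * exp (- (norm (x - y))\<^sup>2 / (4 * s))))))"
  proof (rule Bochner_Integration.integral_cong[OF refl])
    fix x :: 'a
    have "(LINT \<xi>|lborel. F \<xi> x) = (LINT \<xi>|lborel. cis (x \<bullet> \<xi>) * complex_of_real (exp (- s * (norm \<xi>)\<^sup>2)) * fourier h \<xi>) * complex_of_real (h x)"
      unfolding F_def by simp
    then show "(LINT \<xi>|lborel. F \<xi> x) = complex_of_real (sqrt (pi / s) ^ DIM('a) *
        (h x * (LINT y|lborel. h y * exp (- (norm (x - y))\<^sup>2 / (4 * s)))))"
      unfolding heat_identity[OF h s] by (simp only: of_real_mult mult_ac)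
  qed
  finally show ?thesis
    unfolding integral_complex_of_real by (simp only: of_real_eq_iff integral_mult_right_zero)
qed

text \<open>Substituting \<open>y = x - 2 sqrt s z\<close>.\<close>

lemma gauss_conv_change:
  fixes h :: "'a::euclidean_space \<Rightarrow> real"
  assumes [measurable]: "h \<in> borel_measurable borel" and s: "0 < s"
  shows "sqrt (pi / s) ^ DIM('a) * (LINT y|lborel. h y * exp (- (norm (x - y))\<^sup>2 / (4 * s)))
    = (2 * sqrt pi) ^ DIM('a) * (LINT z|lborel. h (x + (- (2 * sqrt s)) *\<^sub>R z) * exp (- 1 * (norm z)\<^sup>2))"
proof -
  have e: "(norm (x - (x + (- (2 * sqrt s)) *\<^sub>R z)))\<^sup>2 / (4 * s) = (norm z)\<^sup>2" for z
    using s by (simp add: power_mult_distrib)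
  have "(LINT z|lborel. h (x + (- (2 * sqrt s)) *\<^sub>R z) * exp (- 1 * (norm z)\<^sup>2))
      = (LINT z|lborel. (\<lambda>y. h y * exp (- (norm (x - y))\<^sup>2 / (4 * s))) (x + (- (2 * sqrt s)) *\<^sub>R z))"
    using e by simp
  also have "\<dots> = (LINT y|lborel. h y * exp (- (norm (x - y))\<^sup>2 / (4 * s))) /\<^sub>R \<bar>- (2 * sqrt s)\<bar> ^ DIM('a)"
    by (rule lborel_affine_change(2)) (use s in auto)
  finally have "(LINT y|lborel. h y * exp (- (norm (x - y))\<^sup>2 / (4 * s)))
     = (2 * sqrt s) ^ DIM('a) * (LINT z|lborel. h (x + (- (2 * sqrt s)) *\<^sub>R z) * exp (- 1 * (norm z)\<^sup>2))"
    using s by (auto simp: divide_simps mult_ac)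
  moreover have "sqrt (pi / s) * (2 * sqrt s) = 2 * sqrt pi"
    using s by (simp add: real_sqrt_divide)
  then have "sqrt (pi / s) ^ DIM('a) * (2 * sqrt s) ^ DIM('a) = (2 * sqrt pi) ^ DIM('a)"
    by (metis power_mult_distrib)
  ultimately show ?thesis by (simp only: mult.assoc[symmetric])
qed

text \<open>In this form s occurs only in the size of the shift. The Gaussian weight in z stays
  fixed, which gives a bound uniform in s and reduces the limit of small s to the continuity of h
  under translation.\<close>

lemma gauss_energy_eq_shift:
  fixes h :: "'a::euclidean_space \<Rightarrow> real"
  assumes h: "integrable lborel h" and s: "0 < s"
  shows "gauss_energy s h = (2 * sqrt pi) ^ DIM('a) *
    (LINT x|lborel. h x * (LINT z|lborel. h (x + (- (2 * sqrt s)) *\<^sub>R z) * exp (- 1 * (norm z)\<^sup>2)))"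
proof -
  have hm: "h \<in> borel_measurable borel" using h by auto
  have "gauss_energy s h = (LINT x|lborel. h x * (sqrt (pi / s) ^ DIM('a) *
     (LINT y|lborel. h y * exp (- (norm (x - y))\<^sup>2 / (4 * s)))))"
    unfolding gauss_energy_eq[OF assms] mult.left_commute[of "h _"] by simp
  also have "\<dots> = (LINT x|lborel. h x * ((2 * sqrt pi) ^ DIM('a) *
     (LINT z|lborel. h (x + (- (2 * sqrt s)) *\<^sub>R z) * exp (- 1 * (norm z)\<^sup>2))))"
    unfolding gauss_conv_change[OF hm s] ..
  also have "\<dots> = (2 * sqrt pi) ^ DIM('a) * (LINT x|lborel. h x *
     (LINT z|lborel. h (x + (- (2 * sqrt s)) *\<^sub>R z) * exp (- 1 * (norm z)\<^sup>2)))"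
    unfolding mult.left_commute[of "h _"] by simp
  finally show ?thesis .
qed

lemma sqrt_pi_powers: "(2 * sqrt pi) ^ n * sqrt pi ^ n = (2 * pi) ^ n"
  unfolding power_mult_distrib[symmetric] by (simp only: mult.assoc real_sqrt_mult_self) simp

text \<open>One half of Plancherel: the product of h(x) and a translate is at most half the sum of
  the squares, and translation invariance makes both squares contribute the same integral.\<close>

lemma gauss_energy_le:
  fixes h :: "'a::euclidean_space \<Rightarrow> real"
  assumes h: "integrable lborel h" and h2: "integrable lborel (\<lambda>x. (h x)\<^sup>2)" and s: "0 < s"
  shows "gauss_energy s h \<le> (2 * pi) ^ DIM('a) * (LINT x|lborel. (h x)\<^sup>2)"
proof -
  have [measurable]: "h \<in> borel_measurable borel" using h by auto
  define r where "r = - (2 * sqrt s)"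
  have r: "r \<noteq> 0" using s by (simp add: r_def)
  define E where "E z = exp (- 1 * (norm z)\<^sup>2)" for z :: 'a
  have [measurable]: "E \<in> borel_measurable borel" unfolding E_def[abs_def] by measurable
  have E: "integrable lborel E" "(LINT z|lborel. E z) = sqrt pi ^ DIM('a)" "\<And>z. 0 \<le> E z"
    using gaussian_integral[of 1, where 'a = 'a] by (auto simp: E_def[abs_def])
  define N where "N = (LINT x|lborel. (h x)\<^sup>2)"
  define A where "A x z = (h (x + r *\<^sub>R z))\<^sup>2 * E z" for x z
  have shift: "integrable lborel (\<lambda>x. (h (x + v))\<^sup>2)" "(LINT x|lborel. (h (x + v))\<^sup>2) = N" for v
    using lborel_affine_change[of "\<lambda>x. (h x)\<^sup>2" 1 v] h2 by (auto simp: N_def add.commute)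
  have intA: "integrable (lborel \<Otimes>\<^sub>M lborel) (\<lambda>(z, x). A x z)"
  proof (rule lborel_pair.Fubini_integrable)
    show "(\<lambda>(z, x). A x z) \<in> borel_measurable (lborel \<Otimes>\<^sub>M lborel)"
      unfolding A_def by measurable
    show "integrable lborel (\<lambda>z. LINT x|lborel. norm (case (z, x) of (z, x) \<Rightarrow> A x z))"
      using E shift by (simp add: A_def abs_mult)
    show "AE z in lborel. integrable lborel (\<lambda>x. case (z, x) of (z, x) \<Rightarrow> A x z)"
      using shift by (simp add: A_def)
  qed
  have intA': "integrable (lborel \<Otimes>\<^sub>M lborel) (\<lambda>(x, z). A x z)"
    using lborel_pair.integrable_product_swap[OF intA] by (simp add: split_def)
  have "(LINT x|lborel. LINT z|lborel. A x z) = (LINT z|lborel. LINT x|lborel. A x z)"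
    by (rule lborel_pair.Fubini_integral[OF intA])
  also have "\<dots> = N * sqrt pi ^ DIM('a)"
    using E shift by (simp add: A_def)
  finally have AA: "(LINT x|lborel. LINT z|lborel. A x z) = N * sqrt pi ^ DIM('a)" .
  have iA: "integrable lborel (\<lambda>x. LINT z|lborel. A x z)" "AE x in lborel. integrable lborel (A x)"
    using lborel_pair.integrable_fst'[OF intA'] lborel_pair.AE_integrable_fst'[OF intA'] by simp_all
  define G where "G x = h x * (LINT z|lborel. h (x + r *\<^sub>R z) * E z)" for x
  have "(LINT x|lborel. G x) \<le> (LINT x|lborel. (1/2) * ((h x)\<^sup>2 * sqrt pi ^ DIM('a)) + (1/2) * (LINT z|lborel. A x z))"
  proof (rule integral_mono_AE')
    show "integrable lborel (\<lambda>x. (1/2) * ((h x)\<^sup>2 * sqrt pi ^ DIM('a)) + (1/2) * (LINT z|lborel. A x z))"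
      by (intro Bochner_Integration.integrable_add integrable_mult_right integrable_mult_left h2 iA)
    show "AE x in lborel. 0 \<le> (1/2) * ((h x)\<^sup>2 * sqrt pi ^ DIM('a)) + (1/2) * (LINT z|lborel. A x z)"
      by (auto intro!: AE_I2 add_nonneg_nonneg Bochner_Integration.integral_nonneg mult_nonneg_nonneg E(3) simp: A_def)
    show "AE x in lborel. G x \<le> (1/2) * ((h x)\<^sup>2 * sqrt pi ^ DIM('a)) + (1/2) * (LINT z|lborel. A x z)"
      using iA(2)
    proof eventually_elim
      case (elim x)
      have "G x = (LINT z|lborel. h x * (h (x + r *\<^sub>R z) * E z))" unfolding G_def by simp
      also have "\<dots> \<le> (LINT z|lborel. (1/2) * ((h x)\<^sup>2 * E z) + (1/2) * A x z)"
      proof (rule integral_mono')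
        show "integrable lborel (\<lambda>z. (1/2) * ((h x)\<^sup>2 * E z) + (1/2) * A x z)"
          by (intro Bochner_Integration.integrable_add integrable_mult_right E elim)
        fix z
        show "h x * (h (x + r *\<^sub>R z) * E z) \<le> (1/2) * ((h x)\<^sup>2 * E z) + (1/2) * A x z"
          using mult_right_mono[OF sum_squares_bound[of "h x" "h (x + r *\<^sub>R z)"] E(3)[of z]]
          by (simp add: A_def algebra_simps)
        show "0 \<le> (1/2) * ((h x)\<^sup>2 * E z) + (1/2) * A x z"
          by (auto intro!: add_nonneg_nonneg mult_nonneg_nonneg E(3) simp: A_def)
      qed
      also have "\<dots> = (1/2) * ((h x)\<^sup>2 * sqrt pi ^ DIM('a)) + (1/2) * (LINT z|lborel. A x z)"
        using E elim by simp
      finally show ?case .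
    qed
  qed
  also have "\<dots> = N * sqrt pi ^ DIM('a)"
    using h2 iA(1) AA by (simp add: N_def)
  finally have "gauss_energy s h \<le> (2 * sqrt pi) ^ DIM('a) * (N * sqrt pi ^ DIM('a))"
    unfolding gauss_energy_eq_shift[OF h s] G_def E_def r_def by (intro mult_left_mono) auto
  also have "\<dots> = (2 * pi) ^ DIM('a) * N"
    using sqrt_pi_powers[of "DIM('a)"] by (simp add: mult_ac)
  finally show ?thesis by (simp add: N_def)
qed

text \<open>As s tends to 0 the shifts vanish, and dominated convergence in z and then in x applies
  since w is continuous and bounded. General L^2 functions are reached by approximation.\<close>

lemma gauss_energy_tendsto:
  fixes w :: "'a::euclidean_space \<Rightarrow> real"
  assumes c: "continuous_on UNIV w" and S: "compact S" "\<And>x. x \<notin> S \<Longrightarrow> w x = 0"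
  shows "(\<lambda>i. gauss_energy (1 / real (Suc i)) w) \<longlonglongrightarrow> (2 * pi) ^ DIM('a) * (LINT x|lborel. (w x)\<^sup>2)"
proof -
  have w: "integrable lborel w" by (rule cont_compact_support_integrable[OF c S])
  have [measurable]: "w \<in> borel_measurable borel" using w by auto
  obtain M where M: "0 < M" "\<And>x. \<bar>w x\<bar> \<le> M"
  proof -
    have "bounded (w ` S)"
      by (intro compact_imp_bounded compact_continuous_image S continuous_on_subset[OF c]) auto
    then obtain M where M: "0 < M" "\<And>x. x \<in> S \<Longrightarrow> \<bar>w x\<bar> \<le> M"
      unfolding bounded_pos by auto
    then have "\<bar>w x\<bar> \<le> M" for x using S(2)[of x] by (cases "x \<in> S") auto
    with M that show ?thesis by blast
  qed
  define E where "E z = exp (- 1 * (norm z)\<^sup>2)" for z :: 'a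
  have [measurable]: "E \<in> borel_measurable borel" unfolding E_def[abs_def] by measurable
  have E: "integrable lborel E" "(LINT z|lborel. E z) = sqrt pi ^ DIM('a)" "\<And>z. 0 \<le> E z"
    using gaussian_integral[of 1, where 'a = 'a] by (auto simp: E_def[abs_def])
  define r where "r i = - (2 * sqrt (1 / real (Suc i)))" for i
  have "(\<lambda>i. - (2 * sqrt (1 / real (Suc i)))) \<longlonglongrightarrow> - (2 * sqrt 0)"
    by (intro tendsto_intros LIMSEQ_Suc[OF lim_1_over_n])
  then have r: "r \<longlonglongrightarrow> 0" by (simp add: r_def[abs_def])
  have inner: "(\<lambda>i. LINT z|lborel. w (x + r i *\<^sub>R z) * E z) \<longlonglongrightarrow> w x * sqrt pi ^ DIM('a)" for x
  proof -
    have "(\<lambda>i. LINT z|lborel. w (x + r i *\<^sub>R z) * E z) \<longlonglongrightarrow> (LINT z|lborel. w x * E z)"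
    proof (rule integral_dominated_convergence)
      show "integrable lborel (\<lambda>z. M * E z)" using E by simp
      show "AE z in lborel. (\<lambda>i. w (x + r i *\<^sub>R z) * E z) \<longlonglongrightarrow> w x * E z"
      proof (rule AE_I2)
        fix z
        have "(\<lambda>i. x + r i *\<^sub>R z) \<longlonglongrightarrow> x + 0 *\<^sub>R z" by (intro tendsto_intros r)
        then have "(\<lambda>i. x + r i *\<^sub>R z) \<longlonglongrightarrow> x" by simp
        then have "(\<lambda>i. w (x + r i *\<^sub>R z)) \<longlonglongrightarrow> w x"
          by (rule continuous_on_tendsto_compose[OF c]) auto
        then show "(\<lambda>i. w (x + r i *\<^sub>R z) * E z) \<longlonglongrightarrow> w x * E z"
          by (intro tendsto_intros)
      qed
      show "AE z in lborel. norm (w (x + r i *\<^sub>R z) * E z) \<le> M * E z" for i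
        using M E by (auto intro!: AE_I2 mult_right_mono simp: abs_mult)
    qed measurable
    then show ?thesis using E by simp
  qed
  have bound: "\<bar>LINT z|lborel. w (x + r i *\<^sub>R z) * E z\<bar> \<le> M * sqrt pi ^ DIM('a)" for x i
  proof -
    have "\<bar>LINT z|lborel. w (x + r i *\<^sub>R z) * E z\<bar> \<le> (LINT z|lborel. \<bar>w (x + r i *\<^sub>R z) * E z\<bar>)"
      by (rule integral_abs_bound)
    also have "\<dots> \<le> (LINT z|lborel. M * E z)"
      by (rule integral_mono') (use M E in \<open>auto simp: abs_mult intro!: mult_right_mono mult_nonneg_nonneg\<close>)
    finally show ?thesis using E by simp
  qed
  have "(\<lambda>i. LINT x|lborel. w x * (LINT z|lborel. w (x + r i *\<^sub>R z) * E z))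
      \<longlonglongrightarrow> (LINT x|lborel. w x * (w x * sqrt pi ^ DIM('a)))"
  proof (rule integral_dominated_convergence)
    show "integrable lborel (\<lambda>x. \<bar>w x\<bar> * (M * sqrt pi ^ DIM('a)))" using w by simp
    show "AE x in lborel. (\<lambda>i. w x * (LINT z|lborel. w (x + r i *\<^sub>R z) * E z)) \<longlonglongrightarrow> w x * (w x * sqrt pi ^ DIM('a))"
      by (intro AE_I2 tendsto_intros inner)
    show "AE x in lborel. norm (w x * (LINT z|lborel. w (x + r i *\<^sub>R z) * E z)) \<le> \<bar>w x\<bar> * (M * sqrt pi ^ DIM('a))" for i
      using bound by (auto intro!: AE_I2 mult_left_mono simp: abs_mult)
  qed measurable
  then have "(\<lambda>i. (2 * sqrt pi) ^ DIM('a) * (LINT x|lborel. w x * (LINT z|lborel. w (x + r i *\<^sub>R z) * E z)))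
      \<longlonglongrightarrow> (2 * sqrt pi) ^ DIM('a) * (LINT x|lborel. w x * (w x * sqrt pi ^ DIM('a)))"
    by (intro tendsto_intros)
  moreover have "gauss_energy (1 / real (Suc i)) w
      = (2 * sqrt pi) ^ DIM('a) * (LINT x|lborel. w x * (LINT z|lborel. w (x + r i *\<^sub>R z) * E z))" for i
    unfolding r_def E_def by (rule gauss_energy_eq_shift[OF w]) simp
  moreover have "(2 * sqrt pi) ^ DIM('a) * (LINT x|lborel. w x * (w x * sqrt pi ^ DIM('a)))
      = (2 * pi) ^ DIM('a) * (LINT x|lborel. (w x)\<^sup>2)"
    using sqrt_pi_powers[of "DIM('a)"]
    by (simp add: power2_eq_square mult.assoc[symmetric])
  ultimately show ?thesis by (simp only:)
qed

section \<open>Approximation in L^2 by continuous functions of compact support\<close>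

lemma bounded_L2_approx:
  fixes h :: "'a::euclidean_space \<Rightarrow> real"
  assumes [measurable]: "h \<in> borel_measurable borel"
    and M: "\<And>x. \<bar>h x\<bar> \<le> M" and R: "\<And>x. R \<le> norm x \<Longrightarrow> h x = 0" and e: "0 < e"
  shows "\<exists>w. continuous_on UNIV w \<and> (\<forall>x. x \<notin> cball 0 (R + 1) \<longrightarrow> w x = 0) \<and>
    integrable lborel (\<lambda>x. (w x - h x)\<^sup>2) \<and> (LINT x|lborel. (w x - h x)\<^sup>2) < e"
proof -
  have "h measurable_on UNIV"
    by (rule lebesgue_measurable_imp_measurable_on) (auto intro: measurable_completion)
  then obtain N g where N: "negligible N" and g: "\<And>n. continuous_on UNIV (g n)"
    and lim: "\<And>x. x \<notin> N \<Longrightarrow> (\<lambda>n. g n x) \<longlonglongrightarrow> h x"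
    unfolding measurable_on_def by auto
  have M0: "0 \<le> M" using M[of 0] by linarith
  \<comment> \<open>The continuous functions \<open>g n\<close> converge almost everywhere but carry
    no bounds. Clamping to [-M, M] and multiplying by a ramp that is 1 for |x| \<le> R and 0 beyond
    R + 1 provides a fixed integrable majorant without changing the limit h.\<close>
  define w where "w n x = max 0 (min 1 (R + 1 - norm x)) * max (- M) (min M (g n x))" for n x
  have w: "continuous_on UNIV (w n)" for n
    unfolding w_def by (intro continuous_intros g)
  then have [measurable]: "w n \<in> borel_measurable borel" for n
    by (rule borel_measurable_continuous_onI)
  have w0: "w n x = 0" if "x \<notin> cball 0 (R + 1)" for n x
    using that by (simp add: w_def)
  have wM: "\<bar>w n x\<bar> \<le> M" for n x
  proof -
    have "\<bar>w n x\<bar> \<le> 1 * M" unfolding w_def abs_mult using M0 by (intro mult_mono) auto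
    then show ?thesis by simp
  qed
  have AE: "AE x in lborel. x \<notin> N"
    using AE_not_in[of N lebesgue] N by (simp add: negligible_iff_null_sets AE_completion_iff)
  define B where "B x = indicator (cball 0 (R + 1)) x *\<^sub>R ((2 * M)\<^sup>2)" for x :: 'a
  have B: "integrable lborel B"
    unfolding B_def[abs_def] by (rule borel_integrable_compact) auto
  have bound: "(w n x - h x)\<^sup>2 \<le> B x" for n x
  proof (cases "x \<in> cball 0 (R + 1)")
    case True
    have "\<bar>w n x - h x\<bar> \<le> 2 * M" using wM[of n x] M[of x] by linarith
    then have "\<bar>w n x - h x\<bar>\<^sup>2 \<le> (2 * M)\<^sup>2" by (intro power_mono) auto
    with True show ?thesis by (simp add: B_def)
  next
    case False
    then have "h x = 0" by (intro R) auto
    then show ?thesis using w0[OF False] False by (simp add: B_def)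
  qed
  have i: "integrable lborel (\<lambda>x. (w n x - h x)\<^sup>2)" for n
    by (rule Bochner_Integration.integrable_bound[OF B]) (use bound in \<open>auto intro!: AE_I2 order_trans[OF bound abs_ge_self]\<close>)
  have "(\<lambda>n. LINT x|lborel. (w n x - h x)\<^sup>2) \<longlonglongrightarrow> (LINT x|(lborel::'a measure). (0::real))"
  proof (rule integral_dominated_convergence[OF _ _ B])
    show "AE x in lborel. (\<lambda>n. (w n x - h x)\<^sup>2) \<longlonglongrightarrow> 0"
      using AE
    proof eventually_elim
      case (elim x)
      have "(\<lambda>n. (w n x - h x)\<^sup>2) \<longlonglongrightarrow> (max 0 (min 1 (R + 1 - norm x)) * max (- M) (min M (h x)) - h x)\<^sup>2"
        unfolding w_def by (intro tendsto_intros lim elim)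
      moreover have "max (- M) (min M (h x)) = h x" using M[of x] by linarith
      moreover have "max 0 (min 1 (R + 1 - norm x)) * h x = h x"
        using R[of x] by (cases "R \<le> norm x") auto
      ultimately show ?case by simp
    qed
  qed (use bound in auto)
  then have "eventually (\<lambda>n. (LINT x|lborel. (w n x - h x)\<^sup>2) < e) sequentially"
    using e by (simp add: order_tendstoD(2))
  then obtain n where "(LINT x|lborel. (w n x - h x)\<^sup>2) < e"
    by (auto simp: eventually_sequentially)
  with w w0 i show ?thesis by blast
qed

lemma power2_sum_le: "(a + b)\<^sup>2 \<le> 2 * a\<^sup>2 + 2 * (b::real)\<^sup>2"
  using sum_squares_bound[of a b] by (simp add: power2_sum)

lemma cmod_power2_sum_le: "(cmod (a + b))\<^sup>2 \<le> 2 * (cmod a)\<^sup>2 + 2 * (cmod b)\<^sup>2"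
  using power_mono[OF norm_triangle_ineq[of a b] norm_ge_zero, of 2] power2_sum_le[of "cmod a" "cmod b"] by linarith

text \<open>Clamping h at height n reduces to bounded functions; two errors below e/4 add up to less
  than e through (a + b)^2 \<le> 2 a^2 + 2 b^2.\<close>

lemma L2_approx:
  fixes h :: "'a::euclidean_space \<Rightarrow> real"
  assumes hm[measurable]: "h \<in> borel_measurable borel" and h2: "integrable lborel (\<lambda>x. (h x)\<^sup>2)"
    and R: "\<And>x. R \<le> norm x \<Longrightarrow> h x = 0" and e: "0 < e"
  shows "\<exists>w. continuous_on UNIV w \<and> (\<forall>x. x \<notin> cball 0 (R + 1) \<longrightarrow> w x = 0) \<and>
    integrable lborel (\<lambda>x. (w x - h x)\<^sup>2) \<and> (LINT x|lborel. (w x - h x)\<^sup>2) < e"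
proof -
  define c where "c n x = max (- real n) (min (real n) (h x))" for n x
  have [measurable]: "c n \<in> borel_measurable borel" for n unfolding c_def[abs_def] by measurable
  have bound: "(c n x - h x)\<^sup>2 \<le> (h x)\<^sup>2" for n x
    unfolding c_def by (subst abs_le_square_iff[symmetric]) linarith
  have ic: "integrable lborel (\<lambda>x. (c n x - h x)\<^sup>2)" for n
    by (rule Bochner_Integration.integrable_bound[OF h2]) (use bound in auto)
  have "(\<lambda>n. LINT x|lborel. (c n x - h x)\<^sup>2) \<longlonglongrightarrow> (LINT x|(lborel::'a measure). (0::real))"
  proof (rule integral_dominated_convergence[OF _ _ h2])
    show "AE x in lborel. (\<lambda>n. (c n x - h x)\<^sup>2) \<longlonglongrightarrow> 0"
    proof (rule AE_I2)
      fix x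
      obtain N :: nat where N: "\<bar>h x\<bar> \<le> N" using real_arch_simple by blast
      have "c n x = h x" if "N \<le> n" for n
      proof -
        have "real N \<le> real n" using that by simp
        with N show ?thesis unfolding c_def by linarith
      qed
      then have "eventually (\<lambda>n. (c n x - h x)\<^sup>2 = 0) sequentially"
        by (auto simp: eventually_sequentially)
      then show "(\<lambda>n. (c n x - h x)\<^sup>2) \<longlonglongrightarrow> 0" by (rule tendsto_eventually)
    qed
  qed (use bound in auto)
  then have "(\<lambda>n. LINT x|lborel. (c n x - h x)\<^sup>2) \<longlonglongrightarrow> 0" by simp
  then have "eventually (\<lambda>n. (LINT x|lborel. (c n x - h x)\<^sup>2) < e / 4) sequentially"
    by (rule order_tendstoD(2)) (use e in simp)
  then obtain n where n: "(LINT x|lborel. (c n x - h x)\<^sup>2) < e / 4"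
    by (auto simp: eventually_sequentially)
  have "\<bar>c n x\<bar> \<le> real n" "R \<le> norm x \<Longrightarrow> c n x = 0" for x
    using R[of x] unfolding c_def by (linarith, simp)
  then obtain w where w: "continuous_on UNIV w" "\<forall>x. x \<notin> cball 0 (R + 1) \<longrightarrow> w x = 0"
    "integrable lborel (\<lambda>x. (w x - c n x)\<^sup>2)" "(LINT x|lborel. (w x - c n x)\<^sup>2) < e / 4"
    using bounded_L2_approx[of "c n" "real n" R "e / 4"] e by auto
  have [measurable]: "w \<in> borel_measurable borel" by (rule borel_measurable_continuous_onI[OF w(1)])
  have b: "(w x - h x)\<^sup>2 \<le> 2 * (w x - c n x)\<^sup>2 + 2 * (c n x - h x)\<^sup>2" for x
    using power2_sum_le[of "w x - c n x" "c n x - h x"] by simp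
  have i2: "integrable lborel (\<lambda>x. 2 * (w x - c n x)\<^sup>2 + 2 * (c n x - h x)\<^sup>2)"
    by (intro Bochner_Integration.integrable_add integrable_mult_right w ic)
  have i: "integrable lborel (\<lambda>x. (w x - h x)\<^sup>2)"
    by (rule Bochner_Integration.integrable_bound[OF i2]) (use b in auto)
  have "(LINT x|lborel. (w x - h x)\<^sup>2) \<le> (LINT x|lborel. 2 * (w x - c n x)\<^sup>2 + 2 * (c n x - h x)\<^sup>2)"
    by (rule integral_mono[OF i i2]) (rule b)
  also have "\<dots> < e" using w n ic by simp
  finally show ?thesis using w i by blast
qed

lemma fourier_diff:
  fixes f g :: "'a::euclidean_space \<Rightarrow> real"
  assumes "integrable lborel f" "integrable lborel g"
  shows "fourier (\<lambda>x. f x - g x) \<xi> = fourier f \<xi> - fourier g \<xi>"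
  unfolding fourier_def of_real_diff right_diff_distrib
  by (intro Bochner_Integration.integral_diff fourier_integrand_integrable assms)

lemma truncation_integrable:
  fixes h :: "'a::euclidean_space \<Rightarrow> real"
  assumes [measurable]: "h \<in> borel_measurable borel" and h2: "integrable lborel (\<lambda>x. (h x)\<^sup>2)"
  shows "integrable lborel (\<lambda>x. indicator (ball 0 R) x * h x)"
proof (rule Bochner_Integration.integrable_bound)
  have [measurable]: "ball (0::'a) R \<in> sets borel" by simp
  show "(\<lambda>x. indicator (ball 0 R) x * h x) \<in> borel_measurable lborel" by measurable
  show "integrable lborel (\<lambda>x. indicator (cball 0 R) x *\<^sub>R (1::real) + (h x)\<^sup>2)"
    by (intro Bochner_Integration.integrable_add h2 borel_integrable_compact) auto
  show "AE x in lborel. norm (indicator (ball 0 R) x * h x) \<le> norm (indicator (cball 0 R) x *\<^sub>R (1::real) + (h x)\<^sup>2)"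
  proof (rule AE_I2)
    fix x
    have "\<bar>h x\<bar> \<le> 1 + (h x)\<^sup>2" using sum_squares_bound[of "\<bar>h x\<bar>" 1] by (simp add: abs_le_iff) (use zero_le_power2[of "h x"] in linarith)
    then show "norm (indicator (ball 0 R) x * h x) \<le> norm (indicator (cball 0 R) x *\<^sub>R (1::real) + (h x)\<^sup>2)"
      by (auto simp: indicator_def)
  qed
qed

text \<open>The limit of the energy for small s is available for continuous functions, so h is
  compared with a continuous w: the energy bound passes from h to w, the limit is taken for w, and
  the result returns to h. Each of the two comparisons costs a factor 2, giving the 4. The
  right-hand side is a nonnegative integral because finiteness is not known in advance.\<close>

lemma plancherel_le_compact:
  fixes h :: "'a::euclidean_space \<Rightarrow> real"
  assumes h: "integrable lborel h" and h2: "integrable lborel (\<lambda>x. (h x)\<^sup>2)"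
    and R: "\<And>x. R \<le> norm x \<Longrightarrow> h x = 0"
  shows "ennreal (LINT x|lborel. (h x)\<^sup>2) \<le> 4 * (\<integral>\<^sup>+\<xi>. ennreal ((cmod (fourier h \<xi>))\<^sup>2) \<partial>lborel)"
proof (cases "(\<integral>\<^sup>+\<xi>. ennreal ((cmod (fourier h \<xi>))\<^sup>2) \<partial>lborel) = \<infinity>")
  case False
  have [measurable]: "h \<in> borel_measurable borel" using h by auto
  obtain A where A: "0 \<le> A" "(\<integral>\<^sup>+\<xi>. ennreal ((cmod (fourier h \<xi>))\<^sup>2) \<partial>lborel) = ennreal A"
    using False by (cases "\<integral>\<^sup>+\<xi>. ennreal ((cmod (fourier h \<xi>))\<^sup>2) \<partial>lborel") auto
  have gA: "gauss_energy s h \<le> A" if s: "0 < s" for s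
  proof -
    have "ennreal (gauss_energy s h) = (\<integral>\<^sup>+\<xi>. ennreal (exp (- s * (norm \<xi>)\<^sup>2) * (cmod (fourier h \<xi>))\<^sup>2) \<partial>lborel)"
      unfolding gauss_energy_def
      by (rule nn_integral_eq_integral[OF fourier_gauss_weight_integrable[OF h s], symmetric]) auto
    also have "\<dots> \<le> ennreal A" unfolding A(2)[symmetric]
      using s by (intro nn_integral_mono ennreal_leI) (auto intro!: mult_left_le_one_le)
    finally show ?thesis using A by (simp add: ennreal_le_iff)
  qed
  have pi: "1 \<le> (2 * pi) ^ DIM('a)" using pi_gt3 by (intro one_le_power) linarith
  have "(LINT x|lborel. (h x)\<^sup>2) \<le> 4 * A + e" if e: "0 < e" for e
  proof -
    \<comment> \<open>The approximation error enters the final estimate with total weight 6.\<close>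
    obtain w where w: "continuous_on UNIV w" "\<And>x. x \<notin> cball 0 (R + 1) \<Longrightarrow> w x = 0"
      "integrable lborel (\<lambda>x. (w x - h x)\<^sup>2)" "(LINT x|lborel. (w x - h x)\<^sup>2) < e / 6"
      using L2_approx[of h R "e / 6"] h2 R e by auto
    have iw: "integrable lborel w"
      by (rule cont_compact_support_integrable[where S = "cball 0 (R + 1)"]) (use w in auto)
    have iw2: "integrable lborel (\<lambda>x. (w x)\<^sup>2)"
      by (rule cont_compact_support_integrable[where S = "cball 0 (R + 1)"]) (use w in \<open>auto intro!: continuous_intros\<close>)
    have ih: "integrable lborel (\<lambda>x. w x - h x)" using iw h by simp
    define P where "P = (2 * pi) ^ DIM('a)"
    have P: "1 \<le> P" using pi by (simp add: P_def)
    define D where "D = (LINT x|lborel. (w x - h x)\<^sup>2)"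
    have step: "gauss_energy s w \<le> 2 * A + 2 * (P * D)" if s: "0 < s" for s
    proof -
      have "gauss_energy s w \<le> (LINT \<xi>|lborel. 2 * (exp (- s * (norm \<xi>)\<^sup>2) * (cmod (fourier h \<xi>))\<^sup>2)
          + 2 * (exp (- s * (norm \<xi>)\<^sup>2) * (cmod (fourier (\<lambda>x. w x - h x) \<xi>))\<^sup>2))"
        unfolding gauss_energy_def
      proof (rule integral_mono)
        fix \<xi> :: 'a
        have "fourier w \<xi> = fourier h \<xi> + fourier (\<lambda>x. w x - h x) \<xi>"
          using fourier_diff[OF iw h] by simp
        then have "(cmod (fourier w \<xi>))\<^sup>2 \<le> 2 * (cmod (fourier h \<xi>))\<^sup>2 + 2 * (cmod (fourier (\<lambda>x. w x - h x) \<xi>))\<^sup>2"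
          using cmod_power2_sum_le by metis
        from mult_left_mono[OF this, of "exp (- s * (norm \<xi>)\<^sup>2)"]
        show "exp (- s * (norm \<xi>)\<^sup>2) * (cmod (fourier w \<xi>))\<^sup>2
          \<le> 2 * (exp (- s * (norm \<xi>)\<^sup>2) * (cmod (fourier h \<xi>))\<^sup>2)
          + 2 * (exp (- s * (norm \<xi>)\<^sup>2) * (cmod (fourier (\<lambda>x. w x - h x) \<xi>))\<^sup>2)"
          by (simp add: algebra_simps)
      qed (intro Bochner_Integration.integrable_add integrable_mult_right fourier_gauss_weight_integrable iw h ih s)+
      also have "\<dots> = 2 * gauss_energy s h + 2 * gauss_energy s (\<lambda>x. w x - h x)"
        unfolding gauss_energy_def
        using fourier_gauss_weight_integrable[OF h s] fourier_gauss_weight_integrable[OF ih s] by simp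
      also have "\<dots> \<le> 2 * A + 2 * (P * D)"
        unfolding P_def D_def by (intro add_mono mult_left_mono gA s gauss_energy_le ih w) auto
      finally show ?thesis .
    qed
    have "P * (LINT x|lborel. (w x)\<^sup>2) \<le> 2 * A + 2 * (P * D)"
      unfolding P_def
    proof (rule LIMSEQ_le_const2)
      show "(\<lambda>i. gauss_energy (1 / real (Suc i)) w) \<longlonglongrightarrow> (2 * pi) ^ DIM('a) * (LINT x|lborel. (w x)\<^sup>2)"
        by (rule gauss_energy_tendsto[where S = "cball 0 (R + 1)"]) (use w in auto)
      show "\<exists>N. \<forall>n\<ge>N. gauss_energy (1 / real (Suc n)) w \<le> 2 * A + 2 * ((2 * pi) ^ DIM('a) * D)"
        using step unfolding P_def by (intro exI[of _ 0] allI impI) simp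
    qed
    \<comment> \<open>P = (2 pi)^n is at least 1, so 2A may be enlarged to P times 2A; dividing by P
      afterwards discards the gain (2 pi)^(-n).\<close>
    also have "\<dots> \<le> P * (2 * A + 2 * D)" using P A(1) mult_right_mono[of 1 P "2 * A"] by (simp add: algebra_simps)
    finally have ww: "(LINT x|lborel. (w x)\<^sup>2) \<le> 2 * A + 2 * D" using P by simp
    have "(LINT x|lborel. (h x)\<^sup>2) \<le> (LINT x|lborel. 2 * (w x)\<^sup>2 + 2 * (w x - h x)\<^sup>2)"
    proof (rule integral_mono)
      fix x show "(h x)\<^sup>2 \<le> 2 * (w x)\<^sup>2 + 2 * (w x - h x)\<^sup>2"
        using power2_sum_le[of "w x" "h x - w x"] by (simp add: power2_commute)
    qed (use h2 iw2 w in auto)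
    also have "\<dots> = 2 * (LINT x|lborel. (w x)\<^sup>2) + 2 * D" using iw2 w by (simp add: D_def)
    also have "\<dots> \<le> 4 * A + 6 * D" using ww by simp
    also have "\<dots> \<le> 4 * A + e" using w(4) by (simp add: D_def)
    finally show ?thesis .
  qed
  then have "(LINT x|lborel. (h x)\<^sup>2) \<le> 4 * A" by (rule field_le_epsilon)
  then show ?thesis unfolding A(2) using A(1) by (simp add: ennreal_leI ennreal_mult'[symmetric] flip: ennreal_numeral)
qed simp

section \<open>From truncations to the Fourier-Plancherel transform\<close>

lemma nn_integral_cmod_power2_add_le:
  fixes a b :: "'a \<Rightarrow> complex"
  assumes [measurable]: "a \<in> borel_measurable M" "b \<in> borel_measurable M"
  shows "(\<integral>\<^sup>+x. ennreal ((cmod (a x + b x))\<^sup>2) \<partial>M)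
    \<le> 2 * (\<integral>\<^sup>+x. ennreal ((cmod (a x))\<^sup>2) \<partial>M) + 2 * (\<integral>\<^sup>+x. ennreal ((cmod (b x))\<^sup>2) \<partial>M)"
proof -
  have "(\<integral>\<^sup>+x. ennreal ((cmod (a x + b x))\<^sup>2) \<partial>M)
      \<le> (\<integral>\<^sup>+x. 2 * ennreal ((cmod (a x))\<^sup>2) + 2 * ennreal ((cmod (b x))\<^sup>2) \<partial>M)"
  proof (rule nn_integral_mono)
    fix x
    have "ennreal ((cmod (a x + b x))\<^sup>2) \<le> ennreal (2 * (cmod (a x))\<^sup>2 + 2 * (cmod (b x))\<^sup>2)"
      by (intro ennreal_leI cmod_power2_sum_le)
    then show "ennreal ((cmod (a x + b x))\<^sup>2) \<le> 2 * ennreal ((cmod (a x))\<^sup>2) + 2 * ennreal ((cmod (b x))\<^sup>2)"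
      by (simp add: ennreal_plus ennreal_mult)
  qed
  also have "\<dots> = 2 * (\<integral>\<^sup>+x. ennreal ((cmod (a x))\<^sup>2) \<partial>M) + 2 * (\<integral>\<^sup>+x. ennreal ((cmod (b x))\<^sup>2) \<partial>M)"
    by (simp add: nn_integral_add nn_integral_cmult)
  finally show ?thesis .
qed

abbreviation trunc :: "real \<Rightarrow> ('a::euclidean_space \<Rightarrow> real) \<Rightarrow> 'a \<Rightarrow> real" where
  "trunc R f \<equiv> (\<lambda>x. indicator (ball 0 R) x * f x)"

lemma trunc_measurable [measurable]:
  fixes f :: "'a::euclidean_space \<Rightarrow> real"
  assumes [measurable]: "f \<in> borel_measurable borel"
  shows "trunc R f \<in> borel_measurable borel"
proof -
  have [measurable]: "ball (0::'a) R \<in> sets borel" by simp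
  show ?thesis by measurable
qed

lemma L2_fun_D:
  assumes "L2_fun f"
  shows "f \<in> borel_measurable borel" "integrable lborel (\<lambda>x. (f x)\<^sup>2)" "integrable lborel (trunc R f)"
  using assms truncation_integrable[of f R] by (auto simp: L2_fun_def)

lemma has_fourier_L2_D:
  assumes "has_fourier_L2 f g"
  shows "g \<in> borel_measurable borel" "integrable lborel (\<lambda>\<xi>. (cmod (g \<xi>))\<^sup>2)"
    "(\<lambda>i. \<integral>\<^sup>+\<xi>. ennreal ((cmod (fourier (trunc (real i) f) \<xi> - g \<xi>))\<^sup>2) \<partial>lborel) \<longlonglongrightarrow> 0"
  using assms filterlim_compose[OF _ filterlim_real_sequentially] by (auto simp: has_fourier_L2_def)

text \<open>Truncations to balls are covered by the compact case. Replacing their transforms by the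
  limit g doubles the constant 4, and the error \<open>a i\<close> tends to 0 by the definition of
  g.\<close>

lemma plancherel_le:
  fixes f :: "'a::euclidean_space \<Rightarrow> real"
  assumes f: "L2_fun f" and g: "has_fourier_L2 f g"
  shows "(LINT x|lborel. (f x)\<^sup>2) \<le> 8 * (LINT \<xi>|lborel. (cmod (g \<xi>))\<^sup>2)"
proof -
  note fD = L2_fun_D[OF f] and gD = has_fourier_L2_D[OF g]
  have [measurable]: "f \<in> borel_measurable borel" "g \<in> borel_measurable borel" by fact+
  define G where "G = (LINT \<xi>|lborel. (cmod (g \<xi>))\<^sup>2)"
  have G0: "0 \<le> G" unfolding G_def by (rule Bochner_Integration.integral_nonneg) simp
  have nG: "(\<integral>\<^sup>+\<xi>. ennreal ((cmod (g \<xi>))\<^sup>2) \<partial>lborel) = ennreal G"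
    unfolding G_def by (rule nn_integral_eq_integral[OF gD(2)]) simp
  define a where "a i = (\<integral>\<^sup>+\<xi>. ennreal ((cmod (fourier (trunc (real i) f) \<xi> - g \<xi>))\<^sup>2) \<partial>lborel)" for i :: nat
  have le: "ennreal (LINT x|lborel. (trunc (real i) f x)\<^sup>2) \<le> 4 * (2 * a i + 2 * ennreal G)" for i
  proof -
    have "integrable lborel (\<lambda>x. (trunc (real i) f x)\<^sup>2)"
      by (rule Bochner_Integration.integrable_bound[OF fD(2)])
        (auto intro!: AE_I2 simp: indicator_def)
    then have "ennreal (LINT x|lborel. (trunc (real i) f x)\<^sup>2)
        \<le> 4 * (\<integral>\<^sup>+\<xi>. ennreal ((cmod (fourier (trunc (real i) f) \<xi>))\<^sup>2) \<partial>lborel)"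
      by (intro plancherel_le_compact[where R = "real i"] fD) auto
    also have "(\<integral>\<^sup>+\<xi>. ennreal ((cmod (fourier (trunc (real i) f) \<xi>))\<^sup>2) \<partial>lborel) \<le> 2 * a i + 2 * ennreal G"
      using nn_integral_cmod_power2_add_le[of "\<lambda>\<xi>. fourier (trunc (real i) f) \<xi> - g \<xi>" lborel g]
      by (simp add: a_def nG)
    finally show ?thesis by (simp add: mult_left_mono)
  qed
  have "(\<lambda>i. LINT x|lborel. (trunc (real i) f x)\<^sup>2) \<longlonglongrightarrow> (LINT x|lborel. (f x)\<^sup>2)"
  proof (rule integral_dominated_convergence[OF _ _ fD(2)])
    show "AE x in lborel. (\<lambda>i. (trunc (real i) f x)\<^sup>2) \<longlonglongrightarrow> (f x)\<^sup>2"
    proof (rule AE_I2)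
      fix x :: 'a
      obtain N :: nat where "norm x < real N" using reals_Archimedean2 by blast
      then have "trunc (real i) f x = f x" if "N \<le> i" for i
      proof -
        have "real N \<le> real i" using that by simp
        with \<open>norm x < real N\<close> show ?thesis by simp
      qed
      then have "\<exists>N. \<forall>i\<ge>N. (trunc (real i) f x)\<^sup>2 = (f x)\<^sup>2" by metis
      then have "eventually (\<lambda>i. (trunc (real i) f x)\<^sup>2 = (f x)\<^sup>2) sequentially"
        by (simp only: eventually_sequentially)
      then show "(\<lambda>i. (trunc (real i) f x)\<^sup>2) \<longlonglongrightarrow> (f x)\<^sup>2" by (rule tendsto_eventually)
    qed
  qed (auto intro!: AE_I2 simp: indicator_def)
  then have 1: "(\<lambda>i. ennreal (LINT x|lborel. (trunc (real i) f x)\<^sup>2)) \<longlonglongrightarrow> ennreal (LINT x|lborel. (f x)\<^sup>2)"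
    by (rule tendsto_ennrealI)
  have "a \<longlonglongrightarrow> 0" using gD(3) by (simp add: a_def[abs_def])
  then have 2: "(\<lambda>i. 4 * (2 * a i + 2 * ennreal G)) \<longlonglongrightarrow> 4 * (2 * 0 + 2 * ennreal G)"
    by (intro ennreal_tendsto_cmult tendsto_add tendsto_const) auto
  have "ennreal (LINT x|lborel. (f x)\<^sup>2) \<le> 4 * (2 * 0 + 2 * ennreal G)"
    by (rule LIMSEQ_le[OF 1 2]) (use le in auto)
  also have "\<dots> = ennreal (8 * G)"
    using G0 by (simp add: ennreal_mult mult.assoc[symmetric])
  finally show ?thesis using G0 by (simp add: G_def ennreal_le_iff)
qed

text \<open>\<open>fourier_L2\<close> picks its value by \<open>SOME\<close>, while membership in
  \<open>sobolev_space\<close> speaks of some other witness. Uniqueness up to null sets lets the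
  integrability of the weighted square pass from one to the other.\<close>

lemma has_fourier_L2_unique:
  fixes f :: "'a::euclidean_space \<Rightarrow> real"
  assumes f: "L2_fun f" and g: "has_fourier_L2 f g" "has_fourier_L2 f h"
  shows "AE \<xi> in lborel. g \<xi> = h \<xi>"
proof -
  note gD = has_fourier_L2_D[OF g(1)] and hD = has_fourier_L2_D[OF g(2)]
  have [measurable]: "f \<in> borel_measurable borel" "g \<in> borel_measurable borel" "h \<in> borel_measurable borel"
    using L2_fun_D[OF f] gD hD by auto
  have "(\<integral>\<^sup>+\<xi>. ennreal ((cmod (h \<xi> - g \<xi>))\<^sup>2) \<partial>lborel) \<le> 2 * 0 + 2 * 0"
  proof (rule LIMSEQ_le[OF tendsto_const])
    let ?F = "\<lambda>i. fourier (trunc (real i) f)"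
    show "(\<lambda>i. 2 * (\<integral>\<^sup>+\<xi>. ennreal ((cmod (?F i \<xi> - g \<xi>))\<^sup>2) \<partial>lborel)
        + 2 * (\<integral>\<^sup>+\<xi>. ennreal ((cmod (?F i \<xi> - h \<xi>))\<^sup>2) \<partial>lborel)) \<longlonglongrightarrow> 2 * 0 + 2 * 0"
      by (intro tendsto_add ennreal_tendsto_cmult gD hD) auto
    have "(\<integral>\<^sup>+\<xi>. ennreal ((cmod (h \<xi> - g \<xi>))\<^sup>2) \<partial>lborel)
      \<le> 2 * (\<integral>\<^sup>+\<xi>. ennreal ((cmod (?F i \<xi> - g \<xi>))\<^sup>2) \<partial>lborel)
        + 2 * (\<integral>\<^sup>+\<xi>. ennreal ((cmod (?F i \<xi> - h \<xi>))\<^sup>2) \<partial>lborel)" for i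
      using nn_integral_cmod_power2_add_le[of "\<lambda>\<xi>. ?F i \<xi> - g \<xi>" lborel "\<lambda>\<xi>. h \<xi> - ?F i \<xi>"]
      by (simp add: norm_minus_commute[of "h _"])
    then show "\<exists>N. \<forall>i\<ge>N. (\<integral>\<^sup>+\<xi>. ennreal ((cmod (h \<xi> - g \<xi>))\<^sup>2) \<partial>lborel)
      \<le> 2 * (\<integral>\<^sup>+\<xi>. ennreal ((cmod (?F i \<xi> - g \<xi>))\<^sup>2) \<partial>lborel)
        + 2 * (\<integral>\<^sup>+\<xi>. ennreal ((cmod (?F i \<xi> - h \<xi>))\<^sup>2) \<partial>lborel)" by blast
  qed
  then have "AE \<xi> in lborel. ennreal ((cmod (h \<xi> - g \<xi>))\<^sup>2) = 0"
    by (subst nn_integral_0_iff_AE[symmetric]) auto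
  then show ?thesis by eventually_elim (auto simp: ennreal_eq_0_iff)
qed

lemma L2_fun_diff:
  assumes "L2_fun f" "L2_fun h"
  shows "L2_fun (\<lambda>x. f x - h x)"
proof -
  have [measurable]: "f \<in> borel_measurable borel" "h \<in> borel_measurable borel"
    using assms by (auto dest: L2_fun_D)
  have i: "integrable lborel (\<lambda>x. 2 * (f x)\<^sup>2 + 2 * (h x)\<^sup>2)"
    by (intro Bochner_Integration.integrable_add integrable_mult_right L2_fun_D(2) assms)
  have "(f x - h x)\<^sup>2 \<le> 2 * (f x)\<^sup>2 + 2 * (h x)\<^sup>2" for x
    using power2_sum_le[of "f x" "- h x"] by simp
  then have "integrable lborel (\<lambda>x. (f x - h x)\<^sup>2)"
    by (intro Bochner_Integration.integrable_bound[OF i]) auto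
  then show ?thesis by (simp add: L2_fun_def)
qed

lemma has_fourier_L2_diff:
  fixes f h :: "'a::euclidean_space \<Rightarrow> real"
  assumes f: "L2_fun f" "L2_fun h" and g: "has_fourier_L2 f g" "has_fourier_L2 h k"
  shows "has_fourier_L2 (\<lambda>x. f x - h x) (\<lambda>\<xi>. g \<xi> - k \<xi>)"
proof -
  have [measurable]: "f \<in> borel_measurable borel" "h \<in> borel_measurable borel"
      "g \<in> borel_measurable borel" "k \<in> borel_measurable borel"
    using f g by (auto dest: L2_fun_D has_fourier_L2_D)
  have i: "integrable lborel (\<lambda>x. 2 * (cmod (g x))\<^sup>2 + 2 * (cmod (k x))\<^sup>2)"
    by (intro Bochner_Integration.integrable_add integrable_mult_right has_fourier_L2_D(2)[OF g(1)] has_fourier_L2_D(2)[OF g(2)])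
  have "(cmod (g x - k x))\<^sup>2 \<le> 2 * (cmod (g x))\<^sup>2 + 2 * (cmod (k x))\<^sup>2" for x
    using cmod_power2_sum_le[of "g x" "- k x"] by simp
  then have int: "integrable lborel (\<lambda>\<xi>. (cmod (g \<xi> - k \<xi>))\<^sup>2)"
    by (intro Bochner_Integration.integrable_bound[OF i]) auto
  define a where "a R = (\<integral>\<^sup>+\<xi>. ennreal ((cmod (fourier (trunc R f) \<xi> - g \<xi>))\<^sup>2) \<partial>lborel)" for R
  define b where "b R = (\<integral>\<^sup>+\<xi>. ennreal ((cmod (fourier (trunc R h) \<xi> - k \<xi>))\<^sup>2) \<partial>lborel)" for R
  have "((\<lambda>R. \<integral>\<^sup>+\<xi>. ennreal ((cmod (fourier (trunc R (\<lambda>x. f x - h x)) \<xi> - (g \<xi> - k \<xi>)))\<^sup>2) \<partial>lborel) \<longlongrightarrow> 0) at_top"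
  proof (rule tendsto_sandwich[of "\<lambda>_. 0" _ _ "\<lambda>R. 2 * a R + 2 * b R"])
    have "((\<lambda>R. 2 * a R + 2 * b R) \<longlongrightarrow> 2 * 0 + 2 * 0) at_top"
      using g unfolding has_fourier_L2_def a_def b_def
      by (intro tendsto_add ennreal_tendsto_cmult) auto
    then show "((\<lambda>R. 2 * a R + 2 * b R) \<longlongrightarrow> 0) at_top" by simp
    have "(\<integral>\<^sup>+\<xi>. ennreal ((cmod (fourier (trunc R (\<lambda>x. f x - h x)) \<xi> - (g \<xi> - k \<xi>)))\<^sup>2) \<partial>lborel) \<le> 2 * a R + 2 * b R" for R
    proof -
      have "trunc R (\<lambda>x. f x - h x) = (\<lambda>x. trunc R f x - trunc R h x)"
        by (simp add: right_diff_distrib fun_eq_iff)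
      then have "fourier (trunc R (\<lambda>x. f x - h x)) \<xi> = fourier (trunc R f) \<xi> - fourier (trunc R h) \<xi>" for \<xi>
        using fourier_diff[OF L2_fun_D(3)[OF f(1)] L2_fun_D(3)[OF f(2)]] by simp
      then have e: "fourier (trunc R (\<lambda>x. f x - h x)) \<xi> - (g \<xi> - k \<xi>)
          = (fourier (trunc R f) \<xi> - g \<xi>) + (k \<xi> - fourier (trunc R h) \<xi>)" for \<xi>
        by simp
      show ?thesis
        using nn_integral_cmod_power2_add_le[of "\<lambda>\<xi>. fourier (trunc R f) \<xi> - g \<xi>" lborel "\<lambda>\<xi>. k \<xi> - fourier (trunc R h) \<xi>"]
        by (simp add: e a_def b_def norm_minus_commute[of "k _"])
    qed
    then show "\<forall>\<^sub>F R in at_top. (\<integral>\<^sup>+\<xi>. ennreal ((cmod (fourier (trunc R (\<lambda>x. f x - h x)) \<xi> - (g \<xi> - k \<xi>)))\<^sup>2) \<partial>lborel) \<le> 2 * a R + 2 * b R"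
      by simp
  qed auto
  then show ?thesis using int by (simp add: has_fourier_L2_def)
qed

section \<open>Control of the L^2 norm by the Sobolev norm\<close>

lemma sobolev_diff_L2_le:
  fixes f h :: "'a::euclidean_space \<Rightarrow> real"
  assumes f: "f \<in> sobolev_space a" and h: "h \<in> sobolev_space a" and a: "0 \<le> a"
  shows "(LINT x|lborel. (f x - h x)\<^sup>2) \<le> 8 * (sobolev_norm a (\<lambda>x. f x - h x))\<^sup>2"
proof -
  let ?w = "\<lambda>\<xi>::'a. (1 + (norm \<xi>)\<^sup>2) powr a"
  let ?d = "\<lambda>x. f x - h x"
  obtain g where f2: "L2_fun f" and g: "has_fourier_L2 f g" "integrable lborel (\<lambda>\<xi>. ?w \<xi> * (cmod (g \<xi>))\<^sup>2)"
    using f by (auto simp: sobolev_space_def)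
  obtain k where h2: "L2_fun h" and k: "has_fourier_L2 h k" "integrable lborel (\<lambda>\<xi>. ?w \<xi> * (cmod (k \<xi>))\<^sup>2)"
    using h by (auto simp: sobolev_space_def)
  define G where "G = fourier_L2 ?d"
  have d2: "L2_fun ?d" by (rule L2_fun_diff[OF f2 h2])
  have gk: "has_fourier_L2 ?d (\<lambda>\<xi>. g \<xi> - k \<xi>)" by (rule has_fourier_L2_diff[OF f2 h2 g(1) k(1)])
  then have "\<exists>g. has_fourier_L2 ?d g" by blast
  then have G: "has_fourier_L2 ?d G" unfolding G_def fourier_L2_def by (rule someI_ex)
  have [measurable]: "g \<in> borel_measurable borel" "k \<in> borel_measurable borel" "G \<in> borel_measurable borel"
    using g k G by (auto dest: has_fourier_L2_D)
  \<comment> \<open>The chosen transform G agrees almost everywhere with g - k, whose weighted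
    square is integrable. Otherwise the Bochner integral in \<open>sobolev_norm\<close> could be 0
    by default and would control nothing.\<close>
  have "AE \<xi> in lborel. G \<xi> = g \<xi> - k \<xi>" by (rule has_fourier_L2_unique[OF d2 G gk])
  then have "AE \<xi> in lborel. norm (?w \<xi> * (cmod (G \<xi>))\<^sup>2) \<le> norm (2 * (?w \<xi> * (cmod (g \<xi>))\<^sup>2) + 2 * (?w \<xi> * (cmod (k \<xi>))\<^sup>2))"
  proof eventually_elim
    case (elim \<xi>)
    have "(cmod (G \<xi>))\<^sup>2 \<le> 2 * (cmod (g \<xi>))\<^sup>2 + 2 * (cmod (k \<xi>))\<^sup>2"
      using cmod_power2_sum_le[of "g \<xi>" "- k \<xi>"] elim by simp
    then have "?w \<xi> * (cmod (G \<xi>))\<^sup>2 \<le> ?w \<xi> * (2 * (cmod (g \<xi>))\<^sup>2 + 2 * (cmod (k \<xi>))\<^sup>2)"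
      by (intro mult_left_mono) auto
    then have "?w \<xi> * (cmod (G \<xi>))\<^sup>2 \<le> 2 * (?w \<xi> * (cmod (g \<xi>))\<^sup>2) + 2 * (?w \<xi> * (cmod (k \<xi>))\<^sup>2)"
      by (simp only: distrib_left mult_ac)
    moreover have "0 \<le> ?w \<xi> * (cmod (G \<xi>))\<^sup>2" by simp
    ultimately show ?case unfolding real_norm_def by linarith
  qed
  then have i: "integrable lborel (\<lambda>\<xi>. ?w \<xi> * (cmod (G \<xi>))\<^sup>2)"
    by (rule Bochner_Integration.integrable_bound[rotated 2])
      (intro Bochner_Integration.integrable_add integrable_mult_right g k, measurable)
  have "(LINT x|lborel. (?d x)\<^sup>2) \<le> 8 * (LINT \<xi>|lborel. (cmod (G \<xi>))\<^sup>2)"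
    by (rule plancherel_le[OF d2 G])
  also have "(LINT \<xi>|lborel. (cmod (G \<xi>))\<^sup>2) \<le> (LINT \<xi>|lborel. ?w \<xi> * (cmod (G \<xi>))\<^sup>2)"
  proof (rule integral_mono[OF has_fourier_L2_D(2)[OF G] i])
    fix \<xi> :: 'a
    have "1 \<le> ?w \<xi>" using a by (intro ge_one_powr_ge_zero) auto
    then have "1 * (cmod (G \<xi>))\<^sup>2 \<le> ?w \<xi> * (cmod (G \<xi>))\<^sup>2" by (intro mult_right_mono) auto
    then show "(cmod (G \<xi>))\<^sup>2 \<le> ?w \<xi> * (cmod (G \<xi>))\<^sup>2" by simp
  qed
  also have "(LINT \<xi>|lborel. ?w \<xi> * (cmod (G \<xi>))\<^sup>2) = (sobolev_norm a ?d)\<^sup>2"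
    unfolding sobolev_norm_def G_def[symmetric]
    by (rule real_sqrt_pow2[symmetric]) (rule Bochner_Integration.integral_nonneg, simp)
  finally show ?thesis by simp
qed

text \<open>Continuity bounds the squared L^2 norm only near each time; compactness of S selects
  finitely many such neighbourhoods, and the sum of their bounds serves for all. The 16 is twice the
  constant 8 of \<open>sobolev_diff_L2_le\<close>, for a Sobolev distance below 1.\<close>

lemma continuous_in_sobolev_L2_bounded:
  fixes u :: "real \<Rightarrow> 'a::euclidean_space \<Rightarrow> real"
  assumes u: "continuous_in_sobolev I a u" and a: "0 \<le> a" and S: "compact S" "S \<subseteq> I"
  shows "\<exists>N. \<forall>t\<in>S. (LINT x|lborel. (u t x)\<^sup>2) \<le> N"
proof -
  define n where "n t = (LINT x|lborel. (u t x)\<^sup>2)" for t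
  have sob: "u t \<in> sobolev_space a" if "t \<in> I" for t
    using u that by (auto simp: continuous_in_sobolev_def)
  have "\<exists>U. open U \<and> t \<in> U \<and> (\<forall>s\<in>U \<inter> I. n s \<le> 2 * n t + 16)" if t: "t \<in> I" for t
  proof -
    have "((\<lambda>s. sobolev_norm a (\<lambda>x. u s x - u t x)) \<longlongrightarrow> 0) (at t within I)"
      using u t by (auto simp: continuous_in_sobolev_def)
    then have "eventually (\<lambda>s. dist (sobolev_norm a (\<lambda>x. u s x - u t x)) 0 < 1) (at t within I)"
      by (rule tendstoD) simp
    then obtain U where U: "open U" "t \<in> U" "\<And>s. s \<in> U \<Longrightarrow> s \<noteq> t \<Longrightarrow> s \<in> I \<Longrightarrow> \<bar>sobolev_norm a (\<lambda>x. u s x - u t x)\<bar> < 1"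
      by (auto simp: eventually_at_topological)
    have "n s \<le> 2 * n t + 16" if s: "s \<in> U" "s \<in> I" for s
    proof (cases "s = t")
      case True
      have "0 \<le> n t" unfolding n_def by (rule Bochner_Integration.integral_nonneg) simp
      with True show ?thesis by simp
    next
      case False
      have L: "L2_fun (u s)" "L2_fun (u t)" using sob[OF s(2)] sob[OF t] by (auto simp: sobolev_space_def)
      have i: "integrable lborel (\<lambda>x. (u s x - u t x)\<^sup>2)" "integrable lborel (\<lambda>x. (u s x)\<^sup>2)" "integrable lborel (\<lambda>x. (u t x)\<^sup>2)"
        using L2_fun_D(2)[OF L2_fun_diff[OF L]] L2_fun_D(2)[OF L(1)] L2_fun_D(2)[OF L(2)] by auto
      have "(LINT x|lborel. (u s x - u t x)\<^sup>2) \<le> 8 * (sobolev_norm a (\<lambda>x. u s x - u t x))\<^sup>2"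
        by (rule sobolev_diff_L2_le[OF sob[OF s(2)] sob[OF t] a])
      also have "(sobolev_norm a (\<lambda>x. u s x - u t x))\<^sup>2 \<le> 1"
        using U(3)[OF s(1) False s(2)] by (simp add: abs_square_le_1 less_imp_le)
      finally have d: "(LINT x|lborel. (u s x - u t x)\<^sup>2) \<le> 8" by simp
      have "n s \<le> (LINT x|lborel. 2 * (u t x)\<^sup>2 + 2 * (u s x - u t x)\<^sup>2)"
        unfolding n_def
      proof (rule integral_mono)
        fix x show "(u s x)\<^sup>2 \<le> 2 * (u t x)\<^sup>2 + 2 * (u s x - u t x)\<^sup>2"
          using power2_sum_le[of "u t x" "u s x - u t x"] by simp
      qed (use i in auto)
      also have "\<dots> = 2 * n t + 2 * (LINT x|lborel. (u s x - u t x)\<^sup>2)"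
        using i by (simp add: n_def)
      finally show ?thesis using d by simp
    qed
    with U show ?thesis by blast
  qed
  then obtain U where U: "\<And>t. t \<in> I \<Longrightarrow> open (U t)" "\<And>t. t \<in> I \<Longrightarrow> t \<in> U t"
      "\<And>t s. t \<in> I \<Longrightarrow> s \<in> U t \<Longrightarrow> s \<in> I \<Longrightarrow> n s \<le> 2 * n t + 16"
    by (metis IntI)
  have cover: "S \<subseteq> (\<Union>c\<in>S. U c)" using U(2) S(2) by blast
  have "open (U t)" if "t \<in> S" for t using U(1) S(2) that by blast
  from compactE_image[OF S(1) this cover]
  obtain C where C: "C \<subseteq> S" "finite C" "S \<subseteq> (\<Union>c\<in>C. U c)" by blast
  have "n s \<le> (\<Sum>c\<in>C. 2 * n c + 16)" if s: "s \<in> S" for s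
  proof -
    obtain c where c: "c \<in> C" "s \<in> U c" using C s by auto
    have "n s \<le> 2 * n c + 16" using U(3)[of c s] c s C S by auto
    also have "\<dots> \<le> (\<Sum>c\<in>C. 2 * n c + 16)"
      by (rule member_le_sum[OF c(1) _ C(2)])
        (auto simp: n_def intro!: add_nonneg_nonneg Bochner_Integration.integral_nonneg)
    finally show ?thesis .
  qed
  then show ?thesis unfolding n_def by blast
qed

section \<open>The test function method\<close>

lemma continuous_bounded_off_compact:
  fixes f :: "real \<Rightarrow> real"
  assumes "continuous_on UNIV f" "\<And>t. 2 < \<bar>t\<bar> \<Longrightarrow> f t = 0"
  shows "\<exists>B\<ge>0. \<forall>t. \<bar>f t\<bar> \<le> B"
proof -
  have "bounded (f ` {-2..2})"
    by (intro compact_imp_bounded compact_continuous_image continuous_on_subset[OF assms(1)]) auto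
  then obtain B where B: "0 < B" "\<And>t. t \<in> {-2..2} \<Longrightarrow> \<bar>f t\<bar> \<le> B"
    unfolding bounded_pos by auto
  have "\<bar>f t\<bar> \<le> B" for t
    using B(1) B(2)[of t] assms(2)[of t] by (cases "2 < \<bar>t\<bar>") (auto simp: not_less abs_le_iff)
  with B show ?thesis by (intro exI[of _ B]) auto
qed

text \<open>A high power of the bump loses only a bounded factor under differentiation, up to the
  exponent \<open>1 / p\<close> that Young's inequality can absorb.\<close>

lemma time_cutoff:
  assumes p: "1 < p"
  obtains g g1 g2 :: "real \<Rightarrow> real" and C where
    "\<And>k. C_k k g" "\<And>t. (g has_real_derivative g1 t) (at t)" "\<And>t. (g1 has_real_derivative g2 t) (at t)"
    "continuous_on UNIV g2" "\<And>t. 0 \<le> g t" "\<And>t. g t \<le> 1" "g 0 = 1" "\<And>t. 2 \<le> \<bar>t\<bar> \<Longrightarrow> g t = 0"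
    "0 \<le> C" "\<And>t. \<bar>g1 t\<bar> \<le> C * g t powr (1 / p)" "\<And>t. \<bar>g2 t\<bar> \<le> C * g t powr (1 / p)"
proof -
  obtain b1 where b1: "\<And>t. (bump has_real_derivative b1 t) (at t)" "C_k (Suc 0) b1"
    using C_k_Suc_realE[OF C_k_bump] by blast
  obtain b2 where b2: "\<And>t. (b1 has_real_derivative b2 t) (at t)" "C_k 0 b2"
    using C_k_Suc_realE[OF b1(2)] by blast
  have z0: "bump t = 0" if "2 < \<bar>t\<bar>" for t using that by (intro bump_eq_0) auto
  have z1: "b1 t = 0" if "2 < \<bar>t\<bar>" for t
    by (rule deriv_zero_off_support[OF b1(1) _ that]) (rule z0)
  have z2: "b2 t = 0" if "2 < \<bar>t\<bar>" for t
    by (rule deriv_zero_off_support[OF b2(1) _ that]) (rule z1)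
  have c1: "continuous_on UNIV b1" by (auto intro!: continuous_at_imp_continuous_on DERIV_isCont b2)
  have c2: "continuous_on UNIV b2" using b2(2) by simp
  obtain B1 where B1: "0 \<le> B1" "\<And>t. \<bar>b1 t\<bar> \<le> B1"
    using continuous_bounded_off_compact[of b1] c1 z1 by auto
  obtain B2 where B2: "0 \<le> B2" "\<And>t. \<bar>b2 t\<bar> \<le> B2"
    using continuous_bounded_off_compact[of b2] c2 z2 by auto
  \<comment> \<open>Chosen with l \<ge> 2 / (p - 1), that is (l + 2) / p \<le> l: two derivatives of
    the power l + 2 still contain the power l, which is at most g^(1/p) since the bump lies in
    [0, 1]. The extra 1 makes l positive, so that the l-th power vanishes where the bump
    does.\<close>
  define l where "l = nat \<lceil>2 / (p - 1)\<rceil> + 1"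
  define m where "m = real (l + 2)"
  define g where "g t = bump t ^ (l + 2)" for t
  define g1 where "g1 t = m * (bump t ^ (l + 1) * b1 t)" for t
  define g2 where "g2 t = m * (real (l + 1) * bump t ^ l * (b1 t)\<^sup>2 + bump t ^ (l + 1) * b2 t)" for t
  have d1: "(g has_real_derivative g1 t) (at t)" for t
    unfolding g_def[abs_def] g1_def m_def
    by (rule derivative_eq_intros b1 refl)+ (simp add: mult_ac)
  have d2: "(g1 has_real_derivative g2 t) (at t)" for t
    unfolding g1_def[abs_def] g2_def
    by (rule derivative_eq_intros b1 b2 refl)+ (simp add: power2_eq_square algebra_simps)
  have cb: "continuous_on UNIV bump" using C_k_bump[of 0] by simp
  have key: "bump t ^ l \<le> g t powr (1 / p)" for t
  proof (cases "bump t = 0")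
    case True
    then show ?thesis by (simp add: l_def)
  next
    case False
    with bump_nonneg[of t] have pos: "0 < bump t" by linarith
    have "2 / (p - 1) \<le> real l" unfolding l_def by linarith
    then have "2 \<le> real l * (p - 1)" using p by (simp add: divide_simps)
    then have "(real l + 2) / p \<le> real l" using p by (simp add: divide_simps algebra_simps)
    then have "bump t powr real l \<le> bump t powr ((real l + 2) / p)"
      using pos bump_le_1[of t] by (intro powr_mono') auto
    also have "\<dots> = (bump t powr real (l + 2)) powr (1 / p)"
      by (simp add: powr_powr add.commute)
    also have "bump t powr real (l + 2) = g t"
      unfolding g_def by (rule powr_realpow[OF pos])
    finally show ?thesis using pos by (simp add: powr_realpow)
  qed
  have bl: "bump t ^ (l + 1) \<le> bump t ^ l" "0 \<le> bump t ^ l" for t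
    using bump_nonneg[of t] bump_le_1[of t] by (auto intro: mult_left_le_one_le)
  define C where "C = m * B1 + m * (real (l + 1) * B1\<^sup>2 + B2)"
  have m: "0 \<le> m" by (simp add: m_def)
  have C: "0 \<le> C" "m * B1 \<le> C" "m * (real (l + 1) * B1\<^sup>2 + B2) \<le> C"
    using m B1 B2 by (simp_all add: C_def)
  have e1: "\<bar>g1 t\<bar> \<le> C * g t powr (1 / p)" for t
  proof -
    have "\<bar>g1 t\<bar> = m * (bump t ^ (l + 1) * \<bar>b1 t\<bar>)"
      using m bump_nonneg[of t] by (simp add: g1_def abs_mult)
    also have "\<dots> \<le> m * (bump t ^ l * B1)"
      using m bl B1 bump_nonneg[of t] by (intro mult_left_mono mult_mono) auto
    also have "\<dots> = (m * B1) * bump t ^ l" by simp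
    also have "\<dots> \<le> C * g t powr (1 / p)"
      using C bl key by (intro mult_mono) auto
    finally show ?thesis .
  qed
  have e2: "\<bar>g2 t\<bar> \<le> C * g t powr (1 / p)" for t
  proof -
    have "\<bar>g2 t\<bar> = m * \<bar>real (l + 1) * bump t ^ l * (b1 t)\<^sup>2 + bump t ^ (l + 1) * b2 t\<bar>"
      using m by (simp add: g2_def abs_mult)
    also have "\<dots> \<le> m * (real (l + 1) * bump t ^ l * (b1 t)\<^sup>2 + bump t ^ (l + 1) * \<bar>b2 t\<bar>)"
      using bump_nonneg[of t]
      by (intro mult_left_mono m order_trans[OF abs_triangle_ineq] add_mono) (auto simp: abs_mult)
    also have "\<dots> \<le> m * (real (l + 1) * bump t ^ l * B1\<^sup>2 + bump t ^ l * B2)"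
      using bl B1 B2 bump_nonneg[of t] power_mono[OF B1(2)[of t], of 2]
      by (intro mult_left_mono m add_mono mult_mono) auto
    also have "\<dots> = (m * (real (l + 1) * B1\<^sup>2 + B2)) * bump t ^ l" by (simp add: algebra_simps)
    also have "\<dots> \<le> C * g t powr (1 / p)"
      using C bl key by (intro mult_mono) auto
    finally show ?thesis .
  qed
  show thesis
  proof (rule that[of g g1 g2 C])
    show "C_k k g" for k unfolding g_def[abs_def] by (intro C_k_power C_k_bump)
    show "continuous_on UNIV g2" unfolding g2_def[abs_def] by (intro continuous_intros cb c1 c2)
    show "0 \<le> g t" "g t \<le> 1" for t
      unfolding g_def by (intro zero_le_power power_le_one bump_nonneg bump_le_1)+
    show "g 0 = 1" by (simp add: g_def bump_eq_1)
    show "g t = 0" if "2 \<le> \<bar>t\<bar>" for t using bump_eq_0[OF that] by (simp add: g_def)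
  qed (fact d1 d2 e1 e2 C)+
qed

text \<open>A split according to whether b \<le> a^(p-1) replaces the sharp constants. The
  coefficient of a^p must not exceed 1, since this term has to cancel against the nonlinear
  term.\<close>

lemma young_weak:
  fixes a b :: real
  assumes p: "1 < p" and "0 \<le> a" "0 \<le> b"
  shows "a * b \<le> a powr p + b powr (p / (p - 1))"
proof (cases "b \<le> a powr (p - 1)")
  case True
  then have "a * b \<le> a * a powr (p - 1)" using assms by (intro mult_left_mono) auto
  also have "\<dots> = a powr p" using assms by (cases "a = 0") (auto simp: powr_mult_base)
  finally show ?thesis by (simp add: add_increasing2)
next
  case False
  have "a = (a powr (p - 1)) powr (1 / (p - 1))" using assms by (simp add: powr_powr)
  also have "\<dots> \<le> b powr (1 / (p - 1))" using False p by (intro powr_mono2) auto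
  finally have "a * b \<le> b powr (1 / (p - 1)) * b" using assms by (intro mult_right_mono) auto
  also have "\<dots> = b powr (1 + 1 / (p - 1))" using assms powr_mult_base[of b "1 / (p - 1)"] by (simp add: mult.commute)
  also have "1 + 1 / (p - 1) = p / (p - 1)" using p by (simp add: field_simps)
  finally show ?thesis by (simp add: add_increasing)
qed

text \<open>The free parameter \<tau> puts a small weight on the L^2 norm of u and the large weight
  1/\<tau> on the tail, which vanishes as the number of scales grows.\<close>

lemma weighted_amgm: "a * b \<le> \<tau> * a\<^sup>2 + b\<^sup>2 / \<tau>" if "0 < \<tau>" for a b \<tau> :: real
proof -
  have "0 \<le> (sqrt \<tau> * a - b / sqrt \<tau>)\<^sup>2" by simp
  also have "\<dots> = \<tau> * a\<^sup>2 + b\<^sup>2 / \<tau> - 2 * (a * b)"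
    using that by (simp add: power2_diff power_mult_distrib power_divide)
  finally have "2 * (a * b) \<le> \<tau> * a\<^sup>2 + b\<^sup>2 / \<tau>" by simp
  moreover have "0 \<le> \<tau> * a\<^sup>2 + b\<^sup>2 / \<tau>" using that by simp
  ultimately show ?thesis by linarith
qed

section \<open>The weak formulation tested with the cutoff\<close>

lemma C_k_cutoff_snd: "C_k k (\<lambda>z::real \<times> 'a::euclidean_space. cutoff q J K (snd z))"
proof -
  have "bounded_linear (\<lambda>z::real \<times> 'a. (snd z /\<^sub>R c) \<bullet> b)" for c b
    by (intro bounded_linear_inner_left_comp bounded_linear_compose[OF bounded_linear_scaleR_right] bounded_linear_snd)
  then show ?thesis unfolding cutoff_def[abs_def] prof_def
    by (intro C_k_sum C_k_mult C_k_prod C_k_const C_k_compose[OF C_k_bump] C_k_bounded_linear)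
qed

text \<open>The factor \<open>g (2 / R * t)\<close> vanishes for |t| \<ge> R, so the support ends by
  time R, strictly before T; in space it is bounded for each fixed J.\<close>

lemma test_function_product:
  fixes K R :: real
  assumes g: "\<And>k. C_k k g" "\<And>t. 2 \<le> \<bar>t\<bar> \<Longrightarrow> g t = 0" and R: "0 < R" "ennreal R < T" and K: "0 < K"
  shows "test_function T (\<lambda>(t, x). g (2 / R * t) * cutoff q J K (x::'a::euclidean_space))" (is "test_function T ?\<phi>")
proof -
  define Q where "Q = {- R..R} \<times> cball (0::'a) (2 * real DIM('a) * K * 2 ^ J)"
  have Q: "compact Q" unfolding Q_def by (intro compact_Times) auto
  have "z \<in> Q" if "?\<phi> z \<noteq> 0" for z
  proof -
    obtain t x where z: "z = (t, x)" by force
    have "\<not> 2 \<le> \<bar>2 / R * t\<bar>" using that g(2) z by fastforce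
    then have "\<bar>t\<bar> \<le> R" using R by (auto simp: abs_mult divide_simps)
    moreover have "norm x \<le> 2 * real DIM('a) * K * 2 ^ J"
      using that z cutoff_eq_0[OF K, of J x q] by force
    ultimately show ?thesis using z by (auto simp: Q_def)
  qed
  then have sub: "closure {z. ?\<phi> z \<noteq> 0} \<subseteq> Q"
    by (intro closure_minimal compact_imp_closed Q) auto
  have "compact (closure {z. ?\<phi> z \<noteq> 0})"
    using compact_Int_closed[OF Q closed_closure, of "{z. ?\<phi> z \<noteq> 0}"] sub by (simp add: Int_absorb1)
  moreover have "Q \<subseteq> {t. ennreal t < T} \<times> UNIV"
  proof -
    have "ennreal t < T" if "t \<le> R" for t using ennreal_leI[OF that] R(2) by (rule le_less_trans)
    then show ?thesis by (auto simp: Q_def)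
  qed
  moreover have "C_k k ?\<phi>" for k
  proof -
    have "C_k k (\<lambda>z::real \<times> 'a. g (2 / R * fst z) * cutoff q J K (snd z))"
      by (intro C_k_mult C_k_cutoff_snd C_k_compose[OF g(1)] C_k_const C_k_bounded_linear bounded_linear_fst)
    then show ?thesis by (simp add: split_def)
  qed
  ultimately show ?thesis using sub unfolding test_function_def by blast
qed

text \<open>D bounds the three operator terms relative to cutoff plus tail, with g^(1/p) as a common
  factor in time. Young's inequality bounds u times these terms by |u|^p times the test function
  plus a remainder. The former occurs on the left of the weak identity with the same coefficient and
  cancels because its integral is finite; the remainder is integrated over [0, R], hence the factor
  R. J and \<tau> stay arbitrary, so that limits can be taken afterwards.\<close>

lemma weak_form_estimate:
  fixes u :: "real \<Rightarrow> 'a::euclidean_space \<Rightarrow> real" and v :: "'a \<Rightarrow> real"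
  assumes sol: "sobolev_solution \<sigma> \<delta> p v T u"
    and p: "1 < p" and R: "0 < R" "ennreal R < T" and K: "1 \<le> K" and q: "real DIM('a) \<le> q"
    and g: "\<And>k. C_k k g" "\<And>t. (g has_real_derivative g1 t) (at t)" "\<And>t. (g1 has_real_derivative g2 t) (at t)"
      "continuous_on UNIV g2" "\<And>t. 0 \<le> g t" "\<And>t. g t \<le> 1" "g 0 = 1" "\<And>t. 2 \<le> \<bar>t\<bar> \<Longrightarrow> g t = 0"
      "0 \<le> C" "\<And>t. \<bar>g1 t\<bar> \<le> C * g t powr (1 / p)" "\<And>t. \<bar>g2 t\<bar> \<le> C * g t powr (1 / p)"
    and L\<sigma>: "\<And>x. \<bar>frac_laplacian \<sigma> (cutoff q J K) x\<bar> \<le> a * (cutoff q J K x + tail q J K (x::'a))"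
    and L\<delta>: "\<And>x. \<bar>frac_laplacian \<delta> (cutoff q J K) x\<bar> \<le> b * (cutoff q J K x + tail q J K (x::'a))"
    and ab: "0 \<le> a" "0 \<le> b"
    and D: "D = C * (2 / R)\<^sup>2 + a + C * (2 / R) * b"
    and N: "\<And>t. t \<in> {0..R} \<Longrightarrow> (LINT x|lborel. (u t x)\<^sup>2) \<le> N"
    and \<tau>: "0 < \<tau>"
  shows "(LINT x|lborel. v x * cutoff q J K x) \<le> R * (D powr (p / (p - 1)) * (LINT x|lborel. cutoff q J K (x::'a))
    + D * (\<tau> * N + (LINT x|lborel. (tail q J K (x::'a))\<^sup>2) / \<tau>))"
proof -
  define I where "I = time_interval T"
  define F where "F = (cutoff q J K :: 'a \<Rightarrow> real)"
  define G where "G = (tail q J K :: 'a \<Rightarrow> real)"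
  define c where "c = 2 / R"
  have c: "0 < c" using R by (simp add: c_def)
  have K0: "0 < K" using K by simp
  have "1 \<le> real DIM('a)" by (simp add: Suc_leI)
  with q have q1: "1 \<le> q" by linarith
  have [measurable]: "F \<in> borel_measurable borel" "G \<in> borel_measurable borel"
    by (simp_all add: F_def G_def)
  have F: "0 \<le> F x" "F x \<le> 2" for x
    unfolding F_def by (rule cutoff_nonneg, rule cutoff_le_2[OF q1])
  have G0: "0 \<le> G x" for x unfolding G_def by (rule tail_nonneg)
  have iF: "integrable lborel F" unfolding F_def by (rule cutoff_integrable[OF K0])
  have iG: "integrable lborel (\<lambda>x. (G x)\<^sup>2)" unfolding G_def by (rule tail_sq_tendsto_0(1)[OF q K])
  have cont: "continuous_on UNIV g" "continuous_on UNIV g1"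
    by (auto intro!: continuous_at_imp_continuous_on DERIV_isCont g(2,3))
  have [measurable]: "g \<in> borel_measurable borel" "g1 \<in> borel_measurable borel" "g2 \<in> borel_measurable borel"
    by (intro borel_measurable_continuous_onI cont g(4))+
  have Im[measurable]: "I \<in> sets borel"
    unfolding I_def time_interval_def by measurable
  have sub: "{0..R} \<subseteq> I"
  proof
    fix t assume "t \<in> {0..R}"
    then have "ennreal t \<le> ennreal R" by (intro ennreal_leI) auto
    then have "ennreal t < T" using R(2) by (rule le_less_trans)
    then show "t \<in> I" using \<open>t \<in> {0..R}\<close> by (simp add: I_def time_interval_def)
  qed
  have off: "g (c * t) = 0" "g1 (c * t) = 0" "g2 (c * t) = 0" if "R < \<bar>t\<bar>" for t
  proof -
    have "2 \<le> \<bar>c * t\<bar>" using that R by (simp add: c_def abs_mult divide_simps)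
    then show "g (c * t) = 0" by (rule g(8))
    then show "g1 (c * t) = 0" "g2 (c * t) = 0" using g(10)[of "c * t"] g(11)[of "c * t"] by auto
  qed

  have um: "(\<lambda>z. indicator (I \<times> UNIV) z *\<^sub>R (case z of (t, x) \<Rightarrow> u t x)) \<in> borel_measurable lborel"
    and uc: "continuous_in_sobolev I (2 * \<sigma>) u"
    and up: "\<And>S. compact S \<Longrightarrow> S \<subseteq> I \<times> UNIV \<Longrightarrow> set_integrable lborel S (\<lambda>(t, x). \<bar>u t x\<bar> powr p)"
    and weak: "\<And>\<phi>. test_function T \<phi> \<Longrightarrow>
        (LINT t:I|lborel. LINT x|lborel. \<bar>u t x\<bar> powr p * \<phi> (t, x)) + (LINT x|lborel. v x * \<phi> (0, x))
        = (LINT t:I|lborel. LINT x|lborel. u t x * (dt (dt \<phi>) (t, x)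
                      + frac_laplacian \<sigma> (\<lambda>y. \<phi> (t, y)) x - frac_laplacian \<delta> (\<lambda>y. dt \<phi> (t, y)) x))"
    using sol unfolding sobolev_solution_def I_def set_borel_measurable_def by blast+
  define W where "W t x = c\<^sup>2 * g2 (c * t) * F x + g (c * t) * frac_laplacian \<sigma> F x - c * g1 (c * t) * frac_laplacian \<delta> F x" for t x
  define \<phi> where "\<phi> = (\<lambda>(t, x). g (c * t) * F x)"
  have tf: "test_function T \<phi>"
    unfolding \<phi>_def F_def c_def by (rule test_function_product[OF g(1) g(8) R K0])
  have dt1: "dt \<phi> = (\<lambda>(t, x). (c * g1 (c * t)) * F x)"
  proof -
    have "((\<lambda>s. g (c * s) * F x) has_real_derivative c * g1 (c * t) * F x) (at t)" for t x
      by (rule derivative_eq_intros DERIV_chain2[OF g(2)] refl)+ (simp add: mult.commute)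
    then show ?thesis by (auto simp: dt_def \<phi>_def fun_eq_iff intro!: DERIV_imp_deriv)
  qed
  have dt2: "dt (\<lambda>(t, x). c * g1 (c * t) * F x) = (\<lambda>(t, x). c\<^sup>2 * g2 (c * t) * F x)"
  proof -
    have "((\<lambda>s. c * g1 (c * s) * F x) has_real_derivative c\<^sup>2 * g2 (c * t) * F x) (at t)" for t x
      by (rule derivative_eq_intros DERIV_chain2[OF g(3)] refl)+ (simp add: power2_eq_square mult_ac)
    then show ?thesis by (auto simp: dt_def fun_eq_iff intro!: DERIV_imp_deriv)
  qed
  define X where "X t = (LINT x|lborel. \<bar>u t x\<bar> powr p * (g (c * t) * F x))" for t
  define Y where "Y t = (LINT x|lborel. u t x * W t x)" for t
  have eq: "(LINT t|lborel. indicator I t * X t) + (LINT x|lborel. v x * F x) = (LINT t|lborel. indicator I t * Y t)"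
    using weak[OF tf] unfolding dt1 dt2
    by (simp add: \<phi>_def g(7) frac_laplacian_cmult X_def Y_def W_def set_lebesgue_integral_def)

  have D0: "0 \<le> D" using D g(9) ab R by simp
  have Wb: "\<bar>W t x\<bar> \<le> D * g (c * t) powr (1 / p) * (F x + G x)" for t x
  proof -
    let ?\<theta> = "g (c * t) powr (1 / p)" and ?H = "F x + G x"
    have H: "0 \<le> ?H" "F x \<le> ?H" using F(1)[of x] G0[of x] by auto
    \<comment> \<open>From 0 \<le> g \<le> 1 and p > 1; the term without time derivative thus shares
      the factor of the two differentiated ones.\<close>
    have "g (c * t) \<le> ?\<theta>"
    proof (cases "g (c * t) = 0")
      case False
      then have "g (c * t) powr 1 \<le> ?\<theta>" using p g(5)[of "c * t"] g(6)[of "c * t"]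
        by (intro powr_mono') auto
      then show ?thesis using g(5)[of "c * t"] by simp
    qed simp
    then have 2: "\<bar>g (c * t) * frac_laplacian \<sigma> F x\<bar> \<le> ?\<theta> * (a * ?H)"
      unfolding abs_mult using g(5)[of "c * t"] L\<sigma>[of x] by (intro mult_mono) (auto simp: F_def G_def)
    have 1: "\<bar>c\<^sup>2 * g2 (c * t) * F x\<bar> \<le> c\<^sup>2 * (C * ?\<theta>) * ?H"
      unfolding abs_mult using g(11)[of "c * t"] g(9) F(1)[of x] H by (intro mult_mono) auto
    have 3: "\<bar>c * g1 (c * t) * frac_laplacian \<delta> F x\<bar> \<le> c * (C * ?\<theta>) * (b * ?H)"
      unfolding abs_mult using g(10)[of "c * t"] g(9) c L\<delta>[of x] by (intro mult_mono) (auto simp: F_def G_def)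
    have "\<bar>W t x\<bar> \<le> c\<^sup>2 * (C * ?\<theta>) * ?H + ?\<theta> * (a * ?H) + c * (C * ?\<theta>) * (b * ?H)"
      unfolding W_def using 1 2 3 by linarith
    also have "\<dots> = D * ?\<theta> * ?H" unfolding D c_def by (simp add: algebra_simps)
    finally show ?thesis .
  qed
  have W0: "W t x = 0" if "R < \<bar>t\<bar>" for t x using off[OF that] by (simp add: W_def)

  have L2u: "integrable lborel (\<lambda>x. (u t x)\<^sup>2)" "u t \<in> borel_measurable borel" if "t \<in> I" for t
  proof -
    have "L2_fun (u t)" using uc that by (auto simp: continuous_in_sobolev_def sobolev_space_def)
    then show "integrable lborel (\<lambda>x. (u t x)\<^sup>2)" "u t \<in> borel_measurable borel" by (rule L2_fun_D)+
  qed
  \<comment> \<open>An integrable majorant of (F + G)^2: the 4 combines the factor 2 of the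
    elementary inequality with F^2 \<le> 2F.\<close>
  define P where "P x = 4 * F x + 2 * (G x)\<^sup>2" for x
  have iP: "integrable lborel P" unfolding P_def[abs_def] using iF iG by simp
  have HP: "(F x + G x)\<^sup>2 \<le> P x" for x
  proof -
    have "F x * F x \<le> F x * 2" using F[of x] by (intro mult_left_mono) auto
    then show ?thesis using power2_sum_le[of "F x" "G x"] by (simp add: P_def power2_eq_square)
  qed
  have ptY: "\<bar>u t x * W t x\<bar> \<le> D * ((u t x)\<^sup>2 + P x)" for t x
  proof -
    have "g (c * t) powr (1 / p) \<le> 1" using g(5)[of "c * t"] g(6)[of "c * t"] p by (intro powr_le1) auto
    then have "D * g (c * t) powr (1 / p) * (F x + G x) \<le> D * 1 * (F x + G x)"
      using D0 F(1)[of x] G0[of x] by (intro mult_right_mono mult_left_mono) auto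
    then have "\<bar>W t x\<bar> \<le> D * (F x + G x)" using Wb[of t x] by simp
    then have "\<bar>u t x * W t x\<bar> \<le> \<bar>u t x\<bar> * (D * (F x + G x))"
      unfolding abs_mult by (intro mult_left_mono) auto
    also have "\<dots> = D * (\<bar>u t x\<bar> * (F x + G x))" by simp
    also have "\<dots> \<le> D * ((u t x)\<^sup>2 + P x)"
    proof (intro mult_left_mono D0)
      show "\<bar>u t x\<bar> * (F x + G x) \<le> (u t x)\<^sup>2 + P x"
        using weighted_amgm[of 1 "\<bar>u t x\<bar>" "F x + G x"] HP[of x] by simp
    qed
    finally show ?thesis .
  qed
  have [measurable]: "W t \<in> borel_measurable borel" for t unfolding W_def[abs_def] by measurable
  have iY: "integrable lborel (\<lambda>x. u t x * W t x)" if "t \<in> I" for t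
  proof (rule Bochner_Integration.integrable_bound)
    show "integrable lborel (\<lambda>x. D * ((u t x)\<^sup>2 + P x))"
      by (intro integrable_mult_right Bochner_Integration.integrable_add L2u that iP)
    have [measurable]: "u t \<in> borel_measurable borel" by (rule L2u[OF that])
    show "(\<lambda>x. u t x * W t x) \<in> borel_measurable lborel" by measurable
    show "AE x in lborel. norm (u t x * W t x) \<le> norm (D * ((u t x)\<^sup>2 + P x))"
      unfolding real_norm_def by (intro AE_I2 order_trans[OF ptY abs_ge_self])
  qed

  define S where "S = {0..R} \<times> cball (0::'a) (2 * real DIM('a) * K * 2 ^ J)"
  have S: "compact S" "S \<subseteq> I \<times> UNIV"
    unfolding S_def using sub by (auto intro: compact_Times)
  \<comment> \<open>Integrability of |u|^p is given on compact sets only. S contains the support of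
    the test function in nonnegative time, so V is integrable and still agrees with the full
    integrand on I.\<close>
  define V where "V = (\<lambda>z::real \<times> 'a. (indicator S z * (case z of (t, x) \<Rightarrow> \<bar>u t x\<bar> powr p)) * (g (c * fst z) * F (snd z)))"
  have iV: "integrable (lborel \<Otimes>\<^sub>M lborel) V"
    unfolding lborel_prod
  proof (rule Bochner_Integration.integrable_bound)
    have *: "integrable lborel (\<lambda>z::real \<times> 'a. indicator S z * (case z of (t, x) \<Rightarrow> \<bar>u t x\<bar> powr p))"
      using up[OF S] by (simp add: set_integrable_def)
    then show "integrable lborel (\<lambda>z::real \<times> 'a. 2 * (indicator S z * (case z of (t, x) \<Rightarrow> \<bar>u t x\<bar> powr p)))"
      by (rule integrable_mult_right)
    have [measurable]: "(\<lambda>z::real \<times> 'a. indicator S z * (case z of (t, x) \<Rightarrow> \<bar>u t x\<bar> powr p)) \<in> borel_measurable borel"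
      using * by auto
    have "(\<lambda>z::real \<times> 'a. g (c * fst z) * F (snd z)) \<in> borel_measurable (borel \<Otimes>\<^sub>M borel)" by measurable
    then have [measurable]: "(\<lambda>z::real \<times> 'a. g (c * fst z) * F (snd z)) \<in> borel_measurable borel"
      by (simp add: borel_prod)
    show "V \<in> borel_measurable lborel" unfolding V_def by measurable
    have gF: "\<bar>g s * F x\<bar> \<le> 2" for s x
      using mult_mono[OF g(6)[of s] F(2)[of x]] g(5)[of s] F(1)[of x] by simp
    show "AE z in lborel. norm (V z) \<le> norm (2 * (indicator S z * (case z of (t, x) \<Rightarrow> \<bar>u t x\<bar> powr p)))"
    proof (rule AE_I2)
      fix z :: "real \<times> 'a"
      let ?A = "indicator S z * (case z of (t, x) \<Rightarrow> \<bar>u t x\<bar> powr p) :: real"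
      have A: "0 \<le> ?A" by (auto simp: split_def)
      have "norm (V z) = ?A * \<bar>g (c * fst z) * F (snd z)\<bar>"
        unfolding V_def real_norm_def abs_mult[of ?A] using A by simp
      also have "\<dots> \<le> ?A * 2" by (intro mult_left_mono gF A)
      finally show "norm (V z) \<le> norm (2 * ?A)" using A by simp
    qed
  qed
  have V: "V (t, x) = indicator I t * (\<bar>u t x\<bar> powr p * (g (c * t) * F x))" for t x
  proof (cases "(t, x) \<in> S")
    case True
    with S show ?thesis by (auto simp: V_def)
  next
    case False
    then consider "t < 0" | "R < \<bar>t\<bar>" | "2 * real DIM('a) * K * 2 ^ J < norm x"
      unfolding S_def by (cases "t < 0"; cases "R < t") auto
    then show ?thesis
    proof cases
      case 1
      then show ?thesis using False by (simp add: V_def I_def time_interval_def)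
    next
      case 2
      then show ?thesis using False off by (simp add: V_def)
    next
      case 3
      then show ?thesis using False cutoff_eq_0[OF K0 3, of q] by (simp add: V_def F_def)
    qed
  qed
  have X: "indicator I t * X t = (LINT x|lborel. V (t, x))" for t
    by (simp add: V X_def)
  have iX: "integrable lborel (\<lambda>t. indicator I t * X t)"
    unfolding X by (rule lborel_pair.integrable_fst'[OF iV])
  \<comment> \<open>For these times the x integral defining \<open>X t\<close> is a genuine value
    and not a default 0, so that additivity may be used in the comparison below.\<close>
  have AEX: "AE t in lborel. integrable lborel (\<lambda>x. V (t, x))"
    by (rule lborel_pair.AE_integrable_fst'[OF iV])

  \<comment> \<open>Measurability in time of the space integral needs joint measurability of u,
    which is available for its extension by 0 beyond I.\<close>
  define U where "U = (\<lambda>z::real \<times> 'a. indicator (I \<times> UNIV) z *\<^sub>R (case z of (t, x) \<Rightarrow> u t x))"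
  have [measurable]: "U \<in> borel_measurable (borel \<Otimes>\<^sub>M borel)"
    using um by (simp add: U_def borel_prod)
  have YU: "indicator I t * Y t = (LINT x|lborel. U (t, x) * W t x)" for t
    by (simp add: U_def Y_def indicator_times mult.assoc)
  have [measurable]: "(\<lambda>t. indicator I t * Y t) \<in> borel_measurable lborel"
    unfolding YU W_def by measurable
  define MP where "MP = (LINT x|lborel. P x)"
  have iYt: "integrable lborel (\<lambda>t. indicator I t * Y t)"
  proof (rule Bochner_Integration.integrable_bound)
    show "integrable lborel (\<lambda>t. indicator {0..R} t *\<^sub>R (D * (N + MP)))"
      by (rule borel_integrable_compact) auto
    show "AE t in lborel. norm (indicator I t * Y t) \<le> norm (indicator {0..R} t *\<^sub>R (D * (N + MP)))"
    proof (rule AE_I2)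
      fix t
      show "norm (indicator I t * Y t) \<le> norm (indicator {0..R} t *\<^sub>R (D * (N + MP)))"
      proof (cases "t \<in> {0..R}")
        case True
        then have tI: "t \<in> I" using sub by auto
        have "\<bar>Y t\<bar> \<le> (LINT x|lborel. \<bar>u t x * W t x\<bar>)"
          unfolding Y_def by (rule integral_abs_bound)
        also have "\<dots> \<le> (LINT x|lborel. D * ((u t x)\<^sup>2 + P x))"
          by (rule integral_mono) (use iY[OF tI] ptY L2u[OF tI] iP in auto)
        also have "\<dots> = D * ((LINT x|lborel. (u t x)\<^sup>2) + MP)"
          using L2u[OF tI] iP by (simp add: MP_def)
        also have "\<dots> \<le> D * (N + MP)" using N[OF True] D0 by (intro mult_left_mono) auto
        finally show ?thesis using True tI by simp
      next
        case False
        then have "t \<notin> I \<or> R < \<bar>t\<bar>" by (auto simp: I_def time_interval_def)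
        then have "indicator I t * Y t = 0" using W0 by (auto simp: Y_def)
        with False show ?thesis by simp
      qed
    qed
  qed measurable
  define Z where "Z = D powr (p / (p - 1)) * (LINT x|lborel. F x) + D * (\<tau> * N + (LINT x|lborel. (G x)\<^sup>2) / \<tau>)"
  \<comment> \<open>Young's inequality is applied to |u| g^(1/p) and D, so that the p-th power
    reproduces |u|^p g; in the tail part g^(1/p) is simply replaced by 1.\<close>
  have pt: "u t x * W t x \<le> \<bar>u t x\<bar> powr p * (g (c * t) * F x) + (D powr (p / (p - 1)) * F x + D * (\<tau> * (u t x)\<^sup>2 + (G x)\<^sup>2 / \<tau>))" for t x
  proof -
    let ?\<theta> = "g (c * t) powr (1 / p)" and ?y = "\<bar>u t x\<bar>"
    have \<theta>: "0 \<le> ?\<theta>" "?\<theta> \<le> 1" using g(5)[of "c * t"] g(6)[of "c * t"] p by (auto intro: powr_le1)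
    have "u t x * W t x \<le> ?y * \<bar>W t x\<bar>" by (metis abs_ge_self abs_mult)
    also have "\<dots> \<le> ?y * (D * ?\<theta> * (F x + G x))" by (intro mult_left_mono Wb) auto
    also have "\<dots> = ((?y * ?\<theta>) * D) * F x + (D * (?y * G x)) * ?\<theta>" by (simp add: algebra_simps)
    also have "\<dots> \<le> ((?y * ?\<theta>) powr p + D powr (p / (p - 1))) * F x + (D * (?y * G x)) * 1"
      using \<theta> D0 F(1)[of x] G0[of x] p
      by (intro add_mono mult_right_mono mult_left_mono young_weak) auto
    also have "(?y * ?\<theta>) powr p = ?y powr p * g (c * t)"
      using p g(5)[of "c * t"] by (simp add: powr_mult powr_powr)
    also have "D * (?y * G x) * 1 \<le> D * (\<tau> * (u t x)\<^sup>2 + (G x)\<^sup>2 / \<tau>)"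
      using weighted_amgm[OF \<tau>, of ?y "G x"] D0 by (simp add: mult_left_mono)
    finally show ?thesis by (simp add: algebra_simps)
  qed
  have "AE t in lborel. indicator I t * Y t \<le> indicator I t * X t + indicator {0..R} t *\<^sub>R Z"
    using AEX
  proof eventually_elim
    case (elim t)
    show ?case
    proof (cases "t \<in> {0..R}")
      case True
      then have tI: "t \<in> I" using sub by auto
      let ?B = "\<lambda>x. D powr (p / (p - 1)) * F x + D * (\<tau> * (u t x)\<^sup>2 + (G x)\<^sup>2 / \<tau>)"
      have iB: "integrable lborel ?B" using iF iG L2u[OF tI] by simp
      have iXx: "integrable lborel (\<lambda>x. \<bar>u t x\<bar> powr p * (g (c * t) * F x))"
        using elim tI by (simp add: V)
      have "Y t \<le> (LINT x|lborel. \<bar>u t x\<bar> powr p * (g (c * t) * F x) + ?B x)"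
        unfolding Y_def by (rule integral_mono[OF iY[OF tI] Bochner_Integration.integrable_add[OF iXx iB]]) (rule pt)
      also have "\<dots> = X t + (LINT x|lborel. ?B x)"
        unfolding X_def by (rule Bochner_Integration.integral_add[OF iXx iB])
      also have "(LINT x|lborel. ?B x) = D powr (p / (p - 1)) * (LINT x|lborel. F x)
          + D * (\<tau> * (LINT x|lborel. (u t x)\<^sup>2) + (LINT x|lborel. (G x)\<^sup>2) / \<tau>)"
        using iF iG L2u[OF tI] by simp
      also have "\<dots> \<le> Z" unfolding Z_def
        using N[OF True] D0 \<tau> by (intro add_mono mult_left_mono) auto
      finally show ?thesis using True tI by simp
    next
      case False
      then have "t \<notin> I \<or> R < \<bar>t\<bar>" by (auto simp: I_def time_interval_def)
      then have z: "indicator I t * Y t = 0" "indicator I t * X t = 0"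
        using W0 off by (auto simp: Y_def X_def)
      show ?thesis unfolding z using False by simp
    qed
  qed
  moreover have iZ: "integrable lborel (\<lambda>t. indicator {0..R} t *\<^sub>R Z)"
    by (rule borel_integrable_compact) auto
  ultimately have "(LINT t|lborel. indicator I t * Y t) \<le> (LINT t|lborel. indicator I t * X t + indicator {0..R} t *\<^sub>R Z)"
    by (intro integral_mono_AE iYt Bochner_Integration.integrable_add iX)
  also have "\<dots> = (LINT t|lborel. indicator I t * X t) + (LINT t|lborel. indicator {0..R} t *\<^sub>R Z)"
    by (rule Bochner_Integration.integral_add[OF iX iZ])
  also have "(LINT t|lborel. indicator {0..R} t *\<^sub>R Z) = R * Z" using R by simp
  finally have "(LINT x|lborel. v x * F x) \<le> R * Z" using eq by linarith
  then show ?thesis unfolding Z_def F_def G_def .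
qed

text \<open>The cutoff is a constant c \<ge> 1 on |x| \<le> K and differs from c by at most 2
  elsewhere. Once the mass of |f| outside the ball is below a quarter of the integral of f, at least
  half of that integral survives, for all J at once.\<close>

lemma cutoff_pairing_ge:
  fixes f :: "'a::euclidean_space \<Rightarrow> real"
  assumes f: "integrable lborel f" and m: "0 < (LINT x|lborel. f x)" and q: "1 \<le> q"
  shows "\<exists>K0\<ge>1. \<forall>K\<ge>K0. \<forall>J. (LINT x|lborel. f x) / 2 \<le> (LINT x|lborel. f x * cutoff q J K x)"
proof -
  have [measurable]: "f \<in> borel_measurable borel" using f by auto
  define m where "m = (LINT x|lborel. f x)"
  define A where "A K = (\<lambda>x. indicator {x. K < norm x} x * \<bar>f x\<bar>)" for K
  have [measurable]: "A K \<in> borel_measurable borel" for K unfolding A_def by measurable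
  have iA: "integrable lborel (A K)" for K
    by (rule Bochner_Integration.integrable_bound[OF f]) (auto simp: A_def indicator_def)
  have "(\<lambda>i. LINT x|lborel. A (real i) x) \<longlonglongrightarrow> (LINT x|(lborel::'a measure). (0::real))"
  proof (rule integral_dominated_convergence[where w = "\<lambda>x. \<bar>f x\<bar>"])
    show "AE x in lborel. (\<lambda>i. A (real i) x) \<longlonglongrightarrow> 0"
    proof (rule AE_I2)
      fix x :: 'a
      obtain N :: nat where N: "norm x \<le> real N" using real_arch_simple by blast
      have "A (real i) x = 0" if "N \<le> i" for i
      proof -
        have "real N \<le> real i" using that by simp
        with N have "\<not> real i < norm x" by linarith
        then show ?thesis by (simp add: A_def)
      qed
      then have "eventually (\<lambda>i. A (real i) x = 0) sequentially"
        by (auto simp: eventually_sequentially)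
      then show "(\<lambda>i. A (real i) x) \<longlonglongrightarrow> 0" by (rule tendsto_eventually)
    qed
  qed (use f in \<open>auto simp: A_def indicator_def\<close>)
  then have "(\<lambda>i. LINT x|lborel. A (real i) x) \<longlonglongrightarrow> 0" by simp
  then have "eventually (\<lambda>i. (LINT x|lborel. A (real i) x) < m / 4) sequentially"
    by (rule order_tendstoD(2)) (use m in \<open>simp add: m_def\<close>)
  then obtain i where i: "(LINT x|lborel. A (real i) x) < m / 4"
    by (auto simp: eventually_sequentially)
  have "m / 2 \<le> (LINT x|lborel. f x * cutoff q J K x)" if K: "max 1 (real i) \<le> K" for K J
  proof -
    have K0: "0 < K" "real i \<le> K" using K by auto
    define c where "c = cutoff q J K (0::'a)"
    have c: "1 \<le> c" unfolding c_def by (rule cutoff_ge_1) (use K0 in auto)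
    have low: "c * f x - 2 * A (real i) x \<le> f x * cutoff q J K x" for x
    proof (cases "norm x \<le> K")
      case True
      then have "cutoff q J K x = c" unfolding c_def by (rule cutoff_plateau[OF K0(1)])
      then show ?thesis by (simp add: A_def)
    next
      case False
      have "\<bar>cutoff q J K x - c\<bar> \<le> 2"
        using cutoff_nonneg[of q J K x] cutoff_le_2[OF q, of J K x]
          cutoff_nonneg[of q J K "0::'a"] cutoff_le_2[OF q, of J K "0::'a"] by (simp add: c_def abs_le_iff)
      then have "\<bar>f x\<bar> * \<bar>cutoff q J K x - c\<bar> \<le> \<bar>f x\<bar> * 2" by (intro mult_left_mono) auto
      then have "\<bar>f x * cutoff q J K x - c * f x\<bar> \<le> 2 * \<bar>f x\<bar>"
        by (simp add: abs_mult[symmetric] algebra_simps)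
      then show ?thesis using False K0 by (simp add: A_def abs_le_iff)
    qed
    have iprod: "integrable lborel (\<lambda>x. f x * cutoff q J K x)"
    proof (rule Bochner_Integration.integrable_bound)
      show "integrable lborel (\<lambda>x. 2 * f x)" using f by simp
      show "AE x in lborel. norm (f x * cutoff q J K x) \<le> norm (2 * f x)"
      proof (rule AE_I2)
        fix x
        have "\<bar>f x\<bar> * \<bar>cutoff q J K x\<bar> \<le> \<bar>f x\<bar> * 2"
          using cutoff_nonneg[of q J K x] cutoff_le_2[OF q, of J K x] by (intro mult_left_mono) auto
        then show "norm (f x * cutoff q J K x) \<le> norm (2 * f x)" by (simp add: abs_mult)
      qed
    qed measurable
    have "m / 2 \<le> 1 * m - 2 * (m / 4)" by simp
    also have "\<dots> \<le> c * m - 2 * (LINT x|lborel. A (real i) x)"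
      using i c m by (intro diff_mono mult_right_mono mult_left_mono) (auto simp: m_def)
    also have "\<dots> = (LINT x|lborel. c * f x - 2 * A (real i) x)"
      using f iA[of "real i"] by (simp add: m_def)
    also have "\<dots> \<le> (LINT x|lborel. f x * cutoff q J K x)"
      by (rule integral_mono) (use f iA[of "real i"] iprod low in auto)
    finally show ?thesis .
  qed
  then show ?thesis unfolding m_def by (intro exI[of _ "max 1 (real i)"]) auto
qed

text \<open>Existence beyond the time K^(2\<sigma>-k^-) forces the data to be small; read
  contrapositively, this bounds the lifespan. The constants are fixed before \<epsilon>, K, T and u,
  which gives uniformity in \<epsilon>.\<close>

lemma solution_size_bound:
  fixes u1 :: "'a::euclidean_space \<Rightarrow> real"
  assumes \<sigma>: "1 \<le> \<sigma>" and \<delta>: "0 \<le> \<delta>" "\<delta> < \<sigma>" and p: "1 < p"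
    and u1: "integrable lborel u1" "0 < (LINT x|lborel. u1 x)"
  shows "\<exists>C\<ge>0. \<exists>K0\<ge>1. \<forall>\<epsilon> K T u. 0 < \<epsilon> \<longrightarrow> K0 \<le> K \<longrightarrow>
    ennreal (K powr (2 * \<sigma> - k_minus \<sigma> \<delta>)) < T \<longrightarrow> sobolev_solution \<sigma> \<delta> p (\<lambda>x. \<epsilon> * u1 x) T u \<longrightarrow>
    \<epsilon> \<le> C * K powr (- (2 * \<sigma> / (p - 1) - (real DIM('a) - k_minus \<sigma> \<delta>)))"
proof -
  define n where "n = real DIM('a)"
  have n: "1 \<le> n" by (simp add: n_def Suc_leI)
  \<comment> \<open>For \<delta> > 0 the smaller order \<delta> is the restrictive one; for \<delta>
    = 0 that operator is the identity and only \<sigma> limits q. Both choices exceed n.\<close>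
  define q where "q = n + (if \<delta> = 0 then 2 * \<sigma> else 2 * \<delta>)"
  have q: "n < q" "1 \<le> q" "q \<le> 2 * \<sigma> + n" "\<delta> = 0 \<or> q \<le> 2 * \<delta> + n"
    using n \<sigma> \<delta> by (auto simp: q_def)
  obtain g g1 g2 :: "real \<Rightarrow> real" and Cg where
    g: "\<And>k. C_k k g" "\<And>t. (g has_real_derivative g1 t) (at t)" "\<And>t. (g1 has_real_derivative g2 t) (at t)"
    "continuous_on UNIV g2" "\<And>t. 0 \<le> g t" "\<And>t. g t \<le> 1" "g 0 = 1" "\<And>t. 2 \<le> \<bar>t\<bar> \<Longrightarrow> g t = 0"
    "0 \<le> Cg" "\<And>t. \<bar>g1 t\<bar> \<le> Cg * g t powr (1 / p)" "\<And>t. \<bar>g2 t\<bar> \<le> Cg * g t powr (1 / p)"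
    using time_cutoff[OF p] by blast
  obtain C\<sigma> where C\<sigma>: "0 \<le> C\<sigma>" "\<And>J K x. 0 < K \<Longrightarrow> \<bar>frac_laplacian \<sigma> (cutoff q J K) (x::'a)\<bar>
      \<le> C\<sigma> * K powr (- 2 * \<sigma>) * (cutoff q J K x + tail q J K x)"
    using frac_laplacian_cutoff_bound[of \<sigma> q, where 'a = 'a] \<sigma> q by (auto simp: n_def)
  obtain C\<delta> where C\<delta>: "0 \<le> C\<delta>" "\<And>J K x. 0 < K \<Longrightarrow> \<bar>frac_laplacian \<delta> (cutoff q J K) (x::'a)\<bar>
      \<le> C\<delta> * K powr (- 2 * \<delta>) * (cutoff q J K x + tail q J K x)"
    using frac_laplacian_cutoff_bound[of \<delta> q, where 'a = 'a] \<delta> q by (auto simp: n_def)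
  obtain B where B: "0 \<le> B" "\<And>J K. 0 < K \<Longrightarrow> (LINT x|lborel. cutoff q J K (x::'a)) \<le> B * K ^ DIM('a)"
    using cutoff_integral_le[of q, where 'a = 'a] q by (auto simp: n_def)
  define m where "m = (LINT x|lborel. u1 x)"
  obtain K0 where K0: "1 \<le> K0" "\<And>K J. K0 \<le> K \<Longrightarrow> m / 2 \<le> (LINT x|lborel. u1 x * cutoff q J K x)"
    using cutoff_pairing_ge[OF u1 q(2)] by (auto simp: m_def)
  have m: "0 < m" using u1 by (simp add: m_def)
  define p' where "p' = p / (p - 1)"
  have p': "0 < p'" using p by (simp add: p'_def)
  \<comment> \<open>The 4 and the 2 come from the powers of 2 / R that differentiating
    \<open>g (2 / R * t)\<close> produces.\<close>
  define C0 where "C0 = 4 * Cg + C\<sigma> + 2 * Cg * C\<delta>"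
  have C0: "0 \<le> C0" using g(9) C\<sigma> C\<delta> by (simp add: C0_def)
  define k where "k = k_minus \<sigma> \<delta>"
  have k: "k \<le> \<sigma>" "k \<le> 2 * \<delta>" by (auto simp: k_def k_minus_def)
  define \<alpha> where "\<alpha> = 2 * \<sigma> - k"
  define C where "C = 2 * C0 powr p' * B / m"
  have main: "\<epsilon> \<le> C * K powr (- (2 * \<sigma> / (p - 1) - (n - k)))"
    if \<epsilon>: "0 < \<epsilon>" and K: "K0 \<le> K" and T: "ennreal (K powr \<alpha>) < T"
      and sol: "sobolev_solution \<sigma> \<delta> p (\<lambda>x. \<epsilon> * u1 x) T u" for \<epsilon> K T u
  proof -
    have K1: "1 \<le> K" "0 < K" using K K0 by auto
    define R where "R = K powr \<alpha>"
    have R: "0 < R" "ennreal R < T" using K1 T by (auto simp: R_def)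
    define a where "a = C\<sigma> * K powr (- 2 * \<sigma>)"
    define b where "b = C\<delta> * K powr (- 2 * \<delta>)"
    have ab: "0 \<le> a" "0 \<le> b" using C\<sigma> C\<delta> by (auto simp: a_def b_def)
    define D where "D = Cg * (2 / R)\<^sup>2 + a + Cg * (2 / R) * b"
    have D0: "0 \<le> D" using g(9) ab R by (simp add: D_def)
    \<comment> \<open>All three contributions are at most of order K^(-2\<sigma>): k \<le> \<sigma>
      gives \<alpha> \<ge> \<sigma> for the second time derivative, and k \<le> 2\<delta> gives
      \<alpha> \<ge> 2\<sigma> - 2\<delta> for the damping.\<close>
    have DK: "D \<le> C0 * K powr (- 2 * \<sigma>)"
    proof -
      have "R\<^sup>2 = K powr (2 * \<alpha>)" by (simp add: R_def power2_eq_square flip: powr_add)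
      then have "(2 / R)\<^sup>2 = 4 * K powr (- 2 * \<alpha>)" by (simp add: power_divide powr_minus_divide)
      also have "\<dots> \<le> 4 * K powr (- 2 * \<sigma>)"
        using powr_mono[of "- 2 * \<alpha>" "- 2 * \<sigma>" K] K1 k by (simp add: \<alpha>_def)
      finally have 1: "(2 / R)\<^sup>2 \<le> 4 * K powr (- 2 * \<sigma>)" .
      have "(2 / R) * K powr (- 2 * \<delta>) = 2 * K powr (- \<alpha> - 2 * \<delta>)"
        by (simp add: R_def powr_minus powr_diff divide_inverse)
      also have "\<dots> \<le> 2 * K powr (- 2 * \<sigma>)"
        using powr_mono[of "- \<alpha> - 2 * \<delta>" "- 2 * \<sigma>" K] K1 k by (simp add: \<alpha>_def)
      finally have 2: "(2 / R) * K powr (- 2 * \<delta>) \<le> 2 * K powr (- 2 * \<sigma>)" .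
      have "D = Cg * (2 / R)\<^sup>2 + C\<sigma> * K powr (- 2 * \<sigma>) + Cg * C\<delta> * ((2 / R) * K powr (- 2 * \<delta>))"
        by (simp add: D_def a_def b_def)
      also have "\<dots> \<le> Cg * (4 * K powr (- 2 * \<sigma>)) + C\<sigma> * K powr (- 2 * \<sigma>) + Cg * C\<delta> * (2 * K powr (- 2 * \<sigma>))"
        using g(9) C\<delta>(1) by (intro add_mono mult_left_mono 1 2 order_refl) auto
      also have "\<dots> = C0 * K powr (- 2 * \<sigma>)" by (simp add: C0_def algebra_simps)
      finally show ?thesis .
    qed
    have sub: "{0..R} \<subseteq> time_interval T"
    proof
      fix t assume t: "t \<in> {0..R}"
      then have "ennreal t \<le> ennreal R" by (intro ennreal_leI) auto
      then have "ennreal t < T" using R(2) by (rule le_less_trans)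
      then show "t \<in> time_interval T" using t by (simp add: time_interval_def)
    qed
    have "continuous_in_sobolev (time_interval T) (2 * \<sigma>) u"
      using sol by (simp add: sobolev_solution_def)
    then have "\<exists>N. \<forall>t\<in>{0..R}. (LINT x|lborel. (u t x)\<^sup>2) \<le> N"
      by (rule continuous_in_sobolev_L2_bounded) (use \<sigma> sub in auto)
    then obtain N where N: "\<And>t. t \<in> {0..R} \<Longrightarrow> (LINT x|lborel. (u t x)\<^sup>2) \<le> N" by blast
    define M where "M = R * (D powr p' * (B * K ^ DIM('a)))"
    define t where "t J = (LINT x|lborel. (tail q J K (x::'a))\<^sup>2)" for J
    have t: "t \<longlonglongrightarrow> 0"
      unfolding t_def using q K1 by (intro tail_sq_tendsto_0(2)) (auto simp: n_def)
    have est: "\<epsilon> * (m / 2) \<le> M + R * (D * (\<tau> * N + t J / \<tau>))" if \<tau>: "0 < \<tau>" for \<tau> J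
    proof -
      have "\<epsilon> * (m / 2) \<le> \<epsilon> * (LINT x|lborel. u1 x * cutoff q J K x)"
        using \<epsilon> by (intro mult_left_mono K0 K) auto
      also have "\<dots> = (LINT x|lborel. \<epsilon> * u1 x * cutoff q J K x)" by (simp add: mult.assoc)
      also have "\<dots> \<le> R * (D powr (p / (p - 1)) * (LINT x|lborel. cutoff q J K (x::'a)) + D * (\<tau> * N + t J / \<tau>))"
        unfolding t_def
      proof (rule weak_form_estimate[OF sol p R K1(1) _ g _ _ ab D_def N \<tau>])
        show "real DIM('a) \<le> q" using q by (simp add: n_def)
        show "\<bar>frac_laplacian \<sigma> (cutoff q J K) x\<bar> \<le> a * (cutoff q J K x + tail q J K x)" for x :: 'a
          unfolding a_def by (rule C\<sigma>(2)[OF K1(2)])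
        show "\<bar>frac_laplacian \<delta> (cutoff q J K) x\<bar> \<le> b * (cutoff q J K x + tail q J K x)" for x :: 'a
          unfolding b_def by (rule C\<delta>(2)[OF K1(2)])
      qed
      also have "\<dots> \<le> R * (D powr p' * (B * K ^ DIM('a)) + D * (\<tau> * N + t J / \<tau>))"
        unfolding p'_def using R by (intro mult_left_mono add_right_mono B K1) auto
      also have "\<dots> = M + R * (D * (\<tau> * N + t J / \<tau>))" by (simp add: M_def distrib_left)
      finally show ?thesis .
    qed
    have est2: "\<epsilon> * (m / 2) \<le> M + R * (D * (\<tau> * N + 0 / \<tau>))" if \<tau>: "0 < \<tau>" for \<tau>
    proof (rule LIMSEQ_le_const)
      show "(\<lambda>J. M + R * (D * (\<tau> * N + t J / \<tau>))) \<longlonglongrightarrow> M + R * (D * (\<tau> * N + 0 / \<tau>))"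
        by (intro tendsto_intros t) (use \<tau> in auto)
    qed (use est[OF \<tau>] in auto)
    have "\<epsilon> * (m / 2) \<le> M + R * (D * (0 * N))"
    proof (rule LIMSEQ_le_const)
      show "(\<lambda>i. M + R * (D * (1 / real (Suc i) * N))) \<longlonglongrightarrow> M + R * (D * (0 * N))"
        by (intro tendsto_intros LIMSEQ_Suc[OF lim_1_over_n])
      show "\<exists>N0. \<forall>i\<ge>N0. \<epsilon> * (m / 2) \<le> M + R * (D * (1 / real (Suc i) * N))"
      proof (intro exI allI impI)
        fix i show "\<epsilon> * (m / 2) \<le> M + R * (D * (1 / real (Suc i) * N))"
          using est2[of "1 / real (Suc i)"] by simp
      qed
    qed
    then have "\<epsilon> * (m / 2) \<le> M" by simp
    also have "M \<le> R * ((C0 * K powr (- 2 * \<sigma>)) powr p' * (B * K ^ DIM('a)))"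
      unfolding M_def using R B(1) K1 D0 DK p' by (intro mult_left_mono mult_right_mono powr_mono2) auto
    also have "\<dots> = C0 powr p' * B * (K powr \<alpha> * K powr (- 2 * \<sigma> * p') * K powr n)"
      using C0 K1 by (simp add: R_def n_def powr_mult powr_powr powr_realpow mult_ac)
    also have "K powr \<alpha> * K powr (- 2 * \<sigma> * p') * K powr n = K powr (\<alpha> + - 2 * \<sigma> * p' + n)"
      by (simp only: powr_add)
    \<comment> \<open>Since p / (p - 1) = 1 + 1 / (p - 1), one 2\<sigma> cancels against that in
      \<alpha>.\<close>
    also have "\<alpha> + - 2 * \<sigma> * p' + n = - (2 * \<sigma> / (p - 1) - (n - k))"
      using p by (simp add: \<alpha>_def p'_def field_simps)
    finally have "\<epsilon> * (m / 2) \<le> C0 powr p' * B * K powr (- (2 * \<sigma> / (p - 1) - (n - k)))" .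
    then show ?thesis using m by (simp add: C_def field_simps)
  qed
  have "0 \<le> C" using B m by (simp add: C_def)
  with main K0(1) show ?thesis unfolding n_def k_def \<alpha>_def by blast
qed

text \<open>If T exceeded K^\<alpha> for the K with K^s = A / \<epsilon>, the size bound would give
  \<epsilon> \<le> C1 \<epsilon> / A, impossible once A > C1. Expressing K^\<alpha> through
  \<epsilon> yields the exponent \<alpha> / s.\<close>

theorem mainTheorem2:
  fixes \<sigma> \<delta> p :: real
    and u1 :: "real ^ 'n \<Rightarrow> real"
  assumes "1 \<le> \<sigma>"
    and "0 \<le> \<delta>" and "\<delta> < \<sigma>"
    and "2 * k_minus \<sigma> \<delta> < real CARD('n)"
    and "integrable lborel u1"
    and "0 < (LINT x|lborel. u1 x)"
    and "1 < p" and "p < 1 + 2 * \<sigma> / (real CARD('n) - k_minus \<sigma> \<delta>)"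
  shows "\<exists>\<epsilon>0>0. \<exists>C>0. \<forall>\<epsilon>::real. 0 < \<epsilon> \<and> \<epsilon> \<le> \<epsilon>0 \<longrightarrow>
    lifespan \<sigma> \<delta> p u1 \<epsilon> \<le>
      ennreal (C * \<epsilon> powr
        (- ((2 * \<sigma> - k_minus \<sigma> \<delta>) * (p - 1)
            / (2 * \<sigma> - (real CARD('n) - k_minus \<sigma> \<delta>) * (p - 1)))))"
proof -
  define k where "k = k_minus \<sigma> \<delta>"
  define n where "n = real CARD('n)"
  define \<alpha> where "\<alpha> = 2 * \<sigma> - k"
  define s where "s = 2 * \<sigma> / (p - 1) - (n - k)"
  have k: "0 \<le> k" "k \<le> \<sigma>" using assms by (auto simp: k_def k_minus_def)
  have nk: "0 < n - k" using assms(4) k by (simp add: n_def k_def)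
  have p: "0 < p - 1" using assms(7) by simp
  have "p - 1 < 2 * \<sigma> / (n - k)" using assms(8) by (simp add: n_def k_def)
  then have "(p - 1) * (n - k) < 2 * \<sigma>" using nk by (simp add: pos_less_divide_eq)
  \<comment> \<open>The subcritical range of p enters here: it makes K^(-s) decay as K
    grows.\<close>
  then have s: "0 < s" using p by (simp add: s_def pos_less_divide_eq mult.commute)
  have \<alpha>: "0 < \<alpha>" using k assms(1) by (simp add: \<alpha>_def)
  have expo: "(2 * \<sigma> - k) * (p - 1) / (2 * \<sigma> - (n - k) * (p - 1)) = \<alpha> / s"
  proof -
    have "s * (p - 1) = 2 * \<sigma> - (n - k) * (p - 1)" using p by (simp add: s_def left_diff_distrib)
    then show ?thesis using p by (simp add: \<alpha>_def flip: \<open>s * (p - 1) = _\<close>)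
  qed
  obtain C1 K0 where C1: "0 \<le> C1" and K0: "1 \<le> K0" and bound:
    "\<And>\<epsilon> K T u. 0 < \<epsilon> \<Longrightarrow> K0 \<le> K \<Longrightarrow> ennreal (K powr \<alpha>) < T \<Longrightarrow>
       sobolev_solution \<sigma> \<delta> p (\<lambda>x. \<epsilon> * u1 x) T u \<Longrightarrow> \<epsilon> \<le> C1 * K powr (- s)"
  proof -
    have dim: "DIM(real ^ 'n) = CARD('n)" by simp
    show thesis
      using solution_size_bound[OF assms(1,2,3,7,5,6)] that
      unfolding dim \<alpha>_def s_def k_def n_def by blast
  qed
  \<comment> \<open>The first entry ensures K \<ge> K0 for all \<epsilon> \<le> 1; together with A
    \<ge> 1, the second gives A > C1, also when C1 = 0.\<close>
  define A where "A = max (K0 powr s) (2 * C1)"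
  have "1 \<le> K0 powr s" using K0 s by (intro ge_one_powr_ge_zero) auto
  then have A: "1 \<le> A" "K0 powr s \<le> A" "2 * C1 \<le> A" by (auto simp: A_def)
  have "lifespan \<sigma> \<delta> p u1 \<epsilon> \<le> ennreal (A powr (\<alpha> / s) * \<epsilon> powr (- (\<alpha> / s)))"
    if \<epsilon>: "0 < \<epsilon>" "\<epsilon> \<le> 1" for \<epsilon>
    unfolding lifespan_def
  proof (rule Sup_least)
    fix T assume "T \<in> {T. 0 < T \<and> (\<exists>u. sobolev_solution \<sigma> \<delta> p (\<lambda>x. \<epsilon> * u1 x) T u)}"
    then obtain u where sol: "sobolev_solution \<sigma> \<delta> p (\<lambda>x. \<epsilon> * u1 x) T u" by blast
    show "T \<le> ennreal (A powr (\<alpha> / s) * \<epsilon> powr (- (\<alpha> / s)))"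
    proof (rule ccontr)
      assume "\<not> ?thesis"
      then have T: "ennreal (A powr (\<alpha> / s) * \<epsilon> powr (- (\<alpha> / s))) < T" by simp
      define K where "K = (A / \<epsilon>) powr (1 / s)"
      have "K powr \<alpha> = (A / \<epsilon>) powr (\<alpha> / s)" by (simp add: K_def powr_powr)
      also have "\<dots> = A powr (\<alpha> / s) * \<epsilon> powr (- (\<alpha> / s))"
        unfolding powr_divide powr_minus by (rule divide_inverse)
      finally have K\<alpha>: "ennreal (K powr \<alpha>) < T" using T by simp
      have "A * \<epsilon> \<le> A * 1" using A \<epsilon> by (intro mult_left_mono) auto
      then have "A \<le> A / \<epsilon>" using \<epsilon> by (simp add: pos_le_divide_eq)
      then have "K0 powr s \<le> A / \<epsilon>" using A by linarith
      then have "(K0 powr s) powr (1 / s) \<le> K" unfolding K_def using s by (intro powr_mono2) auto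
      then have "K0 \<le> K" using K0 s by (simp add: powr_powr)
      from bound[OF \<epsilon>(1) this K\<alpha> sol] have "\<epsilon> \<le> C1 * K powr (- s)" .
      also have "K powr (- s) = \<epsilon> / A"
        using s A \<epsilon> by (simp add: K_def powr_powr powr_minus_divide)
      finally have "A \<le> C1" using \<epsilon> A by (simp add: field_simps)
      with A C1 show False by linarith
    qed
  qed
  moreover have "0 < A powr (\<alpha> / s)" using A by simp
  ultimately show ?thesis
    unfolding expo[unfolded k_def n_def] by (intro exI[of _ 1] conjI exI[of _ "A powr (\<alpha> / s)"]) auto
qed

end
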